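(* Let $(J,K,\tau_0,V,W,\tau_1,R,S)$ be data as described in the context, with $V$ and $W$ finite-dimensional, and let $\mathcal{B}$ be the associated generalized $q$-boson algebra. Assume that $\tau_1$ is non-degenerate, and that $R$, $S$ are both Nichols algebras (of $V$, $W$ respectively). Then the functors $$(\ )_0:\mathcal{O}(\mathcal{B})\to\mathrm{Vec},\ M\mapsto M_0,\qquad R\otimes:\mathrm{Vec}\to\mathcal{O}(\mathcal{B}),\ X\mapsto R\otimes X$$ are quasi-inverses of each other, so that there is a category equivalence $\mathcal{O}(\mathcal{B})\approx\mathrm{Vec}$.
   Context: Let $k$ be a field of arbitrary characteristic; everything is over $k$, and gradings are by $\mathbb{N}=\{0,1,2,\dots\}$ unless otherwise stated. For a Hopf algebra $J$ with bijective antipode $\mathcal{S}$, write $\Delta(a)=a_1\otimes a_2$. ${}_J^J\mathcal{YD}$ is the braided tensor category of Yetter–Drinfeld modules over $J$: left $J$-modules $V$ (action $a\rightharpoonup v$) with a left $J$-comodule structure $v\mapsto v_J\otimes v_V$ such that $a\rightharpoonup v\mapsto a_1v_J\mathcal{S}(a_3)\otimes(a_2\rightharpoonup v_V)$; the braiding is $c(v\otimes w)=(v_J\rightharpoonup w)\otimes v_V$. The tensor algebra $T(V)$ is a braided graded Hopf algebra in ${}_J^J\mathcal{YD}$ in which elements of $V$ are primitive. A pre-Nichols algebra of $V$ is a quotient $R=T(V)/I=\bigoplus_{n\ge 0}R(n)$ by a homogeneous bi-ideal $I$ in ${}_J^J\mathcal{YD}$ with $I\cap V=0$ (equivalently, a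 braided graded bialgebra with $R(0)=k$, $R(1)=V$, generated by $R(1)$). It is the Nichols algebra of $V$ if $I$ is largest possible, equivalently if $R(1)$ equals the space $P(R)$ of all primitives. The coproduct of $R$ is written $\Delta_R(r)=r_{(1)}\otimes r_{(2)}$. The bosonization $R\rtimes J$ (Radford biproduct) is the Hopf algebra on $R\otimes J$ (write $ra=r\otimes a$) with $(ra)(sb)=r(a_1\rightharpoonup s)(a_2b)$ and $\Delta(ra)=r_{(1)}(r_{(2)J}a_1)\otimes r_{(2)R}a_2$. A skew pairing of Hopf algebras $A,X$ (with bijective antipodes) is a linear form $\tau:A\otimes X\to k$ with $\tau(ab,x)=\tau(a,x_1)\tau(b,x_2)$, $\tau(a,xy)=\tau(a_1,y)\tau(a_2,x)$, $\tau(1,x)=\varepsilon(x)$, $\tau(a,1)=\varepsilon(a)$. Data: $J,K$ are Hopf algebras with bijective antipodes; $\tau_0:J\otimes K\to k$ is a skew pairing; $V\in{}_J^J\mathcal{YD}$, $W\in{}_K^K\mathcal{YD}$; $\tau_1:V\otimes W\to k$ is a linear form with $\tau_1(a\rightharpoonup v,w)=\tau_0(a,w_K)\tau_1(v,w_W)$ and $\tau_1(v,x\rightharpoonup w)=\tau_0(v_J,\mathcal{S}(x))\tau_1(v_V,w)$ for all $a\in J,x\in K,v\in V,w\in W$; $R,S$ are pre-Nichols algebras of $V,W$ respectively. Then $\tau_0,\tau_1$ extend uniquely to a skew pairing $\tau:(R\rtimes J)\otimes(S\rtimes K)\to k$ with $\tau(a,w)=0=\tau(v,x)$ for $a\in J$,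 $x\in K$, $v\in V$, $w\in W$. The generalized $q$-boson algebra $\mathcal{B}$ is the unique algebra structure on the vector space $R\otimes S$ with unit $1\otimes 1$ that includes $R=R\otimes k$ and $S=k\otimes S$ as subalgebras and satisfies $rs=r\otimes s$ ($r\in R,s\in S$) and $wv=\tau_0(v_J,w_K)\,v_V\otimes w_W+\tau_1(v,w)\,1\otimes 1$ ($v\in V,w\in W$). $R$ is a left $\mathcal{B}$-module on which $R\subset\mathcal{B}$ acts by left multiplication and $s\in S$ acts by $s\triangleright r=\tau(r_{(1)},s)r_{(2)}$. A left $\mathcal{B}$-module $M$ is integrable if each $m\in M$ is annihilated by $S(n)$ for some sufficiently large integer $n>0$ (which may depend on $m$). $\mathcal{O}(\mathcal{B})$ is the full subcategory of left $\mathcal{B}$-modules consisting of the integrable modules. $\mathrm{Vec}$ is the category of $k$-vector spaces. For a left $\mathcal{B}$-module $M$, $M_0=\{m\in M\mid S(1)m=0\}$. For a vector space $X$, $R\otimes X$ is a left $\mathcal{B}$-module with $\mathcal{B}$ acting on the factor $R$; it is integrable. *)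

theory Defs
  imports Complex_Main "HOL-Library.Function_Algebras" "HOL-Library.FuncSet"
begin

section \<open>Tensors and Sweedler sums\<close>

text \<open>
  The ground field is a type \<open>'k::field\<close>.  The Hopf algebras, Yetter-Drinfeld modules and
  (pre-)Nichols algebras are full types carrying an explicit scalar multiplication; for algebras
  the ring structure is the one of the class \<^class>\<open>ring_1\<close> (a Hopf algebra is never the
  zero ring because of its counit).

  An element of \<open>A \<otimes> B\<close> is represented by its values on bilinear forms.  Over a field
  \<open>A \<otimes> B\<close> embeds in this way into the dual of the space of bilinear forms.  The value on a
  function that is not a bilinear form is set to 0.
\<close>

type_synonym ('k, 'a, 'b) tensor = "('a \<Rightarrow> 'b \<Rightarrow> 'k) \<Rightarrow> 'k"

definition bilinear_map ::
  "('k::field \<Rightarrow> 'a::ab_group_add \<Rightarrow> 'a) \<Rightarrow> ('k \<Rightarrow> 'b::ab_group_add \<Rightarrow> 'b) \<Rightarrow>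
   ('k \<Rightarrow> 'c::ab_group_add \<Rightarrow> 'c) \<Rightarrow> ('a \<Rightarrow> 'b \<Rightarrow> 'c) \<Rightarrow> bool" where
  "bilinear_map sA sB sC f \<longleftrightarrow>
     (\<forall>b. Vector_Spaces.linear sA sC (\<lambda>a. f a b)) \<and> (\<forall>a. Vector_Spaces.linear sB sC (f a))"

definition tensor_of ::
  "('k::field \<Rightarrow> 'a::ab_group_add \<Rightarrow> 'a) \<Rightarrow> ('k \<Rightarrow> 'b::ab_group_add \<Rightarrow> 'b) \<Rightarrow>
   ('a \<times> 'b) list \<Rightarrow> ('k, 'a, 'b) tensor" where
  "tensor_of sA sB ps =
     (\<lambda>\<beta>. if bilinear_map sA sB (*) \<beta> then (\<Sum>(a, b)\<leftarrow>ps. \<beta> a b) else 0)"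

abbreviation pure_tensor ::
  "('k::field \<Rightarrow> 'a::ab_group_add \<Rightarrow> 'a) \<Rightarrow> ('k \<Rightarrow> 'b::ab_group_add \<Rightarrow> 'b) \<Rightarrow>
   'a \<Rightarrow> 'b \<Rightarrow> ('k, 'a, 'b) tensor" where
  "pure_tensor sA sB a b \<equiv> tensor_of sA sB [(a, b)]"

abbreviation tensor_space ::
  "('k::field \<Rightarrow> 'a::ab_group_add \<Rightarrow> 'a) \<Rightarrow> ('k \<Rightarrow> 'b::ab_group_add \<Rightarrow> 'b) \<Rightarrow>
   ('k, 'a, 'b) tensor set" where
  "tensor_space sA sB \<equiv> range (tensor_of sA sB)"

definition tscale :: "'k::field \<Rightarrow> ('x \<Rightarrow> 'k) \<Rightarrow> ('x \<Rightarrow> 'k)" where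
  "tscale c t = (\<lambda>\<beta>. c * t \<beta>)"

text \<open>
  For \<open>t = \<Sum>\<^sub>i a\<^sub>i \<otimes> b\<^sub>i\<close> this is \<open>\<Sum>\<^sub>i F a\<^sub>i b\<^sub>i\<close>.  It is only used for maps \<open>F\<close> that are bilinear, so
  that the choice of the representation is immaterial.
\<close>

definition sweedler ::
  "('k::field \<Rightarrow> 'a::ab_group_add \<Rightarrow> 'a) \<Rightarrow> ('k \<Rightarrow> 'b::ab_group_add \<Rightarrow> 'b) \<Rightarrow>
   ('k, 'a, 'b) tensor \<Rightarrow> ('a \<Rightarrow> 'b \<Rightarrow> 'c::ab_group_add) \<Rightarrow> 'c" where
  "sweedler sA sB t F = (\<Sum>(a, b)\<leftarrow>(SOME ps. t = tensor_of sA sB ps). F a b)"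


section \<open>Hopf algebras\<close>

record ('k, 'a) hopf =
  hscale :: "'k \<Rightarrow> 'a \<Rightarrow> 'a"
  hcomult :: "'a \<Rightarrow> ('k, 'a, 'a) tensor"
  hcounit :: "'a \<Rightarrow> 'k"
  antipode :: "'a \<Rightarrow> 'a"

definition unital_algebra :: "('k::field \<Rightarrow> 'a::ring_1 \<Rightarrow> 'a) \<Rightarrow> bool" where
  "unital_algebra s \<longleftrightarrow> vector_space s \<and>
     (\<forall>c a b. s c a * b = s c (a * b) \<and> a * s c b = s c (a * b))"

definition coalgebra ::
  "('k::field \<Rightarrow> 'a::ab_group_add \<Rightarrow> 'a) \<Rightarrow> ('a \<Rightarrow> ('k, 'a, 'a) tensor) \<Rightarrow> ('a \<Rightarrow> 'k) \<Rightarrow> bool" where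
  "coalgebra s \<Delta> \<epsilon> \<longleftrightarrow>
     vector_space s \<and> range \<Delta> \<subseteq> tensor_space s s \<and>
     Vector_Spaces.linear s tscale \<Delta> \<and> Vector_Spaces.linear s (*) \<epsilon> \<and>
     (\<forall>a. sweedler s s (\<Delta> a) (\<lambda>a' a3. sweedler s s (\<Delta> a') (\<lambda>a1 a2.
              pure_tensor s tscale a1 (pure_tensor s s a2 a3)))
        = sweedler s s (\<Delta> a) (\<lambda>a1 a'. pure_tensor s tscale a1 (\<Delta> a'))) \<and>
     (\<forall>a. sweedler s s (\<Delta> a) (\<lambda>a1 a2. s (\<epsilon> a1) a2) = a \<and>
          sweedler s s (\<Delta> a) (\<lambda>a1 a2. s (\<epsilon> a2) a1) = a)"

definition sw :: "('k::field, 'a::ring_1) hopf \<Rightarrow> 'a \<Rightarrow> ('a \<Rightarrow> 'a \<Rightarrow> 'c::ab_group_add) \<Rightarrow> 'c" where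
  "sw H a F = sweedler (hscale H) (hscale H) (hcomult H a) F"

definition hopf_algebra :: "('k::field, 'a::ring_1) hopf \<Rightarrow> bool" where
  "hopf_algebra H \<longleftrightarrow>
     unital_algebra (hscale H) \<and>
     coalgebra (hscale H) (hcomult H) (hcounit H) \<and>
     (\<forall>a b. hcomult H (a * b) =
        sw H a (\<lambda>a1 a2. sw H b (\<lambda>b1 b2.
          pure_tensor (hscale H) (hscale H) (a1 * b1) (a2 * b2)))) \<and>
     hcomult H 1 = pure_tensor (hscale H) (hscale H) 1 1 \<and>
     (\<forall>a b. hcounit H (a * b) = hcounit H a * hcounit H b) \<and> hcounit H 1 = 1 \<and>
     Vector_Spaces.linear (hscale H) (hscale H) (antipode H) \<and>
     (\<forall>a. sw H a (\<lambda>a1 a2. antipode H a1 * a2) = hscale H (hcounit H a) 1 \<and>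
          sw H a (\<lambda>a1 a2. a1 * antipode H a2) = hscale H (hcounit H a) 1)"

definition skew_pairing ::
  "('k::field, 'a::ring_1) hopf \<Rightarrow> ('k, 'x::ring_1) hopf \<Rightarrow> ('a \<Rightarrow> 'x \<Rightarrow> 'k) \<Rightarrow> bool" where
  "skew_pairing A X \<tau> \<longleftrightarrow>
     bilinear_map (hscale A) (hscale X) (*) \<tau> \<and>
     (\<forall>a b x. \<tau> (a * b) x = sw X x (\<lambda>x1 x2. \<tau> a x1 * \<tau> b x2)) \<and>
     (\<forall>a x y. \<tau> a (x * y) = sw A a (\<lambda>a1 a2. \<tau> a1 y * \<tau> a2 x)) \<and>
     (\<forall>x. \<tau> 1 x = hcounit X x) \<and> (\<forall>a. \<tau> a 1 = hcounit A a)"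


section \<open>Yetter-Drinfeld modules, pre-Nichols and Nichols algebras\<close>

record ('k, 'j, 'v) yd =
  yscale :: "'k \<Rightarrow> 'v \<Rightarrow> 'v"
  yact :: "'j \<Rightarrow> 'v \<Rightarrow> 'v"
  ycoact :: "'v \<Rightarrow> ('k, 'j, 'v) tensor"

definition co ::
  "('k::field, 'j::ring_1) hopf \<Rightarrow> ('k, 'j, 'v::ab_group_add, 'more) yd_scheme \<Rightarrow> 'v \<Rightarrow>
   ('j \<Rightarrow> 'v \<Rightarrow> 'c::ab_group_add) \<Rightarrow> 'c" where
  "co J V v F = sweedler (hscale J) (yscale V) (ycoact V v) F"

definition yetter_drinfeld ::
  "('k::field, 'j::ring_1) hopf \<Rightarrow> ('k, 'j, 'v::ab_group_add, 'more) yd_scheme \<Rightarrow> bool" where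
  "yetter_drinfeld J V \<longleftrightarrow>
     vector_space (yscale V) \<and>
     bilinear_map (hscale J) (yscale V) (yscale V) (yact V) \<and>
     (\<forall>v. yact V 1 v = v) \<and> (\<forall>a b v. yact V (a * b) v = yact V a (yact V b v)) \<and>
     range (ycoact V) \<subseteq> tensor_space (hscale J) (yscale V) \<and>
     Vector_Spaces.linear (yscale V) tscale (ycoact V) \<and>
     (\<forall>v. co J V v (\<lambda>j u. sw J j (\<lambda>j1 j2.
              pure_tensor (hscale J) tscale j1 (pure_tensor (hscale J) (yscale V) j2 u)))
        = co J V v (\<lambda>j u. pure_tensor (hscale J) tscale j (ycoact V u))) \<and>
     (\<forall>v. co J V v (\<lambda>j u. yscale V (hcounit J j) u) = v) \<and>
     (\<forall>a v. ycoact V (yact V a v) =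
        sw J a (\<lambda>a1 a'. sw J a' (\<lambda>a2 a3. co J V v (\<lambda>j u.
          pure_tensor (hscale J) (yscale V) (a1 * j * antipode J a3) (yact V a2 u)))))"

record ('k, 'j, 'r) graded_yd_bialg = "('k, 'j, 'r) yd" +
  bcomult :: "'r \<Rightarrow> ('k, 'r, 'r) tensor"
  bcounit :: "'r \<Rightarrow> 'k"
  grade :: "nat \<Rightarrow> 'r set"

definition bsw ::
  "('k::field, 'j, 'r::ring_1) graded_yd_bialg \<Rightarrow> 'r \<Rightarrow> ('r \<Rightarrow> 'r \<Rightarrow> 'c::ab_group_add) \<Rightarrow> 'c" where
  "bsw R r F = sweedler (yscale R) (yscale R) (bcomult R r) F"

text \<open>
  A bialgebra in the braided category of Yetter-Drinfeld modules: all structure maps are linear and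
  colinear, and the coproduct is multiplicative for the product
  \<open>(r \<otimes> s)(r' \<otimes> s') = r (s\<^sub>J \<rightharpoonup> r') \<otimes> s\<^sub>R s'\<close> on \<open>R \<otimes> R\<close>.
\<close>

definition braided_bialgebra ::
  "('k::field, 'j::ring_1) hopf \<Rightarrow> ('k, 'j, 'r::ring_1) graded_yd_bialg \<Rightarrow> bool" where
  "braided_bialgebra J R \<longleftrightarrow>
     yetter_drinfeld J R \<and> unital_algebra (yscale R) \<and>
     coalgebra (yscale R) (bcomult R) (bcounit R) \<and>
     (\<forall>a r s. yact R a (r * s) = sw J a (\<lambda>a1 a2. yact R a1 r * yact R a2 s)) \<and>
     (\<forall>a. yact R a 1 = yscale R (hcounit J a) 1) \<and>
     (\<forall>r s. ycoact R (r * s) = co J R r (\<lambda>j r'. co J R s (\<lambda>j' s'.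
        pure_tensor (hscale J) (yscale R) (j * j') (r' * s')))) \<and>
     ycoact R 1 = pure_tensor (hscale J) (yscale R) 1 1 \<and>
     (\<forall>a r. bcomult R (yact R a r) = sw J a (\<lambda>a1 a2. bsw R r (\<lambda>r1 r2.
        pure_tensor (yscale R) (yscale R) (yact R a1 r1) (yact R a2 r2)))) \<and>
     (\<forall>a r. bcounit R (yact R a r) = hcounit J a * bcounit R r) \<and>
     (\<forall>r. co J R r (\<lambda>j r'. pure_tensor (hscale J) tscale j (bcomult R r')) =
        bsw R r (\<lambda>r1 r2. co J R r1 (\<lambda>j u. co J R r2 (\<lambda>j' u'.
          pure_tensor (hscale J) tscale (j * j') (pure_tensor (yscale R) (yscale R) u u'))))) \<and>
     (\<forall>r. co J R r (\<lambda>j r'. hscale J (bcounit R r') j) = hscale J (bcounit R r) 1) \<and>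
     (\<forall>r s. bcomult R (r * s) =
        bsw R r (\<lambda>r1 r2. bsw R s (\<lambda>s1 s2. co J R r2 (\<lambda>j u.
          pure_tensor (yscale R) (yscale R) (r1 * yact R j s1) (u * s2))))) \<and>
     bcomult R 1 = pure_tensor (yscale R) (yscale R) 1 1 \<and>
     (\<forall>r s. bcounit R (r * s) = bcounit R r * bcounit R s) \<and> bcounit R 1 = 1"

definition graded_braided_bialgebra ::
  "('k::field, 'j::ring_1) hopf \<Rightarrow> ('k, 'j, 'r::ring_1) graded_yd_bialg \<Rightarrow> bool" where
  "graded_braided_bialgebra J R \<longleftrightarrow>
     braided_bialgebra J R \<and>
     (\<forall>n. module.subspace (yscale R) (grade R n)) \<and>
     (\<forall>r. \<exists>!f. (\<forall>n. f n \<in> grade R n) \<and> finite {n. f n \<noteq> 0} \<and> r = (\<Sum>n | f n \<noteq> 0. f n)) \<and>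
     (\<forall>n a. \<forall>r\<in>grade R n. yact R a r \<in> grade R n) \<and>
     (\<forall>n. \<forall>r\<in>grade R n. \<exists>ps. (\<forall>(j, u)\<in>set ps. u \<in> grade R n) \<and>
        ycoact R r = tensor_of (hscale J) (yscale R) ps) \<and>
     1 \<in> grade R 0 \<and>
     (\<forall>m n. \<forall>r\<in>grade R m. \<forall>s\<in>grade R n. r * s \<in> grade R (m + n)) \<and>
     (\<forall>n. \<forall>r\<in>grade R n. \<exists>ps.
        (\<forall>(p, q)\<in>set ps. \<exists>i j. i + j = n \<and> p \<in> grade R i \<and> q \<in> grade R j) \<and>
        bcomult R r = tensor_of (yscale R) (yscale R) ps) \<and>
     (\<forall>n>0. \<forall>r\<in>grade R n. bcounit R r = 0)"

text \<open>
  The identification of \<open>V\<close> with \<open>R(1)\<close> is an explicit isomorphism \<open>\<iota>\<close> of Yetter-Drinfeld modules.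
\<close>

definition pre_nichols ::
  "('k::field, 'j::ring_1) hopf \<Rightarrow> ('k, 'j, 'v::ab_group_add) yd \<Rightarrow>
   ('k, 'j, 'r::ring_1) graded_yd_bialg \<Rightarrow> ('v \<Rightarrow> 'r) \<Rightarrow> bool" where
  "pre_nichols J V R \<iota> \<longleftrightarrow>
     graded_braided_bialgebra J R \<and>
     grade R 0 = range (\<lambda>c. yscale R c 1) \<and>
     Vector_Spaces.linear (yscale V) (yscale R) \<iota> \<and> bij_betw \<iota> UNIV (grade R 1) \<and>
     (\<forall>a v. \<iota> (yact V a v) = yact R a (\<iota> v)) \<and>
     (\<forall>v. ycoact R (\<iota> v) =
        co J V v (\<lambda>j u. pure_tensor (hscale J) (yscale R) j (\<iota> u))) \<and>
     (\<forall>U. module.subspace (yscale R) U \<and> 1 \<in> U \<and> (\<forall>r\<in>U. \<forall>s\<in>U. r * s \<in> U) \<and> grade R 1 \<subseteq> U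
        \<longrightarrow> U = UNIV)"

definition primitives :: "('k::field, 'j, 'r::ring_1) graded_yd_bialg \<Rightarrow> 'r set" where
  "primitives R = {r. bcomult R r =
     pure_tensor (yscale R) (yscale R) r 1 + pure_tensor (yscale R) (yscale R) 1 r}"

definition nichols ::
  "('k::field, 'j::ring_1) hopf \<Rightarrow> ('k, 'j, 'v::ab_group_add) yd \<Rightarrow>
   ('k, 'j, 'r::ring_1) graded_yd_bialg \<Rightarrow> ('v \<Rightarrow> 'r) \<Rightarrow> bool" where
  "nichols J V R \<iota> \<longleftrightarrow> pre_nichols J V R \<iota> \<and> grade R 1 = primitives R"


section \<open>Vector spaces with a carrier, and tensor products\<close>

text \<open>
  These are the objects of the category of vector spaces: their underlying sets are subsets of a type
  \<open>'u\<close>, their operations are arbitrary.  Linear maps are taken extensional, so that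
  equality of maps is equality of HOL functions.
\<close>

record ('k, 'u) vs =
  carrier :: "'u set"
  add :: "'u \<Rightarrow> 'u \<Rightarrow> 'u"
  zero :: "'u"
  smul :: "'k \<Rightarrow> 'u \<Rightarrow> 'u"

definition vspace :: "('k::field, 'u, 'more) vs_scheme \<Rightarrow> bool" where
  "vspace X \<longleftrightarrow>
     zero X \<in> carrier X \<and>
     (\<forall>x\<in>carrier X. \<forall>y\<in>carrier X. add X x y \<in> carrier X \<and> add X x y = add X y x) \<and>
     (\<forall>x\<in>carrier X. \<forall>y\<in>carrier X. \<forall>z\<in>carrier X. add X (add X x y) z = add X x (add X y z)) \<and>
     (\<forall>x\<in>carrier X. add X (zero X) x = x) \<and>
     (\<forall>x\<in>carrier X. \<exists>y\<in>carrier X. add X x y = zero X) \<and>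
     (\<forall>c. \<forall>x\<in>carrier X. smul X c x \<in> carrier X) \<and>
     (\<forall>c. \<forall>x\<in>carrier X. \<forall>y\<in>carrier X. smul X c (add X x y) = add X (smul X c x) (smul X c y)) \<and>
     (\<forall>c d. \<forall>x\<in>carrier X. smul X (c + d) x = add X (smul X c x) (smul X d x)) \<and>
     (\<forall>c d. \<forall>x\<in>carrier X. smul X (c * d) x = smul X c (smul X d x)) \<and>
     (\<forall>x\<in>carrier X. smul X 1 x = x)"

definition full :: "('k \<Rightarrow> 'a::ab_group_add \<Rightarrow> 'a) \<Rightarrow> ('k, 'a) vs" where
  "full s = \<lparr>carrier = UNIV, add = (+), zero = 0, smul = s\<rparr>"

definition lin :: "('k::field, 'a, 'm1) vs_scheme \<Rightarrow> ('k, 'b, 'm2) vs_scheme \<Rightarrow> ('a \<Rightarrow> 'b) set" where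
  "lin X Y = {f \<in> carrier X \<rightarrow>\<^sub>E carrier Y.
     (\<forall>x\<in>carrier X. \<forall>y\<in>carrier X. f (add X x y) = add Y (f x) (f y)) \<and>
     (\<forall>c. \<forall>x\<in>carrier X. f (smul X c x) = smul Y c (f x))}"

definition bilin ::
  "('k::field, 'a, 'm1) vs_scheme \<Rightarrow> ('k, 'b, 'm2) vs_scheme \<Rightarrow> ('k, 'c, 'm3) vs_scheme \<Rightarrow>
   ('a \<Rightarrow> 'b \<Rightarrow> 'c) set" where
  "bilin X Y Z = {f. (\<forall>x\<in>carrier X. restrict (f x) (carrier Y) \<in> lin Y Z) \<and>
     (\<forall>y\<in>carrier Y. restrict (\<lambda>x. f x y) (carrier X) \<in> lin X Z)}"

text \<open>
  \<open>T\<close> with \<open>(x, y) \<mapsto> t x y\<close> is a tensor product of \<open>X\<close> and \<open>Y\<close>.  The universal property is required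
  for bilinear forms; over a field this implies it for bilinear maps into arbitrary vector
  spaces, as linear forms separate points and subspaces.
\<close>

definition tensor_product ::
  "('k::field, 'a, 'm1) vs_scheme \<Rightarrow> ('k, 'b, 'm2) vs_scheme \<Rightarrow> ('k, 'c, 'm3) vs_scheme \<Rightarrow>
   ('a \<Rightarrow> 'b \<Rightarrow> 'c) \<Rightarrow> bool" where
  "tensor_product X Y T t \<longleftrightarrow>
     vspace X \<and> vspace Y \<and> vspace T \<and> t \<in> bilin X Y T \<and>
     (\<forall>\<beta>\<in>bilin X Y (full (*)). \<exists>!\<phi>. \<phi> \<in> lin T (full (*)) \<and>
        (\<forall>x\<in>carrier X. \<forall>y\<in>carrier Y. \<phi> (t x y) = \<beta> x y))"


section \<open>Bosonization, the extended skew pairing and the q-boson algebra\<close>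

text \<open>
  \<open>A\<close> is the Hopf algebra on the vector space \<open>R \<otimes> J\<close>, with \<open>t r a\<close> in the role of
  \<open>ra = r \<otimes> a\<close>.
\<close>

definition bosonization ::
  "('k::field, 'j::ring_1) hopf \<Rightarrow> ('k, 'j, 'r::ring_1) graded_yd_bialg \<Rightarrow>
   ('k, 'a::ring_1) hopf \<Rightarrow> ('r \<Rightarrow> 'j \<Rightarrow> 'a) \<Rightarrow> bool" where
  "bosonization J R A t \<longleftrightarrow>
     hopf_algebra A \<and>
     tensor_product (full (yscale R)) (full (hscale J)) (full (hscale A)) t \<and>
     (\<forall>r a s b. t r a * t s b = sw J a (\<lambda>a1 a2. t (r * yact R a1 s) (a2 * b))) \<and>
     (\<forall>r a. hcomult A (t r a) =
        bsw R r (\<lambda>r1 r2. co J R r2 (\<lambda>j u. sw J a (\<lambda>a1 a2.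
          pure_tensor (hscale A) (hscale A) (t r1 (j * a1)) (t u a2)))))"

text \<open>The data \<open>(J, K, \<tau>\<^sub>0, V, W, \<tau>\<^sub>1, R, S)\<close>.\<close>

definition boson_data ::
  "('k::field, 'j::ring_1) hopf \<Rightarrow> ('k, 'c::ring_1) hopf \<Rightarrow> ('j \<Rightarrow> 'c \<Rightarrow> 'k) \<Rightarrow>
   ('k, 'j, 'v::ab_group_add) yd \<Rightarrow> ('k, 'c, 'w::ab_group_add) yd \<Rightarrow> ('v \<Rightarrow> 'w \<Rightarrow> 'k) \<Rightarrow>
   ('k, 'j, 'r::ring_1) graded_yd_bialg \<Rightarrow> ('v \<Rightarrow> 'r) \<Rightarrow>
   ('k, 'c, 's::ring_1) graded_yd_bialg \<Rightarrow> ('w \<Rightarrow> 's) \<Rightarrow> bool" where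
  "boson_data J K \<tau>0 V W \<tau>1 R \<iota>V S \<iota>W \<longleftrightarrow>
     hopf_algebra J \<and> bij (antipode J) \<and> hopf_algebra K \<and> bij (antipode K) \<and>
     skew_pairing J K \<tau>0 \<and>
     yetter_drinfeld J V \<and> yetter_drinfeld K W \<and>
     bilinear_map (yscale V) (yscale W) (*) \<tau>1 \<and>
     (\<forall>a v w. \<tau>1 (yact V a v) w = co K W w (\<lambda>x w'. \<tau>0 a x * \<tau>1 v w')) \<and>
     (\<forall>x v w. \<tau>1 v (yact W x w) = co J V v (\<lambda>j v'. \<tau>0 j (antipode K x) * \<tau>1 v' w)) \<and>
     pre_nichols J V R \<iota>V \<and> pre_nichols K W S \<iota>W"

text \<open>
  \<open>A = R \<rtimes> J\<close> and \<open>X = S \<rtimes> K\<close>, with inclusions given by \<open>tA\<close> and \<open>tX\<close>.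
\<close>

definition extended_pairing ::
  "('j::ring_1 \<Rightarrow> 'c::ring_1 \<Rightarrow> 'k::field) \<Rightarrow> ('v \<Rightarrow> 'w \<Rightarrow> 'k) \<Rightarrow>
   ('v \<Rightarrow> 'r::ring_1) \<Rightarrow> ('w \<Rightarrow> 's::ring_1) \<Rightarrow>
   ('k, 'a::ring_1) hopf \<Rightarrow> ('r \<Rightarrow> 'j \<Rightarrow> 'a) \<Rightarrow> ('k, 'x::ring_1) hopf \<Rightarrow> ('s \<Rightarrow> 'c \<Rightarrow> 'x) \<Rightarrow>
   ('a \<Rightarrow> 'x \<Rightarrow> 'k) \<Rightarrow> bool" where
  "extended_pairing \<tau>0 \<tau>1 \<iota>V \<iota>W A tA X tX \<tau> \<longleftrightarrow>
     skew_pairing A X \<tau> \<and>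
     (\<forall>a x. \<tau> (tA 1 a) (tX 1 x) = \<tau>0 a x) \<and>
     (\<forall>v w. \<tau> (tA (\<iota>V v) 1) (tX (\<iota>W w) 1) = \<tau>1 v w) \<and>
     (\<forall>a w. \<tau> (tA 1 a) (tX (\<iota>W w) 1) = 0) \<and>
     (\<forall>v x. \<tau> (tA (\<iota>V v) 1) (tX 1 x) = 0)"

text \<open>
  The ring \<open>'b\<close> with scalar multiplication \<open>sB\<close> is the algebra on the vector space \<open>R \<otimes> S\<close>, with
  \<open>tB r s\<close> in the role of \<open>r \<otimes> s\<close>.
\<close>

definition q_boson_algebra ::
  "('k::field, 'j::ring_1) hopf \<Rightarrow> ('k, 'c::ring_1) hopf \<Rightarrow> ('j \<Rightarrow> 'c \<Rightarrow> 'k) \<Rightarrow>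
   ('k, 'j, 'v::ab_group_add) yd \<Rightarrow> ('k, 'c, 'w::ab_group_add) yd \<Rightarrow> ('v \<Rightarrow> 'w \<Rightarrow> 'k) \<Rightarrow>
   ('k, 'j, 'r::ring_1) graded_yd_bialg \<Rightarrow> ('v \<Rightarrow> 'r) \<Rightarrow>
   ('k, 'c, 's::ring_1) graded_yd_bialg \<Rightarrow> ('w \<Rightarrow> 's) \<Rightarrow>
   ('k \<Rightarrow> 'b::ring_1 \<Rightarrow> 'b) \<Rightarrow> ('r \<Rightarrow> 's \<Rightarrow> 'b) \<Rightarrow> bool" where
  "q_boson_algebra J K \<tau>0 V W \<tau>1 R \<iota>V S \<iota>W sB tB \<longleftrightarrow>
     unital_algebra sB \<and>
     tensor_product (full (yscale R)) (full (yscale S)) (full sB) tB \<and>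
     tB 1 1 = 1 \<and>
     (\<forall>r r'. tB r 1 * tB r' 1 = tB (r * r') 1) \<and>
     (\<forall>s s'. tB 1 s * tB 1 s' = tB 1 (s * s')) \<and>
     (\<forall>r s. tB r 1 * tB 1 s = tB r s) \<and>
     (\<forall>v w. tB 1 (\<iota>W w) * tB (\<iota>V v) 1 =
        co J V v (\<lambda>j v'. co K W w (\<lambda>x w'. sB (\<tau>0 j x) (tB (\<iota>V v') (\<iota>W w')))) + sB (\<tau>1 v w) 1)"

text \<open>
  \<open>\<rho> b r\<close> is the action of \<open>b\<close> on \<open>r\<close> in the left module \<open>R\<close> over the q-boson algebra;
  \<open>s\<close> acts by \<open>s \<triangleright> r = \<tau>(r\<^sub>1, s) r\<^sub>2\<close>.
\<close>

definition boson_action ::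
  "('k::field, 'j, 'r::ring_1) graded_yd_bialg \<Rightarrow>
   ('r \<Rightarrow> 'j::ring_1 \<Rightarrow> 'a) \<Rightarrow> ('s \<Rightarrow> 'c::ring_1 \<Rightarrow> 'x) \<Rightarrow> ('a \<Rightarrow> 'x \<Rightarrow> 'k) \<Rightarrow>
   ('k \<Rightarrow> 'b::ring_1 \<Rightarrow> 'b) \<Rightarrow> ('r \<Rightarrow> 's::ring_1 \<Rightarrow> 'b) \<Rightarrow> ('b \<Rightarrow> 'r \<Rightarrow> 'r) \<Rightarrow> bool" where
  "boson_action R tA tX \<tau> sB tB \<rho> \<longleftrightarrow>
     bilinear_map sB (yscale R) (yscale R) \<rho> \<and>
     (\<forall>r. \<rho> 1 r = r) \<and> (\<forall>b b' r. \<rho> (b * b') r = \<rho> b (\<rho> b' r)) \<and>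
     (\<forall>r r'. \<rho> (tB r 1) r' = r * r') \<and>
     (\<forall>s r. \<rho> (tB 1 s) r = bsw R r (\<lambda>r1 r2. yscale R (\<tau> (tA r1 1) (tX s 1)) r2))"

definition finite_dim :: "('k::field \<Rightarrow> 'a::ab_group_add \<Rightarrow> 'a) \<Rightarrow> bool" where
  "finite_dim s \<longleftrightarrow> (\<exists>B. finite B \<and> module.span s B = UNIV)"

definition nondegenerate :: "('v::zero \<Rightarrow> 'w::zero \<Rightarrow> 'k::zero) \<Rightarrow> bool" where
  "nondegenerate \<beta> \<longleftrightarrow>
     (\<forall>v. (\<forall>w. \<beta> v w = 0) \<longrightarrow> v = 0) \<and> (\<forall>w. (\<forall>v. \<beta> v w = 0) \<longrightarrow> w = 0)"


section \<open>Categories and quasi-inverse functors\<close>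

text \<open>
  \<open>comp C X Y Z g f\<close> is the composite of \<open>f : X \<rightarrow> Y\<close> and \<open>g : Y \<rightarrow> Z\<close>.  An element of the arrow type may
  belong to several hom-sets; source and target are therefore always given explicitly, also
  in the action of a functor on arrows.
\<close>

record ('o, 'm) cat =
  obj :: "'o set"
  hom :: "'o \<Rightarrow> 'o \<Rightarrow> 'm set"
  ident :: "'o \<Rightarrow> 'm"
  comp :: "'o \<Rightarrow> 'o \<Rightarrow> 'o \<Rightarrow> 'm \<Rightarrow> 'm \<Rightarrow> 'm"

definition category :: "('o, 'm) cat \<Rightarrow> bool" where
  "category C \<longleftrightarrow>
     (\<forall>X\<in>obj C. ident C X \<in> hom C X X) \<and>
     (\<forall>X\<in>obj C. \<forall>Y\<in>obj C. \<forall>Z\<in>obj C. \<forall>f\<in>hom C X Y. \<forall>g\<in>hom C Y Z. comp C X Y Z g f \<in> hom C X Z) \<and>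
     (\<forall>X\<in>obj C. \<forall>Y\<in>obj C. \<forall>f\<in>hom C X Y.
        comp C X X Y f (ident C X) = f \<and> comp C X Y Y (ident C Y) f = f) \<and>
     (\<forall>X\<in>obj C. \<forall>Y\<in>obj C. \<forall>Z\<in>obj C. \<forall>U\<in>obj C.
        \<forall>f\<in>hom C X Y. \<forall>g\<in>hom C Y Z. \<forall>h\<in>hom C Z U.
        comp C X Z U h (comp C X Y Z g f) = comp C X Y U (comp C Y Z U h g) f)"

record ('o1, 'm1, 'o2, 'm2) funct =
  fob :: "'o1 \<Rightarrow> 'o2"
  fmap :: "'o1 \<Rightarrow> 'o1 \<Rightarrow> 'm1 \<Rightarrow> 'm2"

definition is_functor :: "('o1, 'm1) cat \<Rightarrow> ('o2, 'm2) cat \<Rightarrow> ('o1, 'm1, 'o2, 'm2) funct \<Rightarrow> bool" where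
  "is_functor C D F \<longleftrightarrow>
     (\<forall>X\<in>obj C. fob F X \<in> obj D) \<and>
     (\<forall>X\<in>obj C. \<forall>Y\<in>obj C. \<forall>f\<in>hom C X Y. fmap F X Y f \<in> hom D (fob F X) (fob F Y)) \<and>
     (\<forall>X\<in>obj C. fmap F X X (ident C X) = ident D (fob F X)) \<and>
     (\<forall>X\<in>obj C. \<forall>Y\<in>obj C. \<forall>Z\<in>obj C. \<forall>f\<in>hom C X Y. \<forall>g\<in>hom C Y Z.
        fmap F X Z (comp C X Y Z g f) =
          comp D (fob F X) (fob F Y) (fob F Z) (fmap F Y Z g) (fmap F X Y f))"

definition fid :: "('o, 'm, 'o, 'm) funct" where
  "fid = \<lparr>fob = (\<lambda>X. X), fmap = (\<lambda>X Y f. f)\<rparr>"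

definition fcomp ::
  "('o2, 'm2, 'o3, 'm3) funct \<Rightarrow> ('o1, 'm1, 'o2, 'm2) funct \<Rightarrow> ('o1, 'm1, 'o3, 'm3) funct" where
  "fcomp G F = \<lparr>fob = (\<lambda>X. fob G (fob F X)),
     fmap = (\<lambda>X Y f. fmap G (fob F X) (fob F Y) (fmap F X Y f))\<rparr>"

definition isomorphism :: "('o, 'm) cat \<Rightarrow> 'o \<Rightarrow> 'o \<Rightarrow> 'm \<Rightarrow> bool" where
  "isomorphism C X Y f \<longleftrightarrow> f \<in> hom C X Y \<and>
     (\<exists>g\<in>hom C Y X. comp C X Y X g f = ident C X \<and> comp C Y X Y f g = ident C Y)"

definition natural_isomorphism ::
  "('o1, 'm1) cat \<Rightarrow> ('o2, 'm2) cat \<Rightarrow> ('o1, 'm1, 'o2, 'm2) funct \<Rightarrow> ('o1, 'm1, 'o2, 'm2) funct \<Rightarrow>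
   ('o1 \<Rightarrow> 'm2) \<Rightarrow> bool" where
  "natural_isomorphism C D F G \<eta> \<longleftrightarrow>
     (\<forall>X\<in>obj C. isomorphism D (fob F X) (fob G X) (\<eta> X)) \<and>
     (\<forall>X\<in>obj C. \<forall>Y\<in>obj C. \<forall>f\<in>hom C X Y.
        comp D (fob F X) (fob F Y) (fob G Y) (\<eta> Y) (fmap F X Y f) =
        comp D (fob F X) (fob G X) (fob G Y) (fmap G X Y f) (\<eta> X))"

definition quasi_inverse ::
  "('o1, 'm1) cat \<Rightarrow> ('o2, 'm2) cat \<Rightarrow> ('o1, 'm1, 'o2, 'm2) funct \<Rightarrow> ('o2, 'm2, 'o1, 'm1) funct \<Rightarrow>
   bool" where
  "quasi_inverse C D F G \<longleftrightarrow>
     category C \<and> category D \<and> is_functor C D F \<and> is_functor D C G \<and>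
     (\<exists>\<eta>. natural_isomorphism C C (fcomp G F) fid \<eta>) \<and>
     (\<exists>\<eta>. natural_isomorphism D D (fcomp F G) fid \<eta>)"

definition equivalent_categories :: "('o1, 'm1) cat \<Rightarrow> ('o2, 'm2) cat \<Rightarrow> bool" where
  "equivalent_categories C D \<longleftrightarrow> (\<exists>F G. quasi_inverse C D F G)"


section \<open>The two categories and the two functors\<close>

definition Vec :: "(('k::field, 'u) vs, 'u \<Rightarrow> 'u) cat" where
  "Vec = \<lparr>obj = {X. vspace X}, hom = lin, ident = (\<lambda>X. restrict (\<lambda>x. x) (carrier X)),
     comp = (\<lambda>X Y Z g f. restrict (g \<circ> f) (carrier X))\<rparr>"

record ('k, 'b, 'u) bmod = "('k, 'u) vs" +
  mact :: "'b \<Rightarrow> 'u \<Rightarrow> 'u"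

definition left_module :: "('k::field \<Rightarrow> 'b::ring_1 \<Rightarrow> 'b) \<Rightarrow> ('k, 'b, 'u) bmod \<Rightarrow> bool" where
  "left_module sB M \<longleftrightarrow> vspace M \<and> mact M \<in> bilin (full sB) M M \<and>
     (\<forall>m\<in>carrier M. mact M 1 m = m) \<and>
     (\<forall>b b'. \<forall>m\<in>carrier M. mact M (b * b') m = mact M b (mact M b' m))"

definition mod_hom :: "('k::field, 'b, 'u) bmod \<Rightarrow> ('k, 'b, 'u) bmod \<Rightarrow> ('u \<Rightarrow> 'u) set" where
  "mod_hom M N = {f \<in> lin M N. \<forall>b. \<forall>m\<in>carrier M. f (mact M b m) = mact N b (f m)}"

definition integrable ::
  "('k, 'c, 's::ring_1) graded_yd_bialg \<Rightarrow> ('r::ring_1 \<Rightarrow> 's \<Rightarrow> 'b) \<Rightarrow> ('k, 'b, 'u) bmod \<Rightarrow> bool" where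
  "integrable S tB M \<longleftrightarrow>
     (\<forall>m\<in>carrier M. \<exists>n>0. \<forall>s\<in>grade S n. mact M (tB 1 s) m = zero M)"

definition cat_O ::
  "('k::field, 'c, 's::ring_1) graded_yd_bialg \<Rightarrow> ('k \<Rightarrow> 'b::ring_1 \<Rightarrow> 'b) \<Rightarrow>
   ('r::ring_1 \<Rightarrow> 's \<Rightarrow> 'b) \<Rightarrow> (('k, 'b, 'u) bmod, 'u \<Rightarrow> 'u) cat" where
  "cat_O S sB tB = \<lparr>obj = {M. left_module sB M \<and> integrable S tB M}, hom = mod_hom,
     ident = (\<lambda>M. restrict (\<lambda>m. m) (carrier M)),
     comp = (\<lambda>M N P g f. restrict (g \<circ> f) (carrier M))\<rparr>"

definition invariants ::
  "('k, 'c, 's::ring_1) graded_yd_bialg \<Rightarrow> ('r::ring_1 \<Rightarrow> 's \<Rightarrow> 'b) \<Rightarrow> ('k, 'b, 'u) bmod \<Rightarrow>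
   ('k, 'u) vs" where
  "invariants S tB M =
     \<lparr>carrier = {m \<in> carrier M. \<forall>s\<in>grade S 1. mact M (tB 1 s) m = zero M},
      add = add M, zero = zero M, smul = smul M\<rparr>"

definition invariants_functor ::
  "('k, 'c, 's::ring_1) graded_yd_bialg \<Rightarrow> ('r::ring_1 \<Rightarrow> 's \<Rightarrow> 'b) \<Rightarrow>
   (('k, 'b, 'u) bmod, 'u \<Rightarrow> 'u, ('k, 'u) vs, 'u \<Rightarrow> 'u) funct" where
  "invariants_functor S tB = \<lparr>fob = invariants S tB,
     fmap = (\<lambda>M N f. restrict f (carrier (invariants S tB M)))\<rparr>"

text \<open>
  A choice of tensor products \<open>R \<otimes> X\<close> within the type \<open>'u\<close>, for all \<open>X\<close>: the space is \<open>P X\<close>, and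
  \<open>p X r x\<close> is \<open>r \<otimes> x\<close>.  Such a choice exists whenever \<open>'u\<close> is infinite and at least as large as \<open>R\<close>;
  the type \<open>'u\<close> thus plays the role of the universe in which vector spaces and modules live.
\<close>

definition tensor_choice ::
  "('k::field, 'j, 'r::ring_1) graded_yd_bialg \<Rightarrow> (('k, 'u) vs \<Rightarrow> ('k, 'u) vs) \<Rightarrow>
   (('k, 'u) vs \<Rightarrow> 'r \<Rightarrow> 'u \<Rightarrow> 'u) \<Rightarrow> bool" where
  "tensor_choice R P p \<longleftrightarrow>
     (\<forall>X. vspace X \<longrightarrow> tensor_product (full (yscale R)) X (P X) (p X))"

text \<open>The linear map \<open>R \<otimes> X \<rightarrow> Z\<close> induced by a bilinear map \<open>F\<close>.\<close>

definition induced ::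
  "(('k::field, 'u) vs \<Rightarrow> ('k, 'u) vs) \<Rightarrow> (('k, 'u) vs \<Rightarrow> 'r \<Rightarrow> 'u \<Rightarrow> 'u) \<Rightarrow>
   ('k, 'u) vs \<Rightarrow> ('k, 'u) vs \<Rightarrow> ('r \<Rightarrow> 'u \<Rightarrow> 'u) \<Rightarrow> ('u \<Rightarrow> 'u)" where
  "induced P p X Z F =
     (THE \<phi>. \<phi> \<in> lin (P X) Z \<and> (\<forall>r. \<forall>x\<in>carrier X. \<phi> (p X r x) = F r x))"

definition tensor_functor ::
  "(('k::field, 'u) vs \<Rightarrow> ('k, 'u) vs) \<Rightarrow> (('k, 'u) vs \<Rightarrow> 'r \<Rightarrow> 'u \<Rightarrow> 'u) \<Rightarrow> ('b \<Rightarrow> 'r \<Rightarrow> 'r) \<Rightarrow>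
   (('k, 'u) vs, 'u \<Rightarrow> 'u, ('k, 'b, 'u) bmod, 'u \<Rightarrow> 'u) funct" where
  "tensor_functor P p \<rho> =
     \<lparr>fob = (\<lambda>X. \<lparr>carrier = carrier (P X), add = add (P X), zero = zero (P X), smul = smul (P X),
                mact = (\<lambda>b. induced P p X (P X) (\<lambda>r x. p X (\<rho> b r) x))\<rparr>),
      fmap = (\<lambda>X Y f. induced P p X (P Y) (\<lambda>r x. p Y r (f x)))\<rparr>"

end

theory Submission
  imports Defs
begin

text \<open>
  Write \<open>q(r, s) = \<tau>(r, s)\<close> for \<open>r \<in> R\<close>, \<open>s \<in> S\<close>.  Since \<open>R\<close> is a module, \<open>q(s \<triangleright> r, s') = q(r, s' s)\<close>, and
  the commutation relation makes \<open>q\<close> orthogonal for the gradings.  If \<open>r\<close> is a homogeneous element of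
  smallest degree in the left radical of \<open>q\<close>, then \<open>S\<^sup>+ \<triangleright> r = 0\<close>; this says that \<open>\<Delta>(r) - r \<otimes> 1 - 1 \<otimes> r\<close>
  vanishes, so \<open>r\<close> is primitive of degree at least 2, hence 0 as \<open>R\<close> is Nichols.  On the other
  side, \<open>q(r r', s) = \<tau>\<^sub>0(r\<^sub>J, s\<^sub>2\<^sub>K) q(r\<^sub>R, s\<^sub>1) q(r', s\<^sub>2\<^sub>S)\<close>, and after undoing the twist by \<open>\<tau>\<^sub>0\<close> with the
  antipode the same argument applies to \<open>S\<close>.  So \<open>R\<close> is the graded dual of the locally finite algebra \<open>S\<close>.

  Non-degeneracy gives \<open>(R \<otimes> X)\<^sub>0 = X\<close>.  For an integrable module \<open>M\<close> the map \<open>\<mu> : R \<otimes> M\<^sub>0 \<rightarrow> M\<close> is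
  \<open>\<B>\<close>-linear.  A non-zero element of its kernel, or of its cokernel, can be moved by \<open>S\<close> to one killed by
  \<open>S\<^sup>+\<close>; in the kernel such an element lies in \<open>1 \<otimes> M\<^sub>0\<close>, where \<open>\<mu>\<close> is injective, and in the cokernel it lifts to
  an invariant because \<open>R \<otimes> M\<^sub>0\<close>, being the graded dual of \<open>S\<close> with coefficients in \<open>M\<^sub>0\<close>, has no
  extensions by the trivial module.
\<close>


section \<open>Linear forms and tensors\<close>

text \<open>Two features of the setting shape the proof. A tensor is known only through its values
  on bilinear forms, and a Sweedler sum runs over a list picked by \<open>SOME\<close>. Identities
  between such sums are therefore checked after applying an arbitrary linear form: the integrand is
  then a bilinear form, and the choice of the list disappears. Likewise tensor products are
  universal only for forms, so vector-valued lifts rest on the fact that forms separate points.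

  The two sides of the pairing are also not symmetric. The given module structure lets
  \<open>S\<close> act on \<open>R\<close>, which makes the left radical accessible at once. On the
  other side only the adjoint of left multiplication is at hand; it mixes the pairing with values of
  \<tau>0 and has to be extracted from the coproduct of the bosonization. Both halves of
  non-degeneracy have their own use: the left one identifies the invariants of
  \<open>R \<otimes> X\<close>, the right one provides the finite dual bases with which functions on
  \<open>S\<close> are represented by elements of \<open>R \<otimes> M_0\<close>.\<close>

lemma vector_space_field: "vector_space ((*) :: 'k::field \<Rightarrow> 'k \<Rightarrow> 'k)"
  by unfold_locales (auto simp: algebra_simps)

lemma vector_space_tscale: "vector_space (tscale :: 'k::field \<Rightarrow> ('x \<Rightarrow> 'k) \<Rightarrow> 'x \<Rightarrow> 'k)"
  by unfold_locales (auto simp: tscale_def algebra_simps fun_eq_iff)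

abbreviation linear_form :: "('k::field \<Rightarrow> 'v::ab_group_add \<Rightarrow> 'v) \<Rightarrow> ('v \<Rightarrow> 'k) \<Rightarrow> bool" where
  "linear_form s \<equiv> Vector_Spaces.linear s (*)"

lemma linear_formI:
  assumes "vector_space s" "\<And>x y. f (x + y) = f x + f y" "\<And>c x. f (s c x) = c * f x"
  shows "linear_form s f"
  using assms vector_space_field by (simp add: Vector_Spaces.linear_iff)

lemma linear_addD: "Vector_Spaces.linear s1 s2 f \<Longrightarrow> f (x + y) = f x + f y"
  by (simp add: Vector_Spaces.linear_iff)

lemma linear_scaleD: "Vector_Spaces.linear s1 s2 f \<Longrightarrow> f (s1 c x) = s2 c (f x)"
  by (simp add: Vector_Spaces.linear_iff)

lemma linear_0D: assumes "Vector_Spaces.linear s1 s2 f" shows "f 0 = 0"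
  using linear_addD[OF assms, of 0 0] by simp

lemma linear_diffD: assumes "Vector_Spaces.linear s1 s2 f" shows "f (x - y) = f x - f y"
  using linear_addD[OF assms, of "x - y" y] by simp

lemma linear_sumD: assumes "Vector_Spaces.linear s1 s2 f" shows "f (sum g A) = (\<Sum>a\<in>A. f (g a))"
  by (induction A rule: infinite_finite_induct)
     (auto simp: linear_0D[OF assms] linear_addD[OF assms])

lemma linear_sum_listD:
  assumes "Vector_Spaces.linear s1 s2 f" shows "f (sum_list xs) = sum_list (map f xs)"
  by (induction xs) (auto simp: linear_0D[OF assms] linear_addD[OF assms])

lemma bilinear_formI:
  assumes "vector_space sA" "vector_space sB"
    "\<And>a a' b. \<beta> (a + a') b = \<beta> a b + \<beta> a' b" "\<And>c a b. \<beta> (sA c a) b = c * \<beta> a b"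
    "\<And>a b b'. \<beta> a (b + b') = \<beta> a b + \<beta> a b'" "\<And>c a b. \<beta> a (sB c b) = c * \<beta> a b"
  shows "bilinear_map sA sB (*) \<beta>"
  using assms unfolding bilinear_map_def by (auto intro!: linear_formI)

lemma bilinear_formD:
  assumes "bilinear_map sA sB sC \<beta>"
  shows "\<beta> (a + a') b = \<beta> a b + \<beta> a' b" "\<beta> (sA c a) b = sC c (\<beta> a b)"
    "\<beta> a (b + b') = \<beta> a b + \<beta> a b'" "\<beta> a (sB c b) = sC c (\<beta> a b)"
    "\<beta> 0 b = 0" "\<beta> a 0 = 0" "\<beta> (a - a') b = \<beta> a b - \<beta> a' b" "\<beta> a (b - b') = \<beta> a b - \<beta> a b'"
    "\<beta> (sum f I) b = (\<Sum>i\<in>I. \<beta> (f i) b)" "\<beta> a (sum g I) = (\<Sum>i\<in>I. \<beta> a (g i))"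
proof -
  have 1: "Vector_Spaces.linear sA sC (\<lambda>a. \<beta> a b)" for b
    using assms by (auto simp: bilinear_map_def)
  have 2: "Vector_Spaces.linear sB sC (\<beta> a)" for a
    using assms by (auto simp: bilinear_map_def)
  show "\<beta> (a + a') b = \<beta> a b + \<beta> a' b" "\<beta> (sA c a) b = sC c (\<beta> a b)"
    "\<beta> 0 b = 0" "\<beta> (a - a') b = \<beta> a b - \<beta> a' b" "\<beta> (sum f I) b = (\<Sum>i\<in>I. \<beta> (f i) b)"
    using linear_addD[OF 1] linear_scaleD[OF 1] linear_0D[OF 1] linear_diffD[OF 1] linear_sumD[OF 1]
    by auto
  show "\<beta> a (b + b') = \<beta> a b + \<beta> a b'" "\<beta> a (sB c b) = sC c (\<beta> a b)"
    "\<beta> a 0 = 0" "\<beta> a (b - b') = \<beta> a b - \<beta> a b'" "\<beta> a (sum g I) = (\<Sum>i\<in>I. \<beta> a (g i))"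
    using linear_addD[OF 2] linear_scaleD[OF 2] linear_0D[OF 2] linear_diffD[OF 2] linear_sumD[OF 2]
    by auto
qed

lemma linear_compD:
  assumes "Vector_Spaces.linear s1 s2 f" "Vector_Spaces.linear s2 s3 g"
  shows "Vector_Spaces.linear s1 s3 (\<lambda>x. g (f x))"
  using assms by (simp add: Vector_Spaces.linear_iff)

text \<open>Coordinates for a basis, extended by zero to all vectors \<open>e\<close>, so that no
  basis set has to be carried around. The expansion holds over every finite \<open>E\<close>
  containing the support, which lets several vectors share one index set.\<close>

lemma ex_coordinates:
  assumes "vector_space (s :: 'k::field \<Rightarrow> ('v::ab_group_add) \<Rightarrow> 'v)"
  obtains rep where "\<And>e. linear_form s (\<lambda>v. rep v e)"
    "\<And>v. finite {e. rep v e \<noteq> 0}"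
    "\<And>v E. finite E \<Longrightarrow> {e. rep v e \<noteq> 0} \<subseteq> E \<Longrightarrow> (\<Sum>e\<in>E. s (rep v e) e) = v"
proof -
  interpret vector_space s by fact
  let ?B = "extend_basis {}"
  have B: "independent ?B" "span ?B = UNIV"
    using independent_extend_basis[OF independent_empty] span_extend_basis[OF independent_empty] by auto
  show thesis
  proof (rule that[of "representation ?B"])
    show "linear_form s (\<lambda>v. representation ?B v e)" for e
      using linear_representation[OF B] .
    show "finite {e. representation ?B v e \<noteq> 0}" for v by (rule finite_representation)
    fix v E assume E: "finite E" "{e. representation ?B v e \<noteq> 0} \<subseteq> E"
    have "(\<Sum>e\<in>E. s (representation ?B v e) e)
        = (\<Sum>e | representation ?B v e \<noteq> 0. s (representation ?B v e) e)"
      by (rule sum.mono_neutral_right) (use E in auto)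
    also have "\<dots> = v" by (rule sum_nonzero_representation_eq) (use B in auto)
    finally show "(\<Sum>e\<in>E. s (representation ?B v e) e) = v" .
  qed
qed

lemma linear_form_separates:
  assumes "vector_space (s :: 'k::field \<Rightarrow> ('v::ab_group_add) \<Rightarrow> 'v)"
    and "\<And>\<phi>. linear_form s \<phi> \<Longrightarrow> \<phi> x = \<phi> y"
  shows "x = y"
proof -
  obtain rep where rep: "\<And>e. linear_form s (\<lambda>v. rep v e)"
    "\<And>v. finite {e. rep v e \<noteq> 0}"
    "\<And>v E. finite E \<Longrightarrow> {e. rep v e \<noteq> 0} \<subseteq> E \<Longrightarrow> (\<Sum>e\<in>E. s (rep v e) e) = v"
    using ex_coordinates[OF assms(1)] by blast
  have "rep x = rep y" using assms(2) rep(1) by blast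
  then show ?thesis using rep(2)[of x] rep(3)[of _ x] rep(3)[of _ y] by (metis order_refl)
qed

lemma tensor_of_apply:
  "bilinear_map sA sB (*) \<beta> \<Longrightarrow> tensor_of sA sB ps \<beta> = (\<Sum>(a, b)\<leftarrow>ps. \<beta> a b)"
  by (simp add: tensor_of_def)

text \<open>Expanding the second legs in coordinates over a common finite set \<open>E\<close> turns
  \<open>\<beta>\<close> into a sum over \<open>e\<close> of values at the slices of the tensors
  along the coordinate forms; the hypothesis equates these slices.\<close>

lemma tensor_of_eqI:
  assumes A: "vector_space sA" and B: "vector_space sB"
    and eq: "\<And>\<phi>. linear_form sB \<phi> \<Longrightarrow> (\<Sum>(a, b)\<leftarrow>ps. sA (\<phi> b) a) = (\<Sum>(a, b)\<leftarrow>qs. sA (\<phi> b) a)"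
  shows "tensor_of sA sB ps = tensor_of sA sB qs"
proof (rule ext)
  fix \<beta>
  obtain rep where rep: "\<And>e. linear_form sB (\<lambda>v. rep v e)"
    "\<And>v. finite {e. rep v e \<noteq> 0}"
    "\<And>v E. finite E \<Longrightarrow> {e. rep v e \<noteq> 0} \<subseteq> E \<Longrightarrow> (\<Sum>e\<in>E. sB (rep v e) e) = v"
    using ex_coordinates[OF B] by blast
  define E where "E = (\<Union>b \<in> snd ` set ps \<union> snd ` set qs. {e. rep b e \<noteq> 0})"
  have E: "finite E" using rep(2) by (auto simp: E_def)
  show "tensor_of sA sB ps \<beta> = tensor_of sA sB qs \<beta>"
  proof (cases "bilinear_map sA sB (*) \<beta>")
    case True
    note bl = bilinear_formD[OF True]
    have one: "\<beta> a b = (\<Sum>e\<in>E. \<beta> (sA (rep b e) a) e)" if "{e. rep b e \<noteq> 0} \<subseteq> E" for a b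
    proof -
      have "\<beta> a b = \<beta> a (\<Sum>e\<in>E. sB (rep b e) e)" using rep(3)[OF E that] by simp
      then show ?thesis by (simp add: bl)
    qed
    have *: "(\<Sum>(a, b)\<leftarrow>rs. \<beta> a b) = (\<Sum>e\<in>E. \<beta> (\<Sum>(a, b)\<leftarrow>rs. sA (rep b e) a) e)"
      if "\<And>a b. (a, b) \<in> set rs \<Longrightarrow> {e. rep b e \<noteq> 0} \<subseteq> E" for rs
      using that
    proof (induction rs)
      case (Cons r rs)
      obtain a b where r: "r = (a, b)" by force
      have "\<beta> a b = (\<Sum>e\<in>E. \<beta> (sA (rep b e) a) e)" using Cons.prems[of a b] by (intro one) (auto simp: r)
      then show ?case using Cons by (auto simp: r bl(1) sum.distrib)
    qed (simp add: bl)
    have "(\<Sum>(a, b)\<leftarrow>ps. \<beta> a b) = (\<Sum>(a, b)\<leftarrow>qs. \<beta> a b)"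
      by (subst (1 2) *) (auto simp: E_def eq[OF rep(1)] intro: rev_bexI)
    then show ?thesis using True by (simp add: tensor_of_apply)
  qed (simp add: tensor_of_def)
qed

lemma sum_list_fun_apply: "(\<Sum>x\<leftarrow>xs. f x) \<beta> = (\<Sum>x\<leftarrow>xs. f x \<beta>)"
  for f :: "'a \<Rightarrow> 'b \<Rightarrow> 'c::ab_group_add"
  by (induction xs) auto

lemma sweedler_rep:
  assumes "t \<in> tensor_space sA sB"
  obtains ps where "t = tensor_of sA sB ps"
    "\<And>F :: 'a::ab_group_add \<Rightarrow> 'b::ab_group_add \<Rightarrow> 'c::ab_group_add. sweedler sA sB t F = (\<Sum>(a, b)\<leftarrow>ps. F a b)"
proof
  show "t = tensor_of sA sB (SOME ps. t = tensor_of sA sB ps)"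
    using assms by (auto intro: someI)
qed (simp add: sweedler_def)

lemma sweedler_form:
  assumes "t \<in> tensor_space sA sB" "bilinear_map sA sB (*) \<beta>"
  shows "sweedler sA sB t \<beta> = t \<beta>"
proof -
  obtain ps where "t = tensor_of sA sB ps" "sweedler sA sB t \<beta> = (\<Sum>(a, b)\<leftarrow>ps. \<beta> a b)"
    using sweedler_rep[OF assms(1)] by metis
  then show ?thesis using assms(2) by (simp add: tensor_of_apply)
qed

lemma sweedler_linear:
  assumes "Vector_Spaces.linear s1 s2 \<phi>"
  shows "\<phi> (sweedler sA sB t F) = sweedler sA sB t (\<lambda>a b. \<phi> (F a b))"
  by (simp add: sweedler_def linear_sum_listD[OF assms] o_def case_prod_unfold)

lemma sweedler_apply: "sweedler sA sB t F \<beta> = sweedler sA sB t (\<lambda>a b. F a b \<beta>)"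
  by (simp add: sweedler_def case_prod_unfold sum_list_fun_apply)

text \<open>After a linear form is applied, the integrand is a bilinear form, and its Sweedler sum
  is the value of the tensor at it, whichever list represents the tensor. Linear forms separate
  points, so the vector-valued case follows.\<close>

lemma sweedler_tensor_of:
  assumes F: "bilinear_map sA sB sC F"
  shows "sweedler sA sB (tensor_of sA sB ps) F = (\<Sum>(a, b)\<leftarrow>ps. F a b)"
proof (rule linear_form_separates)
  show "vector_space sC" using F by (auto simp: bilinear_map_def Vector_Spaces.linear_iff)
  fix \<phi> assume \<phi>: "linear_form sC \<phi>"
  have bf: "bilinear_map sA sB (*) (\<lambda>a b. \<phi> (F a b))"
    using F by (auto simp: bilinear_map_def intro: linear_compD[OF _ \<phi>])
  have "\<phi> (sweedler sA sB (tensor_of sA sB ps) F) = (\<Sum>(a, b)\<leftarrow>ps. \<phi> (F a b))"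
    by (subst sweedler_linear[OF \<phi>], subst sweedler_form[OF _ bf]) (auto simp: tensor_of_apply[OF bf])
  then show "\<phi> (sweedler sA sB (tensor_of sA sB ps) F) = \<phi> (\<Sum>(a, b)\<leftarrow>ps. F a b)"
    by (simp add: linear_sum_listD[OF \<phi>] o_def case_prod_unfold)
qed

lemma sweedler_add: "sweedler sA sB t (\<lambda>a b. F a b + G a b) = sweedler sA sB t F + sweedler sA sB t G"
  by (simp add: sweedler_def case_prod_unfold sum_list_addf)

lemma sweedler_mult_left:
  "sweedler sA sB t (\<lambda>a b. (c :: 'k::field) * F a b) = c * sweedler sA sB t F"
  by (simp add: sweedler_def case_prod_unfold sum_list_const_mult)

lemma sweedler_mult_right:
  "sweedler sA sB t (\<lambda>a b. F a b * (c :: 'k::field)) = sweedler sA sB t F * c"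
  by (simp add: sweedler_def case_prod_unfold sum_list_mult_const)

lemma sum_list_swap:
  "(\<Sum>x\<leftarrow>xs. \<Sum>y\<leftarrow>ys. f x y) = (\<Sum>y\<leftarrow>ys. \<Sum>x\<leftarrow>xs. f x y)" for f :: "'a \<Rightarrow> 'b \<Rightarrow> 'c::ab_group_add"
  by (induction xs) (auto simp: sum_list_addf)

text \<open>Both sides are finite double sums over the same two chosen lists, so the exchange is
  available before anything is known about bilinearity of the integrand.\<close>

lemma sweedler_swap:
  "sweedler sA sB t (\<lambda>a b. sweedler sC sD u (\<lambda>c d. F a b c d))
    = sweedler sC sD u (\<lambda>c d. sweedler sA sB t (\<lambda>a b. F a b c d))"
  by (simp add: sweedler_def case_prod_unfold sum_list_swap[of _ "SOME ps. t = tensor_of sA sB ps"])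

lemma sweedler_in_subspace:
  assumes "module.subspace s U" "vector_space s" "\<And>a b. F a b \<in> U"
  shows "sweedler sA sB t F \<in> U"
proof -
  interpret vector_space s by fact
  have "(\<Sum>(a, b)\<leftarrow>ps. F a b) \<in> U" for ps
    by (induction ps) (auto intro: subspace_add[OF assms(1)] subspace_0[OF assms(1)] assms(3))
  then show ?thesis by (simp add: sweedler_def)
qed

text \<open>A coassociativity law is stated in the tensor space whose second factor consists of all
  functions on forms, so evaluating it on a trilinear form needs an extension of that form to this
  space that stays linear outside the image of the tensors.\<close>

lemma trilinear_extension:
  assumes A: "vector_space sA"
    and "\<And>b c. linear_form sA (\<lambda>a. \<gamma> a b c)"
    and bc: "\<And>a. bilinear_map sB sC (*) (\<gamma> a)"
  obtains \<beta> where "bilinear_map sA tscale (*) \<beta>"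
    "\<And>a ps. \<beta> a (tensor_of sB sC ps) = (\<Sum>(b, c)\<leftarrow>ps. \<gamma> a b c)"
proof -
  obtain rep where rep: "\<And>e. linear_form sA (\<lambda>v. rep v e)"
    "\<And>v. finite {e. rep v e \<noteq> 0}"
    "\<And>v E. finite E \<Longrightarrow> {e. rep v e \<noteq> 0} \<subseteq> E \<Longrightarrow> (\<Sum>e\<in>E. sA (rep v e) e) = v"
    using ex_coordinates[OF A] by blast
  \<comment> \<open>Only the first argument is expanded in coordinates. The second, an arbitrary
    function \<open>t\<close> on forms, is evaluated at the fixed form \<open>\<gamma> e\<close>,
    and this is linear in \<open>t\<close> on the whole function space.\<close>
  define \<beta> where "\<beta> = (\<lambda>a t. \<Sum>e | rep a e \<noteq> 0. rep a e * t (\<gamma> e))"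
  have \<beta>: "\<beta> a t = (\<Sum>e\<in>E. rep a e * t (\<gamma> e))" if "finite E" "{e. rep a e \<noteq> 0} \<subseteq> E" for a t E
    unfolding \<beta>_def by (rule sum.mono_neutral_left) (use that in auto)
  show thesis
  proof
    show "bilinear_map sA tscale (*) \<beta>"
    proof (rule bilinear_formI[OF A vector_space_tscale])
      fix a a' t
      let ?E = "{e. rep a e \<noteq> 0} \<union> {e. rep a' e \<noteq> 0} \<union> {e. rep (a + a') e \<noteq> 0}"
      have "finite ?E" using rep(2) by auto
      note \<beta>' = \<beta>[OF this]
      show "\<beta> (a + a') t = \<beta> a t + \<beta> a' t"
        by (subst (1 2 3) \<beta>') (auto simp: linear_addD[OF rep(1)] algebra_simps sum.distrib)
    next
      fix c a t
      let ?E = "{e. rep a e \<noteq> 0} \<union> {e. rep (sA c a) e \<noteq> 0}"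
      have "finite ?E" using rep(2) by auto
      note \<beta>' = \<beta>[OF this]
      show "\<beta> (sA c a) t = c * \<beta> a t"
        by (subst (1 2) \<beta>') (auto simp: linear_scaleD[OF rep(1)] algebra_simps sum_distrib_left)
    qed (auto simp: \<beta>_def algebra_simps sum.distrib tscale_def sum_distrib_left)
    fix a ps
    have "\<gamma> a b c = (\<Sum>e | rep a e \<noteq> 0. rep a e * \<gamma> e b c)" for b c
      by (subst rep(3)[OF rep(2)[of a], of a, symmetric])
         (auto simp: linear_sumD[OF assms(2)] linear_scaleD[OF assms(2)])
    then have "(\<Sum>(b, c)\<leftarrow>ps. \<gamma> a b c) = (\<Sum>(b, c)\<leftarrow>ps. \<Sum>e | rep a e \<noteq> 0. rep a e * \<gamma> e b c)"
      by simp
    also have "\<dots> = (\<Sum>e | rep a e \<noteq> 0. rep a e * (\<Sum>(b, c)\<leftarrow>ps. \<gamma> e b c))"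
      by (induction ps) (auto simp: algebra_simps sum.distrib)
    finally show "\<beta> a (tensor_of sB sC ps) = (\<Sum>(b, c)\<leftarrow>ps. \<gamma> a b c)"
      by (simp add: \<beta>_def tensor_of_apply[OF bc])
  qed
qed

section \<open>Graded spaces\<close>

locale graded_space = vector_space s for s :: "'k::field \<Rightarrow> 'v::ab_group_add \<Rightarrow> 'v" +
  fixes G :: "nat \<Rightarrow> 'v set"
  assumes subspace_G: "subspace (G n)"
    and decomposition: "\<exists>!f. (\<forall>n. f n \<in> G n) \<and> finite {n. f n \<noteq> 0} \<and> r = (\<Sum>n | f n \<noteq> 0. f n)"
begin

definition pr :: "nat \<Rightarrow> 'v \<Rightarrow> 'v" where
  "pr n r = (THE f. (\<forall>n. f n \<in> G n) \<and> finite {n. f n \<noteq> 0} \<and> r = (\<Sum>n | f n \<noteq> 0. f n)) n"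

lemma pr_decomposition:
  "pr n r \<in> G n" "finite {n. pr n r \<noteq> 0}" "(\<Sum>n | pr n r \<noteq> 0. pr n r) = r"
  using theI'[OF decomposition[of r]] unfolding pr_def by (blast, blast, metis (lifting))

lemma pr_unique:
  assumes "\<And>n. f n \<in> G n" "finite F" "\<And>n. f n \<noteq> 0 \<Longrightarrow> n \<in> F" "r = (\<Sum>n\<in>F. f n)"
  shows "pr n r = f n"
proof -
  have sub: "{n. f n \<noteq> 0} \<subseteq> F" using assms(3) by auto
  then have "finite {n. f n \<noteq> 0}" using assms(2) finite_subset by blast
  moreover have "r = (\<Sum>n | f n \<noteq> 0. f n)"
    unfolding assms(4) by (rule sum.mono_neutral_right) (use assms(2) sub in auto)
  ultimately have "(THE f. (\<forall>n. f n \<in> G n) \<and> finite {n. f n \<noteq> 0} \<and> r = (\<Sum>n | f n \<noteq> 0. f n)) = f"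
    using assms(1) by (intro the1_equality[OF decomposition]) auto
  then show ?thesis by (simp add: pr_def)
qed

lemma sum_pr:
  assumes "finite F" "{n. pr n r \<noteq> 0} \<subseteq> F" shows "(\<Sum>n\<in>F. pr n r) = r"
proof -
  have "(\<Sum>n\<in>F. pr n r) = (\<Sum>n | pr n r \<noteq> 0. pr n r)"
    by (rule sum.mono_neutral_right) (use assms in auto)
  then show ?thesis by (simp only: pr_decomposition(3))
qed

lemma linear_pr: "Vector_Spaces.linear s s (pr n)"
proof -
  have "pr n (x + y) = pr n x + pr n y" for x y
  proof (rule pr_unique[where F = "{n. pr n x \<noteq> 0} \<union> {n. pr n y \<noteq> 0}"])
    show "x + y = (\<Sum>n\<in>{n. pr n x \<noteq> 0} \<union> {n. pr n y \<noteq> 0}. pr n x + pr n y)"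
      unfolding sum.distrib using sum_pr[of _ x] sum_pr[of _ y] by (simp add: pr_decomposition(2))
  qed (auto simp: pr_decomposition intro: subspace_add[OF subspace_G])
  moreover have "pr n (s c x) = s c (pr n x)" for c x
  proof (rule pr_unique[where F = "{n. pr n x \<noteq> 0}"])
    show "s c x = (\<Sum>n | pr n x \<noteq> 0. s c (pr n x))"
      by (simp only: scale_sum_right[symmetric] pr_decomposition(3))
  qed (auto simp: pr_decomposition intro: subspace_scale[OF subspace_G])
  ultimately show ?thesis using vector_space_axioms by (simp add: Vector_Spaces.linear_iff)
qed

lemmas pr_simps = linear_addD[OF linear_pr] linear_scaleD[OF linear_pr] linear_0D[OF linear_pr]
  linear_diffD[OF linear_pr] linear_sumD[OF linear_pr]

lemma pr_hom:
  assumes "x \<in> G n" shows "pr m x = (if m = n then x else 0)"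
  by (rule pr_unique[where F = "{n}"]) (use assms subspace_0[OF subspace_G] in \<open>auto split: if_splits\<close>)

lemma pr_eqI:
  assumes "\<And>n. pr n x = pr n y" shows "x = y"
proof -
  have "(\<Sum>n | pr n x \<noteq> 0. pr n x) = (\<Sum>n | pr n y \<noteq> 0. pr n y)" by (simp only: assms)
  then show ?thesis by (simp only: pr_decomposition(3))
qed

text \<open>An element is a finite sum of its components; the empty sum is covered because 0 is
  homogeneous.\<close>

lemma hom_induct [case_names hom add]:
  assumes "\<And>n x. x \<in> G n \<Longrightarrow> Q x" "\<And>x y. Q x \<Longrightarrow> Q y \<Longrightarrow> Q (x + y)"
  shows "Q r"
proof -
  have Q: "Q (pr n r)" for n using assms(1) pr_decomposition(1) by blast
  have Q0: "Q 0" using assms(1) subspace_0[OF subspace_G[of 0]] by blast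
  have "Q (\<Sum>n\<in>F. pr n r)" if "finite F" for F
    using that by (induction F rule: finite_induct) (auto intro: assms(2) Q Q0)
  then show ?thesis using pr_decomposition(2,3)[of r] by metis
qed

text \<open>The sum of the components of degree less than \<open>n\<close>. Coproduct slices and
  twisted elements need not be homogeneous, so inductions on the degree have to speak about this
  space as well.\<close>

definition below :: "nat \<Rightarrow> 'v set" where
  "below n = {x. \<forall>i\<ge>n. pr i x = 0}"

lemma subspace_below: "subspace (below n)"
  by (auto simp: below_def subspace_def pr_simps)

lemma G_subset_below: "i < n \<Longrightarrow> G i \<subseteq> below n"
  by (auto simp: below_def pr_hom)

lemma ex_below: obtains n where "x \<in> below n"
proof -
  obtain n where "\<forall>i\<in>{n. pr n x \<noteq> 0}. i < n"
    using pr_decomposition(2) finite_nat_set_iff_bounded by blast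
  then have "x \<in> below n" by (force simp: below_def)
  then show thesis by (rule that)
qed

text \<open>The projection \<open>pr n\<close> is the identity on \<open>L n\<close> and zero on the
  other \<open>L m\<close>, so it maps the span of all of them into \<open>L n\<close>.\<close>

lemma G_subset_generating:
  assumes L: "\<And>n. subspace (L n)" "\<And>n. L n \<subseteq> G n" and U: "span (\<Union>n. L n) = UNIV"
  shows "G n \<subseteq> L n"
proof
  have sub: "subspace {x. pr n x \<in> L n}"
    using L(1)[of n] by (auto simp: subspace_def pr_simps)
  have "pr n y \<in> L n" if y: "y \<in> L m" for m y
    using L(2)[of m] y subspace_0[OF L(1)[of n]] by (auto simp: pr_hom)
  then have "span (\<Union>n. L n) \<subseteq> {x. pr n x \<in> L n}"
    by (intro span_minimal[OF _ sub]) auto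
  then have *: "pr n x \<in> L n" for x unfolding U by auto
  fix x assume "x \<in> G n"
  then show "x \<in> L n" using *[of x] by (simp add: pr_hom)
qed

end

text \<open>The radical is graded, so it suffices to test homogeneous elements.\<close>

lemma graded_radical_below:
  assumes gR: "graded_space sR G" and gS: "graded_space sS H"
    and q: "bilinear_map sR sS (*) q"
    and orth: "\<And>i j r s. r \<in> G i \<Longrightarrow> s \<in> H j \<Longrightarrow> i \<noteq> j \<Longrightarrow> q r s = (0 :: 'k::field)"
    and min: "\<And>i r. i < n \<Longrightarrow> r \<in> G i \<Longrightarrow> (\<And>s. q r s = 0) \<Longrightarrow> r = 0"
    and x: "x \<in> graded_space.below G n" "\<And>s. q x s = 0"
  shows "x = 0"
proof -
  interpret R: graded_space sR G by fact
  interpret S: graded_space sS H by fact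
  note bl = bilinear_formD[OF q]
  have q1: "q y s = q (R.pr j y) s" if s: "s \<in> H j" for y s j
  proof (induction y rule: R.hom_induct)
    case (hom n y) then show ?case using s by (auto simp: R.pr_hom bl orth)
  qed (simp add: R.pr_simps bl)
  have q2: "q (R.pr i x) s = 0" for i s
  proof (induction s rule: S.hom_induct)
    case (hom j s)
    show ?case
    proof (cases "i = j")
      case True then show ?thesis using q1[OF hom, of x] x(2) by simp
    qed (auto intro: orth[OF R.pr_decomposition(1) hom])
  qed (simp add: bl)
  show ?thesis
  proof (rule R.pr_eqI)
    show "R.pr i x = R.pr i 0" for i
    proof (cases "i < n")
      case True then show ?thesis using min[OF True R.pr_decomposition(1) q2] by (simp add: R.pr_simps)
    next
      case False then show ?thesis using x(1) by (simp add: R.below_def R.pr_simps)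
    qed
  qed
qed

section \<open>Evaluation of coproducts and coactions\<close>

lemma linear_form_sweedler:
  assumes "Vector_Spaces.linear s tscale T" "range T \<subseteq> tensor_space sA sB"
    "bilinear_map sA sB (*) \<beta>"
  shows "linear_form s (\<lambda>v. sweedler sA sB (T v) \<beta>)"
proof (rule linear_formI)
  show "vector_space s" using assms(1) by (simp add: Vector_Spaces.linear_iff)
  have eq: "sweedler sA sB (T v) \<beta> = T v \<beta>" for v
    using assms(2,3) by (intro sweedler_form) auto
  show "sweedler sA sB (T (x + y)) \<beta> = sweedler sA sB (T x) \<beta> + sweedler sA sB (T y) \<beta>" for x y
    unfolding eq by (simp add: linear_addD[OF assms(1)])
  show "sweedler sA sB (T (s c x)) \<beta> = c * sweedler sA sB (T x) \<beta>" for c x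
    unfolding eq by (simp add: linear_scaleD[OF assms(1)] tscale_def)
qed

lemma hopf_algebraD:
  assumes "hopf_algebra H"
  shows "vector_space (hscale H)" "unital_algebra (hscale H)"
    "range (hcomult H) \<subseteq> tensor_space (hscale H) (hscale H)"
    "Vector_Spaces.linear (hscale H) tscale (hcomult H)"
    "linear_form (hscale H) (hcounit H)" "hcounit H (a * b) = hcounit H a * hcounit H b"
    "hcounit H 1 = 1" "Vector_Spaces.linear (hscale H) (hscale H) (antipode H)"
    "hscale H c a * b = hscale H c (a * b)" "a * hscale H c b = hscale H c (a * b)"
    "hcomult H 1 = pure_tensor (hscale H) (hscale H) 1 1"
  using assms by (auto simp: hopf_algebra_def coalgebra_def unital_algebra_def)

lemma sw_form:
  assumes "hopf_algebra H" "bilinear_map (hscale H) (hscale H) (*) \<beta>"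
  shows "sw H a \<beta> = hcomult H a \<beta>"
  unfolding sw_def using hopf_algebraD(3)[OF assms(1)] by (intro sweedler_form assms(2)) auto

lemma sw_1:
  assumes H: "hopf_algebra H" and F: "bilinear_map (hscale H) (hscale H) sC F"
  shows "sw H 1 F = F 1 1"
  unfolding sw_def hopf_algebraD(11)[OF H] by (subst sweedler_tensor_of[OF F]) auto

lemma sw_counit:
  assumes H: "hopf_algebra H" and \<phi>: "linear_form (hscale H) \<phi>"
  shows "sw H a (\<lambda>a1 a2. \<phi> a1 * hcounit H a2) = \<phi> a" "sw H a (\<lambda>a1 a2. hcounit H a1 * \<phi> a2) = \<phi> a"
proof -
  have "sw H a (\<lambda>a1 a2. hscale H (hcounit H a2) a1) = a" "sw H a (\<lambda>a1 a2. hscale H (hcounit H a1) a2) = a"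
    using H by (auto simp: hopf_algebra_def coalgebra_def sw_def)
  then have "\<phi> a = sw H a (\<lambda>a1 a2. \<phi> (hscale H (hcounit H a2) a1))"
     "\<phi> a = sw H a (\<lambda>a1 a2. \<phi> (hscale H (hcounit H a1) a2))"
    unfolding sw_def using sweedler_linear[OF \<phi>] by metis+
  then show "sw H a (\<lambda>a1 a2. \<phi> a1 * hcounit H a2) = \<phi> a" "sw H a (\<lambda>a1 a2. hcounit H a1 * \<phi> a2) = \<phi> a"
    by (simp_all add: linear_scaleD[OF \<phi>] mult.commute)
qed

lemma sw_antipode:
  assumes H: "hopf_algebra H" and \<phi>: "linear_form (hscale H) \<phi>"
  shows "sw H a (\<lambda>a1 a2. \<phi> (a1 * antipode H a2)) = hcounit H a * \<phi> 1"
proof -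
  have "sw H a (\<lambda>a1 a2. a1 * antipode H a2) = hscale H (hcounit H a) 1"
    using H by (auto simp: hopf_algebra_def)
  then have "\<phi> (hscale H (hcounit H a) 1) = sw H a (\<lambda>a1 a2. \<phi> (a1 * antipode H a2))"
    unfolding sw_def using sweedler_linear[OF \<phi>] by metis
  then show ?thesis by (simp add: linear_scaleD[OF \<phi>])
qed

lemma yetter_drinfeldD:
  assumes "yetter_drinfeld J V"
  shows "vector_space (yscale V)" "range (ycoact V) \<subseteq> tensor_space (hscale J) (yscale V)"
    "Vector_Spaces.linear (yscale V) tscale (ycoact V)" "yact V 1 v = v"
    "bilinear_map (hscale J) (yscale V) (yscale V) (yact V)"
  using assms by (auto simp: yetter_drinfeld_def)

lemma co_form:
  assumes "yetter_drinfeld J V" "bilinear_map (hscale J) (yscale V) (*) \<beta>"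
  shows "co J V v \<beta> = ycoact V v \<beta>"
  unfolding co_def using yetter_drinfeldD(2)[OF assms(1)] by (intro sweedler_form assms(2)) auto

lemma linear_form_co:
  assumes "yetter_drinfeld J V" "bilinear_map (hscale J) (yscale V) (*) \<beta>"
  shows "linear_form (yscale V) (\<lambda>v. co J V v \<beta>)"
  unfolding co_def by (intro linear_form_sweedler yetter_drinfeldD[OF assms(1)] assms)

lemma co_counit:
  assumes V: "yetter_drinfeld J V" and \<phi>: "linear_form (yscale V) \<phi>"
  shows "co J V v (\<lambda>j u. hcounit J j * \<phi> u) = \<phi> v"
proof -
  have "co J V v (\<lambda>j u. yscale V (hcounit J j) u) = v"
    using V by (auto simp: yetter_drinfeld_def)
  then have "\<phi> v = co J V v (\<lambda>j u. \<phi> (yscale V (hcounit J j) u))"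
    unfolding co_def using sweedler_linear[OF \<phi>] by metis
  then show ?thesis by (simp add: linear_scaleD[OF \<phi>])
qed

text \<open>The axiom is an equation between nested tensors. It is evaluated at the extension
  \<open>\<beta>\<close> of \<open>\<gamma>\<close> supplied by \<open>trilinear_extension\<close>,
  whose value at \<open>j\<close> and \<open>ycoact V u\<close> is again a sum over the
  coaction.\<close>

lemma co_coassoc:
  assumes J: "hopf_algebra J" and V: "yetter_drinfeld J V"
    and \<gamma>: "\<And>b c. linear_form (hscale J) (\<lambda>a. \<gamma> a b c)"
    "\<And>a. bilinear_map (hscale J) (yscale V) (*) (\<gamma> a)"
  shows "co J V v (\<lambda>j u. sw J j (\<lambda>j1 j2. \<gamma> j1 j2 u)) = co J V v (\<lambda>j u. co J V u (\<lambda>j' u'. \<gamma> j j' u'))"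
proof -
  obtain \<beta> where \<beta>: "bilinear_map (hscale J) tscale (*) \<beta>"
    "\<And>a ps. \<beta> a (tensor_of (hscale J) (yscale V) ps) = (\<Sum>(b, c)\<leftarrow>ps. \<gamma> a b c)"
    using trilinear_extension[of "hscale J" \<gamma>, OF hopf_algebraD(1)[OF J] \<gamma>] by blast
  have \<beta>': "\<beta> j (ycoact V u) = co J V u (\<gamma> j)" for j u
  proof -
    have "ycoact V u \<in> tensor_space (hscale J) (yscale V)" using yetter_drinfeldD(2)[OF V] by auto
    then obtain ps where "ycoact V u = tensor_of (hscale J) (yscale V) ps"
      "sweedler (hscale J) (yscale V) (ycoact V u) (\<gamma> j) = (\<Sum>(a, b)\<leftarrow>ps. \<gamma> j a b)"
      using sweedler_rep by metis
    then show ?thesis using \<beta>(2) by (simp add: co_def)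
  qed
  have "co J V v (\<lambda>j u. sw J j (\<lambda>j1 j2. pure_tensor (hscale J) tscale j1 (pure_tensor (hscale J) (yscale V) j2 u)))
      = co J V v (\<lambda>j u. pure_tensor (hscale J) tscale j (ycoact V u))"
    using V by (simp add: yetter_drinfeld_def)
  from arg_cong[OF this, of "\<lambda>t. t \<beta>"] show ?thesis
    by (simp add: co_def sw_def sweedler_apply tensor_of_apply[OF \<beta>(1)] \<beta>(2) \<beta>')
qed

lemma graded_braided_bialgebraD:
  assumes "graded_braided_bialgebra J R"
  shows "yetter_drinfeld J R" "vector_space (yscale R)" "graded_space (yscale R) (grade R)"
    "range (bcomult R) \<subseteq> tensor_space (yscale R) (yscale R)"
    "Vector_Spaces.linear (yscale R) tscale (bcomult R)"
    "linear_form (yscale R) (bcounit R)" "bcounit R (a * b) = bcounit R a * bcounit R b"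
    "bcounit R 1 = 1"
    "yscale R c a * b = yscale R c (a * b)" "a * yscale R c b = yscale R c (a * b)"
    "bcomult R 1 = pure_tensor (yscale R) (yscale R) 1 1"
    "ycoact R 1 = pure_tensor (hscale J) (yscale R) 1 1"
    "1 \<in> grade R 0" "r \<in> grade R m \<Longrightarrow> r' \<in> grade R n \<Longrightarrow> r * r' \<in> grade R (m + n)"
    "n > 0 \<Longrightarrow> r \<in> grade R n \<Longrightarrow> bcounit R r = 0"
    "yact R j 1 = yscale R (hcounit J j) 1" "coalgebra (yscale R) (bcomult R) (bcounit R)"
    "r \<in> grade R n \<Longrightarrow> \<exists>ps. (\<forall>(p, q)\<in>set ps. \<exists>i j. i + j = n \<and> p \<in> grade R i \<and> q \<in> grade R j) \<and>
      bcomult R r = tensor_of (yscale R) (yscale R) ps"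
    "r \<in> grade R n \<Longrightarrow> \<exists>ps. (\<forall>(j, u)\<in>set ps. u \<in> grade R n) \<and>
      ycoact R r = tensor_of (hscale J) (yscale R) ps"
proof -
  note gb = assms[unfolded graded_braided_bialgebra_def]
  note b = conjunct1[OF gb, unfolded braided_bialgebra_def]
  show "yetter_drinfeld J R" using b by (elim conjE)
  then show v: "vector_space (yscale R)" by (simp add: yetter_drinfeldD)
  have "\<forall>n. module.subspace (yscale R) (grade R n)"
    "\<forall>r. \<exists>!f. (\<forall>n. f n \<in> grade R n) \<and> finite {n. f n \<noteq> 0} \<and> r = (\<Sum>n | f n \<noteq> 0. f n)"
    using gb by - (elim conjE, assumption)+
  then show "graded_space (yscale R) (grade R)"
    unfolding graded_space_def graded_space_axioms_def using v by (intro conjI)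
  have ua: "unital_algebra (yscale R)" using b by (elim conjE)
  show "yscale R c a * b = yscale R c (a * b)" "a * yscale R c b = yscale R c (a * b)"
    using ua by (auto simp: unital_algebra_def)
  show c: "coalgebra (yscale R) (bcomult R) (bcounit R)" using b by (elim conjE)
  show "range (bcomult R) \<subseteq> tensor_space (yscale R) (yscale R)"
    "Vector_Spaces.linear (yscale R) tscale (bcomult R)" "linear_form (yscale R) (bcounit R)"
    using c unfolding coalgebra_def by - (elim conjE, assumption)+
  have "\<forall>r s. bcounit R (r * s) = bcounit R r * bcounit R s"
    "\<forall>a. yact R a 1 = yscale R (hcounit J a) 1"
    using b by - (elim conjE, assumption)+
  then show "bcounit R (a * b) = bcounit R a * bcounit R b" "yact R j 1 = yscale R (hcounit J j) 1"
    by blast+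
  show "bcounit R 1 = 1" "bcomult R 1 = pure_tensor (yscale R) (yscale R) 1 1"
    "ycoact R 1 = pure_tensor (hscale J) (yscale R) 1 1"
    using b by - (elim conjE, assumption)+
  show "1 \<in> grade R 0" using gb by (elim conjE)
  have "\<forall>m n. \<forall>r\<in>grade R m. \<forall>s\<in>grade R n. r * s \<in> grade R (m + n)"
    "\<forall>n>0. \<forall>r\<in>grade R n. bcounit R r = 0"
    using gb by - (elim conjE, assumption)+
  then show "r \<in> grade R m \<Longrightarrow> r' \<in> grade R n \<Longrightarrow> r * r' \<in> grade R (m + n)"
    "n > 0 \<Longrightarrow> r \<in> grade R n \<Longrightarrow> bcounit R r = 0" by blast+
  have "\<forall>n. \<forall>r\<in>grade R n. \<exists>ps. (\<forall>(j, u)\<in>set ps. u \<in> grade R n) \<and>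
      ycoact R r = tensor_of (hscale J) (yscale R) ps"
    "\<forall>n. \<forall>r\<in>grade R n. \<exists>ps.
      (\<forall>(p, q)\<in>set ps. \<exists>i j. i + j = n \<and> p \<in> grade R i \<and> q \<in> grade R j) \<and>
      bcomult R r = tensor_of (yscale R) (yscale R) ps"
    using gb by - (elim conjE, assumption)+
  then show "r \<in> grade R n \<Longrightarrow> \<exists>ps. (\<forall>(p, q)\<in>set ps. \<exists>i j. i + j = n \<and> p \<in> grade R i \<and> q \<in> grade R j) \<and>
          bcomult R r = tensor_of (yscale R) (yscale R) ps"
        "r \<in> grade R n \<Longrightarrow> \<exists>ps. (\<forall>(j, u)\<in>set ps. u \<in> grade R n) \<and>
          ycoact R r = tensor_of (hscale J) (yscale R) ps"
    by - (elim allE, erule bspec, assumption)+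
qed

lemma bsw_form:
  assumes "graded_braided_bialgebra J R" "bilinear_map (yscale R) (yscale R) (*) \<beta>"
  shows "bsw R r \<beta> = bcomult R r \<beta>"
  unfolding bsw_def using graded_braided_bialgebraD(4)[OF assms(1)]
  by (intro sweedler_form assms(2)) auto

lemma bsw_counit:
  assumes R: "graded_braided_bialgebra J R"
  shows "bsw R r (\<lambda>r1 r2. yscale R (bcounit R r2) r1) = r"
    "linear_form (yscale R) \<phi> \<Longrightarrow> bsw R r (\<lambda>r1 r2. \<phi> r1 * bcounit R r2) = \<phi> r"
    "linear_form (yscale R) \<phi> \<Longrightarrow> bsw R r (\<lambda>r1 r2. bcounit R r1 * \<phi> r2) = \<phi> r"
proof -
  have *: "bsw R r (\<lambda>r1 r2. yscale R (bcounit R r2) r1) = r"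
    "bsw R r (\<lambda>r1 r2. yscale R (bcounit R r1) r2) = r"
    using graded_braided_bialgebraD(17)[OF R] by (auto simp: coalgebra_def bsw_def)
  then show "bsw R r (\<lambda>r1 r2. yscale R (bcounit R r2) r1) = r" by simp
  assume \<phi>: "linear_form (yscale R) \<phi>"
  have "\<phi> r = bsw R r (\<lambda>r1 r2. \<phi> (yscale R (bcounit R r2) r1))"
     "\<phi> r = bsw R r (\<lambda>r1 r2. \<phi> (yscale R (bcounit R r1) r2))"
    unfolding bsw_def using * sweedler_linear[OF \<phi>] by (metis bsw_def)+
  then show "bsw R r (\<lambda>r1 r2. \<phi> r1 * bcounit R r2) = \<phi> r" "bsw R r (\<lambda>r1 r2. bcounit R r1 * \<phi> r2) = \<phi> r"
    by (simp_all add: linear_scaleD[OF \<phi>] mult.commute)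
qed

section \<open>Pre-Nichols algebras: generation in degree one, and a criterion for vanishing\<close>

lemma pre_nicholsD:
  assumes "pre_nichols J V R \<iota>"
  shows "graded_braided_bialgebra J R" "grade R 0 = range (\<lambda>c. yscale R c 1)"
    "Vector_Spaces.linear (yscale V) (yscale R) \<iota>" "inj \<iota>" "range \<iota> = grade R 1"
    "module.subspace (yscale R) U \<Longrightarrow> 1 \<in> U \<Longrightarrow> (\<And>r s. r \<in> U \<Longrightarrow> s \<in> U \<Longrightarrow> r * s \<in> U)
      \<Longrightarrow> grade R 1 \<subseteq> U \<Longrightarrow> U = UNIV"
proof -
  note pn = assms[unfolded pre_nichols_def bij_betw_def]
  show "graded_braided_bialgebra J R" "grade R 0 = range (\<lambda>c. yscale R c 1)"
    "Vector_Spaces.linear (yscale V) (yscale R) \<iota>" "inj \<iota>" "range \<iota> = grade R 1"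
    using pn by - (elim conjE, assumption)+
  have "\<forall>U. module.subspace (yscale R) U \<and> 1 \<in> U \<and> (\<forall>r\<in>U. \<forall>s\<in>U. r * s \<in> U) \<and> grade R 1 \<subseteq> U
        \<longrightarrow> U = UNIV" using pn by - (elim conjE, assumption)+
  then show "module.subspace (yscale R) U \<Longrightarrow> 1 \<in> U \<Longrightarrow> (\<And>r s. r \<in> U \<Longrightarrow> s \<in> U \<Longrightarrow> r * s \<in> U)
      \<Longrightarrow> grade R 1 \<subseteq> U \<Longrightarrow> U = UNIV" by simp
qed

text \<open>Let \<open>L n\<close> be the span of the n-fold products of degree-one elements. The
  \<open>L n\<close> lie in the corresponding degrees and multiply into each other, so their sum is
  a subalgebra containing the generators, hence everything; comparing components gives
  \<open>L n = grade R n\<close>.\<close>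

lemma pre_nichols_grade_Suc:
  assumes "pre_nichols J V R \<iota>"
  shows "grade R (Suc n) = module.span (yscale R) {w * x | w x. w \<in> grade R 1 \<and> x \<in> grade R n}"
proof -
  note pn = pre_nicholsD[OF assms]
  note gb = graded_braided_bialgebraD[OF pn(1)]
  interpret graded_space "yscale R" "grade R" by (rule gb)
  define L where "L = rec_nat (grade R 0) (\<lambda>_ X. span {w * x | w x. w \<in> grade R 1 \<and> x \<in> X})"
  have L0: "L 0 = grade R 0" and LS: "L (Suc n) = span {w * x | w x. w \<in> grade R 1 \<and> x \<in> L n}" for n
    by (simp_all add: L_def)
  have Lsub: "subspace (L n)" for n by (cases n) (auto simp: L0 LS subspace_G)
  have LG: "L n \<subseteq> grade R n" for n
  proof (induction n)
    case (Suc n)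
    have "{w * x | w x. w \<in> grade R 1 \<and> x \<in> L n} \<subseteq> grade R (Suc n)"
      using gb(14)[of _ 1 _ n] subsetD[OF Suc] by auto
    then show ?case unfolding LS by (intro span_minimal subspace_G)
  qed (simp add: L0)
  have Lmult: "x * y \<in> L (m + n)" if "x \<in> L m" "y \<in> L n" for m n x y
    using that
  proof (induction m arbitrary: x)
    case 0
    then obtain c where "x = yscale R c 1" by (auto simp: L0 pn(2))
    then show ?case using 0 subspace_scale[OF Lsub] by (simp add: gb(9))
  next
    case (Suc m)
    have "subspace {x. x * y \<in> L (Suc m + n)}"
      using subspace_0[OF Lsub] subspace_add[OF Lsub] subspace_scale[OF Lsub]
      by (auto simp: subspace_def distrib_right gb(9))
    moreover have "w * x * y \<in> L (Suc m + n)" if "w \<in> grade R 1" "x \<in> L m" for w x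
    proof -
      have "x * y \<in> L (m + n)" using Suc that by simp
      then have "w * (x * y) \<in> L (Suc (m + n))" unfolding LS using that by (intro span_base) auto
      then show ?thesis by (simp add: mult.assoc)
    qed
    ultimately have "L (Suc m) \<subseteq> {x. x * y \<in> L (Suc m + n)}"
      unfolding LS[of m] by (intro span_minimal) auto
    then show ?case using Suc.prems(1) by auto
  qed
  let ?U = "span (\<Union>n. L n)"
  have LU: "x \<in> ?U" if "x \<in> L n" for x n using that by (intro span_base) auto
  have "?U = UNIV"
  proof (rule pn(6))
    show "1 \<in> ?U" using gb(13) by (intro LU[of _ 0]) (simp add: L0)
    show "grade R 1 \<subseteq> ?U"
    proof
      fix w assume "w \<in> grade R 1"
      then have "w * 1 \<in> L (Suc 0)" unfolding LS L0 using gb(13) by (intro span_base CollectI exI[of _ w] exI[of _ 1]) auto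
      then show "w \<in> ?U" using LU by simp
    qed
    fix r r' assume r: "r \<in> ?U" and r': "r' \<in> ?U"
    have mult: "x * r' \<in> ?U" if x: "x \<in> L m" for x m
    proof -
      have "subspace {y. x * y \<in> ?U}"
        using span_zero span_add span_scale by (auto simp: subspace_def distrib_left gb(10))
      then have "?U \<subseteq> {y. x * y \<in> ?U}" using LU[OF Lmult[OF x]] by (intro span_minimal) auto
      then show ?thesis using r' by auto
    qed
    have "subspace {x. x * r' \<in> ?U}"
      using span_zero span_add span_scale by (auto simp: subspace_def distrib_right gb(9))
    then have "?U \<subseteq> {x. x * r' \<in> ?U}" using mult by (intro span_minimal) auto
    then show "r * r' \<in> ?U" using r by auto
  qed simp
  then have "grade R n \<subseteq> L n" for n by (rule G_subset_generating[OF Lsub LG])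
  then have eq: "L n = grade R n" for n using LG by blast
  show ?thesis using LS[of n] unfolding eq .
qed

text \<open>Meant for \<open>N\<close> a radical that is already known to vanish below degree
  \<open>n\<close>. The hypothesis controls the slices of the coproduct along forms
  \<open>\<phi>\<close> modulo \<open>N\<close>. For slices that stay below degree \<open>n\<close>
  it becomes an equation, and this forces \<open>x\<close> to be primitive.\<close>

lemma nichols_element_eq_0:
  assumes R: "nichols J V R \<iota>" and x: "x \<in> grade R n" and n: "n \<ge> 2"
    and N: "module.subspace (yscale R) N" "N \<inter> graded_space.below (grade R) n \<subseteq> {0}"
    and \<Delta>: "\<And>\<phi>. linear_form (yscale R) \<phi> \<Longrightarrow>
       bsw R x (\<lambda>x1 x2. yscale R (\<phi> x2) x1) - yscale R (\<phi> x) 1 \<in> N"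
  shows "x = 0"
proof -
  have pn': "pre_nichols J V R \<iota>" and prim: "grade R 1 = primitives R"
    using R by (auto simp: nichols_def)
  note pn = pre_nicholsD[OF pn']
  note gb = graded_braided_bialgebraD[OF pn(1)]
  note eps = linear_addD[OF gb(6)] linear_scaleD[OF gb(6)]
  interpret graded_space "yscale R" "grade R" by (rule gb)
  obtain ps where ps: "\<And>a b. (a, b) \<in> set ps \<Longrightarrow> \<exists>i j. i + j = n \<and> a \<in> grade R i \<and> b \<in> grade R j"
    "bcomult R x = tensor_of (yscale R) (yscale R) ps"
    using gb(18)[OF x] by fastforce
  define X where "X \<phi> = (\<Sum>(a, b)\<leftarrow>ps. yscale R (\<phi> b) a)" for \<phi>
  have bX: "bsw R x (\<lambda>x1 x2. yscale R (\<phi> x2) x1) = X \<phi>" if \<phi>: "linear_form (yscale R) \<phi>" for \<phi>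
  proof -
    have "bilinear_map (yscale R) (yscale R) (yscale R) (\<lambda>x1 x2. yscale R (\<phi> x2) x1)"
      using \<phi> vector_space_axioms vector_space_field
      by (simp add: bilinear_map_def Vector_Spaces.linear_iff algebra_simps)
    then show ?thesis unfolding bsw_def ps(2) X_def by (rule sweedler_tensor_of)
  qed
  have one: "yscale R c 1 \<in> below n" for c
    using n subsetD[OF G_subset_below gb(13), of n] by (intro subspace_scale[OF subspace_below]) simp
  \<comment> \<open>Left legs of degree \<open>n\<close> are accompanied by right legs of degree 0,
    that is by scalars, and these are killed by \<open>\<phi>\<close>; all other terms stay below
    degree \<open>n\<close>.\<close>
  have X0: "X \<phi> = yscale R (\<phi> x) 1" if \<phi>: "linear_form (yscale R) \<phi>" "\<phi> 1 = 0" for \<phi>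
  proof -
    have "yscale R (\<phi> b) a \<in> below n" if ab: "(a, b) \<in> set ps" for a b
    proof -
      obtain i j where ij: "i + j = n" "a \<in> grade R i" "b \<in> grade R j" using ps(1)[OF ab] by blast
      show ?thesis
      proof (cases "j = 0")
        case True
        then obtain c where "b = yscale R c 1" using ij(3) pn(2) by auto
        then have "\<phi> b = 0" using \<phi> by (simp add: linear_scaleD)
        then show ?thesis using subspace_0[OF subspace_below] by simp
      next
        case False
        then show ?thesis using ij G_subset_below[of i n] subspace_scale[OF subspace_below] by auto
      qed
    qed
    then have "X \<phi> \<in> below n" unfolding X_def
      by (induction ps) (auto simp: subspace_0[OF subspace_below] intro!: subspace_add[OF subspace_below])
    then have "X \<phi> - yscale R (\<phi> x) 1 \<in> below n" using one subspace_diff[OF subspace_below] by blast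
    then show ?thesis using \<Delta>[OF \<phi>(1)] N(2) by (auto simp: bX[OF \<phi>(1)])
  qed
  have X1: "X \<phi> = yscale R (\<phi> 1) x + yscale R (\<phi> x) 1" if \<phi>: "linear_form (yscale R) \<phi>" for \<phi>
  proof -
    \<comment> \<open>Subtracting \<open>\<phi> 1\<close> times the counit makes the form vanish at
      1, and by the counit axiom the slice along the counit is \<open>x\<close> itself.\<close>
    let ?\<psi> = "\<lambda>r. \<phi> r - \<phi> 1 * bcounit R r"
    have "linear_form (yscale R) ?\<psi>"
      by (rule linear_formI[OF vector_space_axioms])
         (simp_all add: linear_addD[OF \<phi>] linear_scaleD[OF \<phi>] eps algebra_simps)
    then have "X ?\<psi> = yscale R (?\<psi> x) 1" by (rule X0) (simp add: gb)
    moreover have "bcounit R x = 0" using gb(15)[OF _ x] n by simp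
    moreover have "X ?\<psi> = X \<phi> - yscale R (\<phi> 1) (X (bcounit R))"
      unfolding X_def by (induction ps) (auto simp: algebra_simps)
    moreover have "X (bcounit R) = x" using bX[OF gb(6)] bsw_counit(1)[OF pn(1)] by simp
    ultimately show ?thesis by (simp add: algebra_simps)
  qed
  have "bcomult R x = tensor_of (yscale R) (yscale R) [(x, 1), (1, x)]"
    unfolding ps(2)
    by (rule tensor_of_eqI) (use X1 in \<open>auto simp: X_def vector_space_axioms\<close>)
  also have "\<dots> = pure_tensor (yscale R) (yscale R) x 1 + pure_tensor (yscale R) (yscale R) 1 x"
    by (auto simp: tensor_of_def fun_eq_iff)
  finally have "x \<in> grade R 1" unfolding prim primitives_def by blast
  \<comment> \<open>Now \<open>x\<close> is homogeneous both of degree 1 and of degree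
    \<open>n\<close>, so its component of degree 1 is both \<open>x\<close> and 0.\<close>
  then show ?thesis using pr_hom[OF x, of 1] pr_hom[of x 1 1] n by simp
qed

section \<open>The pairing of two Nichols algebras\<close>

lemma lin_full:
  assumes "vector_space s" "vector_space s'"
  shows "g \<in> lin (full s) (full s') \<longleftrightarrow> Vector_Spaces.linear s s' g"
  using assms by (auto simp: lin_def full_def Vector_Spaces.linear_iff)

lemma carrier_full [simp]: "carrier (full s) = UNIV"
  by (simp add: full_def)

lemma bilin_full:
  assumes "vector_space s1" "vector_space s2" "vector_space s3"
  shows "f \<in> bilin (full s1) (full s2) (full s3) \<longleftrightarrow> bilinear_map s1 s2 s3 f"
  using assms by (auto simp: bilin_def bilinear_map_def lin_full restrict_UNIV)

lemma vspace_full: "vspace (full s) \<longleftrightarrow> vector_space s"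
proof
  assume "vspace (full s)"
  then show "vector_space s" by unfold_locales (auto simp: vspace_def full_def)
next
  assume "vector_space s"
  then interpret vector_space s .
  have "\<exists>y. x + y = 0" for x :: 'b by (rule exI[of _ "- x"]) simp
  then show "vspace (full s)" by (auto simp: vspace_def full_def algebra_simps)
qed

lemma tensor_product_full:
  assumes "tensor_product (full s1) (full s2) (full s3) t"
  shows "bilinear_map s1 s2 s3 t" "vector_space s1" "vector_space s2" "vector_space s3"
  using assms by (auto simp: tensor_product_def vspace_full bilin_full)

locale q_boson =
  fixes J :: "('k::field, 'j::ring_1) hopf"
    and K :: "('k, 'c::ring_1) hopf"
    and \<tau>0 :: "'j \<Rightarrow> 'c \<Rightarrow> 'k"
    and V :: "('k, 'j, 'v::ab_group_add) yd"
    and W :: "('k, 'c, 'w::ab_group_add) yd"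
    and \<tau>1 :: "'v \<Rightarrow> 'w \<Rightarrow> 'k"
    and R :: "('k, 'j, 'r::ring_1) graded_yd_bialg" and \<iota>V :: "'v \<Rightarrow> 'r"
    and S :: "('k, 'c, 's::ring_1) graded_yd_bialg" and \<iota>W :: "'w \<Rightarrow> 's"
    and A :: "('k, 'a::ring_1) hopf" and tA :: "'r \<Rightarrow> 'j \<Rightarrow> 'a"
    and X :: "('k, 'x::ring_1) hopf" and tX :: "'s \<Rightarrow> 'c \<Rightarrow> 'x"
    and \<tau> :: "'a \<Rightarrow> 'x \<Rightarrow> 'k"
    and sB :: "'k \<Rightarrow> 'b::ring_1 \<Rightarrow> 'b" and tB :: "'r \<Rightarrow> 's \<Rightarrow> 'b"
    and \<rho> :: "'b \<Rightarrow> 'r \<Rightarrow> 'r"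
  assumes data: "boson_data J K \<tau>0 V W \<tau>1 R \<iota>V S \<iota>W"
    and fin_W: "finite_dim (yscale W)"
    and bos_A: "bosonization J R A tA" and bos_X: "bosonization K S X tX"
    and pairing: "extended_pairing \<tau>0 \<tau>1 \<iota>V \<iota>W A tA X tX \<tau>"
    and algebra_B: "q_boson_algebra J K \<tau>0 V W \<tau>1 R \<iota>V S \<iota>W sB tB"
    and action: "boson_action R tA tX \<tau> sB tB \<rho>"
    and nondeg: "nondegenerate \<tau>1"
    and nichols_R: "nichols J V R \<iota>V" and nichols_S: "nichols K W S \<iota>W"
begin

lemma pre_R: "pre_nichols J V R \<iota>V" and pre_S: "pre_nichols K W S \<iota>W"
  using nichols_R nichols_S by (auto simp: nichols_def)

lemma hopf: "hopf_algebra J" "hopf_algebra K" "hopf_algebra A" "hopf_algebra X"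
  using data bos_A bos_X by (auto simp: boson_data_def bosonization_def)

lemmas gb_R = pre_nicholsD(1)[OF pre_R] and gb_S = pre_nicholsD(1)[OF pre_S]
lemmas R = graded_braided_bialgebraD[OF gb_R] and S = graded_braided_bialgebraD[OF gb_S]

sublocale R: graded_space "yscale R" "grade R" by (rule R(3))
sublocale S: graded_space "yscale S" "grade S" by (rule S(3))

lemma tensors:
  "tensor_product (full (yscale R)) (full (hscale J)) (full (hscale A)) tA"
  "tensor_product (full (yscale S)) (full (hscale K)) (full (hscale X)) tX"
  "tensor_product (full (yscale R)) (full (yscale S)) (full sB) tB"
  using bos_A bos_X algebra_B by (auto simp: bosonization_def q_boson_algebra_def)

lemmas tA = bilinear_formD[OF tensor_product_full(1)[OF tensors(1)]]
  and tX = bilinear_formD[OF tensor_product_full(1)[OF tensors(2)]]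
  and tB = bilinear_formD[OF tensor_product_full(1)[OF tensors(3)]]

lemma skew: "skew_pairing A X \<tau>" "skew_pairing J K \<tau>0"
  using pairing data by (auto simp: extended_pairing_def boson_data_def)

lemma bilinear_\<tau>: "bilinear_map (hscale A) (hscale X) (*) \<tau>" "bilinear_map (hscale J) (hscale K) (*) \<tau>0"
  using skew by (auto simp: skew_pairing_def)

lemmas \<tau> = bilinear_formD[OF bilinear_\<tau>(1)] and \<tau>0 = bilinear_formD[OF bilinear_\<tau>(2)]

lemma bilinear_\<rho>: "bilinear_map sB (yscale R) (yscale R) \<rho>"
  using action by (simp add: boson_action_def)

lemmas \<rho> = bilinear_formD[OF bilinear_\<rho>]

lemma \<rho>_1: "\<rho> 1 r = r" and \<rho>_mult: "\<rho> (b * b') r = \<rho> b (\<rho> b' r)"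
  and \<rho>_R: "\<rho> (tB r' 1) r = r' * r"
  and \<rho>_S: "\<rho> (tB 1 s) r = bsw R r (\<lambda>r1 r2. yscale R (\<tau> (tA r1 1) (tX s 1)) r2)"
  using action unfolding boson_action_def by blast+

lemma tB_1: "tB 1 1 = 1" and tB_R: "tB r 1 * tB r' 1 = tB (r * r') 1"
  and tB_S: "tB 1 s * tB 1 s' = tB 1 (s * s')" and tB_RS: "tB r 1 * tB 1 s = tB r s"
  and tB_WV: "tB 1 (\<iota>W w) * tB (\<iota>V v) 1 =
        co J V v (\<lambda>j v'. co K W w (\<lambda>x w'. sB (\<tau>0 j x) (tB (\<iota>V v') (\<iota>W w')))) + sB (\<tau>1 v w) 1"
  using algebra_B by (auto simp: q_boson_algebra_def)

lemma \<tau>_values: "\<tau> (tA 1 a) (tX 1 x) = \<tau>0 a x" "\<tau> (tA (\<iota>V v) 1) (tX (\<iota>W w) 1) = \<tau>1 v w"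
  "\<tau> (tA 1 a) (tX (\<iota>W w) 1) = 0" "\<tau> (tA (\<iota>V v) 1) (tX 1 x) = 0"
  using pairing by (auto simp: extended_pairing_def)

section \<open>The action of \<open>S\<close> on \<open>R\<close> and its compatibility with the
  gradings\<close>

definition q :: "'r \<Rightarrow> 's \<Rightarrow> 'k" where
  "q r s = \<tau> (tA r 1) (tX s 1)"

definition act :: "'s \<Rightarrow> 'r \<Rightarrow> 'r" where
  "act s r = \<rho> (tB 1 s) r"

lemma bilinear_q: "bilinear_map (yscale R) (yscale S) (*) q"
  by (rule bilinear_formI) (auto simp: q_def tA tX \<tau> R S)

lemmas q = bilinear_formD[OF bilinear_q]

lemma bilinear_act: "bilinear_map (yscale S) (yscale R) (yscale R) act"
  using R(2) S(2) by (simp add: bilinear_map_def Vector_Spaces.linear_iff act_def tB \<rho>)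

lemmas act = bilinear_formD[OF bilinear_act]

lemma act_mult: "act (s * s') r = act s (act s' r)" and act_1: "act 1 r = r"
  by (simp_all add: act_def tB_S[symmetric] \<rho>_mult tB_1 \<rho>_1)

lemma form_act:
  assumes "linear_form (yscale R) \<phi>"
  shows "\<phi> (act s r) = bsw R r (\<lambda>r1 r2. q r1 s * \<phi> r2)"
  unfolding act_def \<rho>_S bsw_def sweedler_linear[OF assms] by (simp add: linear_scaleD[OF assms] q_def)

text \<open>Applying the counit to the sum of \<open>\<tau>(r_1, s) r_2\<close> leaves
  \<open>\<tau>(r, s)\<close>. Through this formula the module axiom for \<open>act\<close> becomes
  the adjunction \<open>q_act\<close>.\<close>

lemma q_eq_counit: "q r s = bcounit R (act s r)"
proof -
  have "linear_form (yscale R) (\<lambda>r. q r s)" using bilinear_q by (simp add: bilinear_map_def)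
  from bsw_counit(2)[OF gb_R this] show ?thesis by (simp add: form_act[OF R(6)])
qed

lemma q_act: "q (act s r) s' = q r (s' * s)"
  by (simp add: q_eq_counit act_mult)

lemma act_on_1: "act s 1 = yscale R (q 1 s) 1"
proof (rule linear_form_separates[OF R(2)])
  fix \<phi> assume \<phi>: "linear_form (yscale R) \<phi>"
  have bl: "bilinear_map (yscale R) (yscale R) (*) (\<lambda>r1 r2. q r1 s * \<phi> r2)"
    by (rule bilinear_formI) (auto simp: R q linear_addD[OF \<phi>] linear_scaleD[OF \<phi>] algebra_simps)
  show "\<phi> (act s 1) = \<phi> (yscale R (q 1 s) 1)"
    unfolding form_act[OF \<phi>] bsw_form[OF gb_R bl] R(11) by (simp add: tensor_of_apply[OF bl] linear_scaleD[OF \<phi>])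
qed

lemma grade_R: "grade R 0 = range (\<lambda>c. yscale R c 1)" "grade R 1 = range \<iota>V" "grade R (Suc 0) = range \<iota>V"
  and grade_S: "grade S 0 = range (\<lambda>c. yscale S c 1)" "grade S 1 = range \<iota>W" "grade S (Suc 0) = range \<iota>W"
  using pre_nicholsD[OF pre_R] pre_nicholsD[OF pre_S] by auto

text \<open>The commutation relation of the algebra, evaluated on the module \<open>R\<close>. It is
  a twisted Leibniz rule that reduces the action of \<open>S(1)\<close> in degree
  \<open>n + 1\<close> to the one in degree \<open>n\<close>.\<close>

lemma act_W_V:
  "act (\<iota>W w) (\<iota>V v * r) =
    co J V v (\<lambda>j v'. co K W w (\<lambda>x w'. yscale R (\<tau>0 j x) (\<iota>V v' * act (\<iota>W w') r))) + yscale R (\<tau>1 v w) r"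
proof -
  have lin: "Vector_Spaces.linear sB (yscale R) (\<lambda>b. \<rho> b r)" using bilinear_\<rho> by (simp add: bilinear_map_def)
  have *: "\<rho> (sB c (tB (\<iota>V v') (\<iota>W w'))) r = yscale R c (\<iota>V v' * act (\<iota>W w') r)" for c v' w'
    unfolding tB_RS[of "\<iota>V v'" "\<iota>W w'", symmetric] by (simp add: \<rho> \<rho>_mult \<rho>_R act_def)
  have "act (\<iota>W w) (\<iota>V v * r) = \<rho> (tB 1 (\<iota>W w) * tB (\<iota>V v) 1) r"
    by (simp add: act_def \<rho>_mult \<rho>_R)
  also have "\<dots> = co J V v (\<lambda>j v'. co K W w (\<lambda>x w'. \<rho> (sB (\<tau>0 j x) (tB (\<iota>V v') (\<iota>W w'))) r))
      + yscale R (\<tau>1 v w) r"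
    unfolding tB_WV \<rho>(1) co_def sweedler_linear[OF lin] \<rho>(2) \<rho>_1 ..
  finally show ?thesis unfolding * .
qed

text \<open>The hypothesis concerns the product of a vector with \<open>act (\<iota>W w) x\<close>
  rather than this element itself, which would have degree -1 for \<open>n = 0\<close>; there the
  product lies in degree 0 because it vanishes.\<close>

lemma act_W_grade_step:
  assumes "r \<in> grade R (Suc n)"
    and IH: "\<And>v w x. x \<in> grade R n \<Longrightarrow> \<iota>V v * act (\<iota>W w) x \<in> grade R n"
  shows "act (\<iota>W w) r \<in> grade R n"
proof -
  have "R.subspace {r. act (\<iota>W w) r \<in> grade R n}"
    using R.subspace_0[OF R.subspace_G] R.subspace_add[OF R.subspace_G] R.subspace_scale[OF R.subspace_G]
    by (auto simp: R.subspace_def act)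
  moreover have "act (\<iota>W w) (\<iota>V v * x) \<in> grade R n" if "x \<in> grade R n" for v x
    unfolding act_W_V co_def
    by (intro R.subspace_add[OF R.subspace_G] R.subspace_scale[OF R.subspace_G]
        sweedler_in_subspace[OF R.subspace_G R(2)] IH that)
  ultimately have "grade R (Suc n) \<subseteq> {r. act (\<iota>W w) r \<in> grade R n}"
    unfolding pre_nichols_grade_Suc[OF pre_R] grade_R by (intro R.span_minimal) auto
  then show ?thesis using assms(1) by auto
qed

lemma act_W_grade:
  "r \<in> grade R 0 \<Longrightarrow> act (\<iota>W w) r = 0"
  "r \<in> grade R (Suc n) \<Longrightarrow> act (\<iota>W w) r \<in> grade R n"
proof -
  have "act (\<iota>W w) 1 = 0" for w
    by (simp add: act_on_1 q_def \<tau>_values)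
  then show *: "act (\<iota>W w) r = 0" if "r \<in> grade R 0" for w r
    using that by (auto simp: grade_R act)
  show "r \<in> grade R (Suc n) \<Longrightarrow> act (\<iota>W w) r \<in> grade R n"
  proof (induction n arbitrary: r w)
    case (0 r w)
    show ?case using 0 by (rule act_W_grade_step) (use * R.subspace_0[OF R.subspace_G] in \<open>auto simp: R(13)\<close>)
  next
    case (Suc n)
    show ?case
    proof (rule act_W_grade_step[OF Suc.prems])
      fix v w x assume "x \<in> grade R (Suc n)"
      then show "\<iota>V v * act (\<iota>W w) x \<in> grade R (Suc n)"
        using R(14)[OF _ Suc.IH, of "\<iota>V v" 1] by (simp add: grade_R)
    qed
  qed
qed

text \<open>With truncated subtraction \<open>n - m\<close> is 0 for \<open>m > n\<close>, so
  membership alone would still allow scalars; the vanishing is carried through the induction as a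
  second statement.\<close>

lemma act_grade:
  assumes "s \<in> grade S m" "r \<in> grade R n"
  shows "act s r \<in> grade R (n - m)" "m > n \<Longrightarrow> act s r = 0"
proof -
  have "act s r \<in> grade R (n - m) \<and> (m > n \<longrightarrow> act s r = 0)" using assms(1)
  proof (induction m arbitrary: s)
    case 0
    then obtain c where "s = yscale S c 1" by (auto simp: grade_S)
    then show ?case using assms(2) R.subspace_scale[OF R.subspace_G] by (simp add: act act_1)
  next
    case (Suc m)
    let ?U = "{s. act s r \<in> grade R (n - Suc m) \<and> (Suc m > n \<longrightarrow> act s r = 0)}"
    have "S.subspace ?U"
      using R.subspace_0[OF R.subspace_G] R.subspace_add[OF R.subspace_G] R.subspace_scale[OF R.subspace_G]
      by (auto simp: S.subspace_def act)
    moreover have "w * x \<in> ?U" if "w \<in> grade S 1" "x \<in> grade S m" for w x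
    proof -
      note IH = Suc.IH[OF that(2)]
      obtain w' where w: "w = \<iota>W w'" using \<open>w \<in> grade S 1\<close> unfolding grade_S by blast
      show ?thesis
      proof (cases "m < n")
        case True
        then have "act x r \<in> grade R (Suc (n - Suc m))" using IH by (simp add: Suc_diff_Suc)
        then show ?thesis using True act_W_grade(2) by (simp add: w act_mult)
      next
        case False
        \<comment> \<open>Here \<open>n - m = 0\<close>: degree 0 has been reached, and one more
          factor from \<open>S(1)\<close> annihilates it.\<close>
        then have "act x r \<in> grade R 0" using IH by auto
        then show ?thesis using act_W_grade(1)[of "act x r"] R.subspace_0[OF R.subspace_G] by (simp add: w act_mult)
      qed
    qed
    ultimately have "grade S (Suc m) \<subseteq> ?U"
      unfolding pre_nichols_grade_Suc[OF pre_S] by (intro S.span_minimal) auto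
    then show ?case using Suc.prems by blast
  qed
  then show "act s r \<in> grade R (n - m)" "m > n \<Longrightarrow> act s r = 0" by auto
qed

text \<open>The element \<open>act s r\<close> has degree \<open>i - j\<close>, or is zero when
  \<open>j > i\<close>, and the counit kills positive degrees.\<close>

lemma q_orthogonal: "r \<in> grade R i \<Longrightarrow> s \<in> grade S j \<Longrightarrow> i \<noteq> j \<Longrightarrow> q r s = 0"
  using act_grade[of s j r i] R(15)[of "i - j" "act s r"] linear_0D[OF R(6)]
  by (cases "j > i") (auto simp: q_eq_counit)

lemma q_1_1: "q 1 1 = 1"
  using skew(2) by (auto simp: q_def \<tau>_values skew_pairing_def hopf_algebraD(7)[OF hopf(1)])

lemma q_1: "q 1 s = bcounit S s" "q r 1 = bcounit R r"
proof -
  show "q 1 s = bcounit S s"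
  proof (induction s rule: S.hom_induct)
    case (hom n s)
    show ?case
    proof (cases "n = 0")
      case True
      then obtain c where "s = yscale S c 1" using hom by (auto simp: grade_S)
      then show ?thesis by (simp add: q q_1_1 linear_scaleD[OF S(6)] S(8))
    next
      case False then show ?thesis using q_orthogonal[OF R(13) hom] S(15)[OF _ hom] by simp
    qed
  qed (simp add: q linear_addD[OF S(6)])
  show "q r 1 = bcounit R r" by (simp add: q_eq_counit act_1)
qed

lemma q_V_W: "q (\<iota>V v) (\<iota>W w) = \<tau>1 v w"
  by (simp add: q_def \<tau>_values)

section \<open>Triviality of the left radical\<close>

lemma q_nondegenerate_1:
  "r \<in> grade R 1 \<Longrightarrow> (\<And>s. q r s = 0) \<Longrightarrow> r = 0"
  "s \<in> grade S 1 \<Longrightarrow> (\<And>r. q r s = 0) \<Longrightarrow> s = 0"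
proof -
  have 0: "\<iota>V 0 = 0" "\<iota>W 0 = 0"
    using linear_0D[OF pre_nicholsD(3)[OF pre_R]] linear_0D[OF pre_nicholsD(3)[OF pre_S]] by auto
  show "r \<in> grade R 1 \<Longrightarrow> (\<And>s. q r s = 0) \<Longrightarrow> r = 0"
    "s \<in> grade S 1 \<Longrightarrow> (\<And>r. q r s = 0) \<Longrightarrow> s = 0"
    using nondeg 0 unfolding grade_R grade_S nondegenerate_def q_V_W[symmetric] by blast+
qed

lemma q_nondegenerate_0:
  "r \<in> grade R 0 \<Longrightarrow> (\<And>s. q r s = 0) \<Longrightarrow> r = 0"
  "s \<in> grade S 0 \<Longrightarrow> (\<And>r. q r s = 0) \<Longrightarrow> s = 0"
proof -
  show "r = 0" if r: "r \<in> grade R 0" and *: "\<And>s. q r s = 0"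
  proof -
    obtain c where "r = yscale R c 1" using r by (auto simp: grade_R)
    then show ?thesis using *[of 1] q_1_1 by (simp add: q)
  qed
  show "s = 0" if s: "s \<in> grade S 0" and *: "\<And>r. q r s = 0"
  proof -
    obtain c where "s = yscale S c 1" using s by (auto simp: grade_S)
    then show ?thesis using *[of 1] q_1_1 by (simp add: q)
  qed
qed

lemma subspace_radical:
  "R.subspace {r. \<forall>s. q r s = 0}" "S.subspace {s. \<forall>r. q r s = 0}"
  by (auto simp: R.subspace_def S.subspace_def q)

text \<open>By adjunction \<open>act s r\<close> lies in the radical too, so for \<open>s\<close> of
  positive degree the induction hypothesis applies to it. The radical serves as \<open>N\<close> in
  \<open>nichols_element_eq_0\<close>: pairing the slice of the coproduct along
  \<open>\<phi>\<close> with \<open>s\<close> gives \<open>\<phi> (act s r)\<close>, so the action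
  on \<open>r\<close> determines the slices modulo the radical.\<close>

lemma left_nondegenerate_hom: "r \<in> grade R n \<Longrightarrow> (\<And>s. q r s = 0) \<Longrightarrow> r = 0"
proof (induction n arbitrary: r rule: less_induct)
  case (less n)
  consider "n = 0" | "n = 1" | "n \<ge> 2" by linarith
  then show ?case
  proof cases
    case 3
    have act_r: "act s r = yscale R (bcounit S s) r" for s
    proof (induction s rule: S.hom_induct)
      case (hom m s)
      show ?case
      proof (cases "m = 0")
        case True
        then obtain c where "s = yscale S c 1" using hom by (auto simp: grade_S)
        then show ?thesis by (simp add: act act_1 linear_scaleD[OF S(6)] S(8))
      next
        case False
        have "act s r = 0"
        proof (cases "m > n")
          case False
          then show ?thesis using \<open>m \<noteq> 0\<close> act_grade(1)[OF hom less.prems(1)] 3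
            by (intro less.IH[of "n - m"]) (auto simp: q_act less.prems(2))
        qed (rule act_grade(2)[OF hom less.prems(1)])
        then show ?thesis using S(15)[OF _ hom] False by simp
      qed
    qed (simp add: act linear_addD[OF S(6)] R.scale_left_distrib)
    show ?thesis
    proof (rule nichols_element_eq_0[OF nichols_R less.prems(1) 3 subspace_radical(1)])
      show "{r. \<forall>s. q r s = 0} \<inter> R.below n \<subseteq> {0}"
        using graded_radical_below[OF R(3) S(3) bilinear_q q_orthogonal less.IH] by auto
      fix \<phi> assume \<phi>: "linear_form (yscale R) \<phi>"
      have "q (bsw R r (\<lambda>x1 x2. yscale R (\<phi> x2) x1)) s = \<phi> (act s r)" for s
      proof -
        have "linear_form (yscale R) (\<lambda>r. q r s)" using bilinear_q by (simp add: bilinear_map_def)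
        then show ?thesis
          unfolding form_act[OF \<phi>] bsw_def by (subst sweedler_linear) (simp_all add: q mult.commute)
      qed
      then show "bsw R r (\<lambda>x1 x2. yscale R (\<phi> x2) x1) - yscale R (\<phi> r) 1 \<in> {r. \<forall>s. q r s = 0}"
        by (simp add: q act_r linear_scaleD[OF \<phi>] q_1)
    qed
  qed (use less.prems q_nondegenerate_0(1) q_nondegenerate_1(1) in auto)
qed

lemma left_nondegenerate: assumes "\<And>s. q r s = 0" shows "r = 0"
proof -
  obtain n where "r \<in> R.below n" by (rule R.ex_below)
  then show ?thesis
    using graded_radical_below[OF R(3) S(3) bilinear_q q_orthogonal left_nondegenerate_hom] assms by auto
qed

end

section \<open>Products, coproducts and coactions in the bosonizations\<close>

lemma bosonization_mult:
  assumes b: "bosonization J R A t" and J: "hopf_algebra J" and R: "graded_braided_bialgebra J R"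
  shows "t r 1 * t r' b = t (r * r') b"
proof -
  have t: "bilinear_map (yscale R) (hscale J) (hscale A) t" "vector_space (hscale A)"
    using b tensor_product_full[of "yscale R" "hscale J" "hscale A" t] by (auto simp: bosonization_def)
  note y = yetter_drinfeldD[OF graded_braided_bialgebraD(1)[OF R]]
  have "bilinear_map (hscale J) (hscale J) (hscale A) (\<lambda>a1 a2. t (r * yact R a1 r') (a2 * b))"
    using t(2) hopf_algebraD(1)[OF J]
    by (simp add: bilinear_map_def Vector_Spaces.linear_iff bilinear_formD[OF t(1)]
        bilinear_formD[OF y(5)] distrib_left distrib_right
        hopf_algebraD(9,10)[OF J] graded_braided_bialgebraD(9,10)[OF R])
  from sw_1[OF J this] show ?thesis using b by (simp add: bosonization_def y(4))
qed

lemma bosonization_comult: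
  assumes b: "bosonization J R A t" and \<beta>: "bilinear_map (hscale A) (hscale A) (*) \<beta>"
  shows "sw A (t r a) \<beta> = bsw R r (\<lambda>r1 r2. co J R r2 (\<lambda>j u. sw J a (\<lambda>a1 a2. \<beta> (t r1 (j * a1)) (t u a2))))"
proof -
  have A: "hopf_algebra A" and \<Delta>: "hcomult A (t r a) =
        bsw R r (\<lambda>r1 r2. co J R r2 (\<lambda>j u. sw J a (\<lambda>a1 a2.
          pure_tensor (hscale A) (hscale A) (t r1 (j * a1)) (t u a2))))"
    using b unfolding bosonization_def by blast+
  have "sw A (t r a) \<beta> = hcomult A (t r a) \<beta>" by (rule sw_form[OF A \<beta>])
  also have "\<dots> = bsw R r (\<lambda>r1 r2. co J R r2 (\<lambda>j u. sw J a (\<lambda>a1 a2. \<beta> (t r1 (j * a1)) (t u a2))))"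
    unfolding \<Delta> bsw_def co_def sw_def sweedler_apply tensor_of_apply[OF \<beta>] by simp
  finally show ?thesis .
qed

lemma bosonization_comult_left:
  assumes b: "bosonization J R A t" and J: "hopf_algebra J"
    and \<beta>: "bilinear_map (hscale A) (hscale A) (*) \<beta>"
  shows "sw A (t r 1) \<beta> = bsw R r (\<lambda>r1 r2. co J R r2 (\<lambda>j u. \<beta> (t r1 j) (t u 1)))"
proof -
  have t: "bilinear_map (yscale R) (hscale J) (hscale A) t"
    using b tensor_product_full[of "yscale R" "hscale J" "hscale A" t] by (auto simp: bosonization_def)
  have "sw J 1 (\<lambda>a1 a2. \<beta> (t r1 (j * a1)) (t u a2)) = \<beta> (t r1 j) (t u 1)" for r1 j u
    by (subst sw_1[OF J bilinear_formI])
       (auto simp: hopf_algebraD[OF J] bilinear_formD[OF t] bilinear_formD[OF \<beta>] distrib_left)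
  then show ?thesis unfolding bosonization_comult[OF b \<beta>] by simp
qed

lemma bosonization_comult_right:
  assumes b: "bosonization J R A t" and J: "hopf_algebra J" and R: "graded_braided_bialgebra J R"
    and \<beta>: "bilinear_map (hscale A) (hscale A) (*) \<beta>"
  shows "sw A (t 1 a) \<beta> = sw J a (\<lambda>a1 a2. \<beta> (t 1 a1) (t 1 a2))"
proof -
  note y = graded_braided_bialgebraD(1)[OF R] and v = graded_braided_bialgebraD(2)[OF R]
  have t: "bilinear_map (yscale R) (hscale J) (hscale A) t"
    using b tensor_product_full[of "yscale R" "hscale J" "hscale A" t] by (auto simp: bosonization_def)
  \<comment> \<open>The formulas for \<open>bcomult R 1\<close> and \<open>ycoact R 1\<close> may be
    inserted only under bilinear integrands, so the nested sum is split into layers,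
    \<open>B\<close> inside and \<open>C\<close> outside, and each is shown to be bilinear.\<close>
  define B where "B = (\<lambda>r1 j u. sw J a (\<lambda>a1 a2. \<beta> (t r1 (j * a1)) (t u a2)))"
  have B: "B (x + y) j u = B x j u + B y j u" "B (yscale R c x) j u = c * B x j u"
    "B x (j + j') u = B x j u + B x j' u" "B x (hscale J c j) u = c * B x j u"
    "B x j (u + u') = B x j u + B x j u'" "B x j (yscale R c u) = c * B x j u" for x y c j u j' u'
    by (simp_all add: B_def sw_def sweedler_add[symmetric] sweedler_mult_left[symmetric] distrib_right
        bilinear_formD[OF t] bilinear_formD[OF \<beta>] hopf_algebraD[OF J])
  have B1: "B (x + y) = (\<lambda>j u. B x j u + B y j u)" "B (yscale R c x) = (\<lambda>j u. c * B x j u)" for x y c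
    by (simp_all add: fun_eq_iff B)
  have B2: "bilinear_map (hscale J) (yscale R) (*) (B x)" for x
    by (rule bilinear_formI) (auto simp: B hopf_algebraD[OF J] v)
  define C where "C = (\<lambda>r1 r2. co J R r2 (B r1))"
  have C: "bilinear_map (yscale R) (yscale R) (*) C"
    using linear_addD[OF linear_form_co[OF y B2]] linear_scaleD[OF linear_form_co[OF y B2]]
    by (intro bilinear_formI v) (simp_all add: C_def co_def B1 sweedler_add sweedler_mult_left)
  have "sw A (t 1 a) \<beta> = bsw R 1 C"
    unfolding bosonization_comult[OF b \<beta>] by (simp add: B_def C_def)
  also have "\<dots> = C 1 1"
    unfolding bsw_form[OF R C] graded_braided_bialgebraD(11)[OF R] by (simp add: tensor_of_apply[OF C])
  also have "\<dots> = B 1 1 1"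
    unfolding C_def co_form[OF y B2] graded_braided_bialgebraD(12)[OF R] by (simp add: tensor_of_apply[OF B2])
  finally show ?thesis by (simp add: B_def)
qed

text \<open>The coaction preserves degrees, so \<open>ycoact R r\<close> has a representing list
  with all right legs in \<open>grade R n\<close>; bilinearity of \<open>\<beta>\<close> allows
  passing to this list from the chosen one.\<close>

lemma co_eq_0:
  assumes R: "graded_braided_bialgebra J R" and r: "r \<in> grade R n"
    and \<beta>: "bilinear_map (hscale J) (yscale R) (*) \<beta>" "\<And>j u. u \<in> grade R n \<Longrightarrow> \<beta> j u = 0"
  shows "co J R r \<beta> = 0"
proof -
  obtain ps where ps: "\<forall>(j, u)\<in>set ps. u \<in> grade R n" "ycoact R r = tensor_of (hscale J) (yscale R) ps"
    using graded_braided_bialgebraD(19)[OF R r] by (elim exE conjE)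
  have "(\<Sum>(j, u)\<leftarrow>ps. \<beta> j u) = 0" using ps(1) by (induction ps) (auto simp: \<beta>(2))
  then show ?thesis
    unfolding co_form[OF graded_braided_bialgebraD(1)[OF R] \<beta>(1)] ps(2) by (simp add: tensor_of_apply[OF \<beta>(1)])
qed

section \<open>Values of the extended pairing, and triviality of the right radical\<close>

context q_boson
begin

lemma yd: "yetter_drinfeld J R" "yetter_drinfeld K S"
  using R(1) S(1) .

lemma skewD: "\<tau> (a * b) x = sw X x (\<lambda>x1 x2. \<tau> a x1 * \<tau> b x2)"
  "\<tau> a (x * y) = sw A a (\<lambda>a1 a2. \<tau> a1 y * \<tau> a2 x)"
  "\<tau>0 j (k * k') = sw J j (\<lambda>j1 j2. \<tau>0 j1 k' * \<tau>0 j2 k)"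
  "\<tau>0 1 k = hcounit K k" "\<tau>0 j 1 = hcounit J j"
  using skew unfolding skew_pairing_def by blast+

lemma bilinear_\<tau>\<tau>:
  "bilinear_map (hscale X) (hscale X) (*) (\<lambda>x1 x2. \<tau> a x1 * \<tau> b x2)"
  "bilinear_map (hscale A) (hscale A) (*) (\<lambda>a1 a2. \<tau> a1 x * \<tau> a2 y)"
  by (rule bilinear_formI, auto simp: hopf_algebraD[OF hopf(3)] hopf_algebraD[OF hopf(4)] \<tau> algebra_simps)+

text \<open>The elements \<open>r\<close> satisfying the formula for all \<open>x\<close> form a
  subalgebra: elements of \<open>K\<close> have the same coproduct in the bosonization, and the
  counits of the two legs recombine to the counit of \<open>x\<close>. The subalgebra contains
  \<open>V\<close>, where both sides are zero.\<close>

lemma \<tau>_R_K: "\<tau> (tA r 1) (tX 1 x) = bcounit R r * hcounit K x"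
proof -
  let ?U = "{r. \<forall>x. \<tau> (tA r 1) (tX 1 x) = bcounit R r * hcounit K x}"
  note eps = linear_addD[OF R(6)] linear_scaleD[OF R(6)] linear_0D[OF R(6)]
  have "?U = UNIV"
  proof (rule pre_nicholsD(6)[OF pre_R])
    show "R.subspace ?U" by (auto simp: R.subspace_def tA \<tau> eps distrib_right)
    show "1 \<in> ?U" by (auto simp: \<tau>_values skewD R(8))
    show "grade R 1 \<subseteq> ?U"
      using R(15)[of 1] by (auto simp: grade_R \<tau>_values)
    fix r r' assume r: "r \<in> ?U" "r' \<in> ?U"
    show "r * r' \<in> ?U"
    proof (rule CollectI, rule allI)
      fix x
      have "\<tau> (tA (r * r') 1) (tX 1 x) = sw K x (\<lambda>x1 x2. \<tau> (tA r 1) (tX 1 x1) * \<tau> (tA r' 1) (tX 1 x2))"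
        unfolding bosonization_mult[OF bos_A hopf(1) gb_R, symmetric] skewD
          bosonization_comult_right[OF bos_X hopf(2) gb_S bilinear_\<tau>\<tau>(1)] ..
      also have "\<dots> = sw K x (\<lambda>x1 x2. bcounit R r * bcounit R r' * (hcounit K x1 * hcounit K x2))"
        using r by (simp add: mult_ac)
      also have "\<dots> = bcounit R (r * r') * hcounit K x"
        using sw_counit[OF hopf(2) hopf_algebraD(5)[OF hopf(2)]]
        by (simp add: sw_def sweedler_mult_left R(7))
      finally show "\<tau> (tA (r * r') 1) (tX 1 x) = bcounit R (r * r') * hcounit K x" .
    qed
  qed
  then show ?thesis by blast
qed

lemma \<tau>_A_K: "\<tau> (tA r j) (tX 1 x) = bcounit R r * \<tau>0 j x"
proof -
  have form: "linear_form (hscale K) (\<tau>0 j)" using bilinear_\<tau>(2) by (simp add: bilinear_map_def)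
  have "\<tau> (tA r j) (tX 1 x) = \<tau> (tA r 1 * tA 1 j) (tX 1 x)"
    by (simp add: bosonization_mult[OF bos_A hopf(1) gb_R])
  also have "\<dots> = sw K x (\<lambda>x1 x2. \<tau> (tA r 1) (tX 1 x1) * \<tau> (tA 1 j) (tX 1 x2))"
    unfolding skewD bosonization_comult_right[OF bos_X hopf(2) gb_S bilinear_\<tau>\<tau>(1)] ..
  also have "\<dots> = bcounit R r * sw K x (\<lambda>x1 x2. hcounit K x1 * \<tau>0 j x2)"
    by (simp add: \<tau>_R_K \<tau>_values sw_def mult.assoc sweedler_mult_left)
  finally show ?thesis by (simp add: sw_counit[OF hopf(2) form])
qed

lemma bilinear_\<tau>0_q: "bilinear_map (hscale J) (yscale R) (*) (\<lambda>j u. \<tau>0 j x * q u s)"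
  by (rule bilinear_formI) (auto simp: hopf_algebraD[OF hopf(1)] R(2) \<tau>0 q algebra_simps)

text \<open>The factors \<open>s\<close> and \<open>x\<close> are paired with the two legs of the
  coproduct of \<open>r\<close> in reversed order. The leg paired with \<open>x\<close> contributes
  only the counit of its part in \<open>R\<close>, so \<open>x\<close> sees nothing but the coaction
  of \<open>r\<close>.\<close>

lemma \<tau>_R_X: "\<tau> (tA r 1) (tX s x) = co J R r (\<lambda>j u. \<tau>0 j x * q u s)"
proof -
  have "\<tau> (tA r 1) (tX s x) = \<tau> (tA r 1) (tX s 1 * tX 1 x)"
    by (simp add: bosonization_mult[OF bos_X hopf(2) gb_S])
  also have "\<dots> = bsw R r (\<lambda>r1 r2. co J R r2 (\<lambda>j u. \<tau> (tA r1 j) (tX 1 x) * \<tau> (tA u 1) (tX s 1)))"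
    unfolding skewD bosonization_comult_left[OF bos_A hopf(1) bilinear_\<tau>\<tau>(2)] ..
  also have "\<dots> = bsw R r (\<lambda>r1 r2. bcounit R r1 * co J R r2 (\<lambda>j u. \<tau>0 j x * q u s))"
    by (simp add: \<tau>_A_K q_def co_def mult.assoc sweedler_mult_left)
  also have "\<dots> = co J R r (\<lambda>j u. \<tau>0 j x * q u s)"
    by (rule bsw_counit(3)[OF gb_R linear_form_co[OF yd(1) bilinear_\<tau>0_q]])
  finally show ?thesis .
qed

text \<open>The adjoint of left multiplication by \<open>r\<close> with respect to \<open>q\<close>,
  see \<open>q_mult\<close>. The formula comes from the coproduct of \<open>s\<close> in the
  bosonization, whose left leg \<open>s_1 k\<close> is paired with \<open>r\<close>.\<close>

definition twist :: "'r \<Rightarrow> 's \<Rightarrow> 's" where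
  "twist r s = bsw S s (\<lambda>s1 s2. co K S s2 (\<lambda>k u. yscale S (\<tau> (tA r 1) (tX s1 k)) u))"

lemma form_twist:
  assumes "linear_form (yscale S) \<phi>"
  shows "\<phi> (twist r s) = bsw S s (\<lambda>s1 s2. co K S s2 (\<lambda>k u. \<tau> (tA r 1) (tX s1 k) * \<phi> u))"
  unfolding twist_def bsw_def co_def sweedler_linear[OF assms] linear_scaleD[OF assms] ..

lemma q_mult: "q (r * r') s = q r' (twist r s)"
proof -
  have form: "linear_form (yscale S) (q r')" using bilinear_q by (simp add: bilinear_map_def)
  have "q (r * r') s = \<tau> (tA r 1 * tA r' 1) (tX s 1)"
    by (simp add: q_def bosonization_mult[OF bos_A hopf(1) gb_R])
  also have "\<dots> = bsw S s (\<lambda>s1 s2. co K S s2 (\<lambda>k u. \<tau> (tA r 1) (tX s1 k) * q r' u))"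
    unfolding skewD bosonization_comult_left[OF bos_X hopf(2) bilinear_\<tau>\<tau>(1)] q_def ..
  finally show ?thesis unfolding form_twist[OF form] .
qed

lemma bilinear_twist:
  assumes \<phi>: "linear_form (yscale S) \<phi>"
  shows "bilinear_map (hscale K) (yscale S) (*) (\<lambda>k u. \<tau> (tA r 1) (tX s k) * \<phi> u)" (is "bilinear_map _ _ _ (?b s)")
    and "bilinear_map (yscale S) (yscale S) (*) (\<lambda>s1 s2. co K S s2 (\<lambda>k u. \<tau> (tA r 1) (tX s1 k) * \<phi> u))"
proof -
  show *: "bilinear_map (hscale K) (yscale S) (*) (?b s)" for s
    by (rule bilinear_formI)
       (simp_all add: hopf_algebraD(1)[OF hopf(2)] S(2) tX \<tau> linear_addD[OF \<phi>] linear_scaleD[OF \<phi>] algebra_simps)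
  show "bilinear_map (yscale S) (yscale S) (*) (\<lambda>s1 s2. co K S s2 (?b s1))"
  proof (rule bilinear_formI[OF S(2) S(2)])
    show "co K S s2 (?b (s + s')) = co K S s2 (?b s) + co K S s2 (?b s')"
      "co K S s2 (?b (yscale S c s)) = c * co K S s2 (?b s)" for s s' c s2
      by (simp_all add: tX \<tau> distrib_right mult.assoc co_def sweedler_add sweedler_mult_left)
  qed (rule linear_addD[OF linear_form_co[OF yd(2) *]], rule linear_scaleD[OF linear_form_co[OF yd(2) *]])
qed

text \<open>A left leg of degree 0 in the coproduct of \<open>s\<close> pairs to zero with
  \<open>r\<close>: the coaction of \<open>r\<close> keeps the positive degree \<open>i\<close>, and
  \<open>q\<close> is orthogonal for the gradings. The remaining right legs have degree less than
  \<open>n\<close>, which their coaction preserves.\<close>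

lemma twist_below:
  assumes r: "r \<in> grade R i" "i > 0" and s: "s \<in> grade S n"
  shows "twist r s \<in> S.below n"
proof -
  have "\<phi> (S.pr m (twist r s)) = \<phi> 0" if m: "m \<ge> n" and \<phi>: "linear_form (yscale S) \<phi>" for m \<phi>
  proof -
    have \<psi>: "linear_form (yscale S) (\<lambda>s. \<phi> (S.pr m s))" (is "linear_form _ ?\<psi>")
      by (rule linear_compD[OF S.linear_pr \<phi>])
    note b = bilinear_twist[OF \<psi>, of r]
    obtain ps where ps: "\<forall>(a, b)\<in>set ps. \<exists>i j. i + j = n \<and> a \<in> grade S i \<and> b \<in> grade S j"
      "bcomult S s = tensor_of (yscale S) (yscale S) ps"
      using S(18)[OF s] by (elim exE conjE)
    have 0: "co K S b (\<lambda>k u. \<tau> (tA r 1) (tX a k) * ?\<psi> u) = 0" if ab: "(a, b) \<in> set ps" for a b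
    proof -
      obtain i' j' where ij: "i' + j' = n" "a \<in> grade S i'" "b \<in> grade S j'"
        using bspec[OF ps(1) ab] by auto
      show ?thesis
      proof (cases "i' = 0")
        case True
        have "\<tau> (tA r 1) (tX a k) = 0" for k
          unfolding \<tau>_R_X
          using q_orthogonal[OF _ ij(2)] True r(2) by (intro co_eq_0[OF gb_R r(1) bilinear_\<tau>0_q]) auto
        then show ?thesis by (simp add: co_def sweedler_def case_prod_unfold sum_list_0)
      next
        case False
        have "?\<psi> u = 0" if "u \<in> grade S j'" for u
          using S.pr_hom[OF that, of m] m ij(1) False linear_0D[OF \<phi>] by auto
        then show ?thesis by (intro co_eq_0[OF gb_S ij(3) b(1)]) auto
      qed
    qed
    then have "(\<Sum>(a, b)\<leftarrow>qs. co K S b (\<lambda>k u. \<tau> (tA r 1) (tX a k) * ?\<psi> u)) = 0"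
      if "set qs \<subseteq> set ps" for qs
      using that by (induction qs) auto
    then show ?thesis
      unfolding form_twist[OF \<psi>] bsw_form[OF gb_S b(2)] ps(2)
      by (simp add: tensor_of_apply[OF b(2)] linear_0D[OF \<phi>])
  qed
  then show ?thesis unfolding S.below_def by (auto intro: linear_form_separates[OF S(2)])
qed

lemma bilinear_antipode:
  assumes \<phi>: "linear_form (yscale S) \<phi>"
  shows "bilinear_map (hscale K) (yscale S) (*) (\<lambda>k u. \<tau>0 j (antipode K k) * \<phi> u)"
  using linear_addD[OF hopf_algebraD(8)[OF hopf(2)]] linear_scaleD[OF hopf_algebraD(8)[OF hopf(2)]]
  by (intro bilinear_formI)
    (auto simp: hopf_algebraD(1)[OF hopf(2)] S(2) \<tau>0 linear_addD[OF \<phi>] linear_scaleD[OF \<phi>] algebra_simps)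

text \<open>The twist by \<open>\<tau>0\<close> is undone by pairing with the antipode of the coaction on the result.\<close>

lemma untwist:
  assumes \<phi>: "linear_form (yscale S) \<phi>"
  shows "co J R r (\<lambda>j u. co K S (twist u s) (\<lambda>k u'. \<tau>0 j (antipode K k) * \<phi> u'))
    = bsw S s (\<lambda>s1 s2. q r s1 * \<phi> s2)"
proof -
  let ?S = "antipode K"
  note lS = linear_addD[OF hopf_algebraD(8)[OF hopf(2)]] linear_scaleD[OF hopf_algebraD(8)[OF hopf(2)]]
  note l\<phi> = linear_addD[OF \<phi>] linear_scaleD[OF \<phi>]
  have inner: "co J R r (\<lambda>j u. \<tau> (tA u 1) (tX s1 k) * co K S u2 (\<lambda>k' u'. \<tau>0 j (?S k') * \<phi> u'))
      = co K S u2 (\<lambda>k' u'. \<tau> (tA r 1) (tX s1 (k * ?S k')) * \<phi> u')" for k s1 u2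
  proof -
    \<comment> \<open>Here \<open>j'\<close> is paired with \<open>k\<close>, and \<open>j\<close>
      with the antipode of \<open>k'\<close>: the skew pairing reverses products in its second
      argument, so after coassociativity the two values combine to the pairing with
      \<open>k * ?S k'\<close>.\<close>
    define \<gamma> where "\<gamma> = (\<lambda>j j' v. \<tau>0 j' k * q v s1 * co K S u2 (\<lambda>k' u'. \<tau>0 j (?S k') * \<phi> u'))"
    have \<gamma>: "linear_form (hscale J) (\<lambda>j. \<gamma> j j' v)" "bilinear_map (hscale J) (yscale R) (*) (\<gamma> j)" for j j' v
    proof -
      show "linear_form (hscale J) (\<lambda>j. \<gamma> j j' v)"
        by (rule linear_formI) (simp_all add: \<gamma>_def hopf_algebraD(1)[OF hopf(1)] co_def \<tau>0
            distrib_right distrib_left mult.assoc mult.left_commute sweedler_add sweedler_mult_left)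
      show "bilinear_map (hscale J) (yscale R) (*) (\<gamma> j)"
        by (rule bilinear_formI)
           (auto simp: \<gamma>_def hopf_algebraD(1)[OF hopf(1)] R(2) \<tau>0 q algebra_simps)
    qed
    have "co J R r (\<lambda>j u. \<tau> (tA u 1) (tX s1 k) * co K S u2 (\<lambda>k' u'. \<tau>0 j (?S k') * \<phi> u'))
      = co J R r (\<lambda>j u. co J R u (\<gamma> j))"
      by (simp add: \<gamma>_def \<tau>_R_X co_def sweedler_mult_right)
    also have "\<dots> = co J R r (\<lambda>j v. sw J j (\<lambda>j1 j2. \<gamma> j1 j2 v))"
      by (rule co_coassoc[OF hopf(1) yd(1) \<gamma>, symmetric])
    also have "\<dots> = co J R r (\<lambda>j v. co K S u2 (\<lambda>k' u'. sw J j (\<lambda>j1 j2. \<tau>0 j1 (?S k') * \<tau>0 j2 k) * q v s1 * \<phi> u'))"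
    proof -
      have "sw J j (\<lambda>j1 j2. \<gamma> j1 j2 v)
          = co K S u2 (\<lambda>k' u'. sw J j (\<lambda>j1 j2. \<tau>0 j1 (?S k') * \<tau>0 j2 k) * q v s1 * \<phi> u')" for j v
        unfolding \<gamma>_def sw_def co_def sweedler_mult_left[symmetric] sweedler_mult_right[symmetric]
        by (subst sweedler_swap) (simp add: mult_ac)
      then show ?thesis by simp
    qed
    also have "\<dots> = co J R r (\<lambda>j v. co K S u2 (\<lambda>k' u'. \<tau>0 j (k * ?S k') * q v s1 * \<phi> u'))"
      by (simp add: skewD(3))
    also have "\<dots> = co K S u2 (\<lambda>k' u'. \<tau> (tA r 1) (tX s1 (k * ?S k')) * \<phi> u')"
      unfolding \<tau>_R_X co_def sweedler_mult_right[symmetric] by (rule sweedler_swap)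
    finally show ?thesis .
  qed
  \<comment> \<open>Coassociativity of the coaction on \<open>S\<close> turns \<open>k\<close> and
    \<open>k'\<close> into the two legs of one coproduct, where the antipode axiom collapses their
    product to the counit.\<close>
  have outer: "co K S s2 (\<lambda>k u2. co K S u2 (\<lambda>k' u'. \<tau> (tA r 1) (tX s1 (k * ?S k')) * \<phi> u'))
      = q r s1 * \<phi> s2" for s1 s2
  proof -
    define \<gamma> where "\<gamma> = (\<lambda>k k' u'. \<tau> (tA r 1) (tX s1 (k * ?S k')) * \<phi> u')"
    have \<gamma>: "linear_form (hscale K) (\<lambda>k. \<gamma> k k' v)" "bilinear_map (hscale K) (yscale S) (*) (\<gamma> k)" for k k' v
    proof -
      show "linear_form (hscale K) (\<lambda>k. \<gamma> k k' v)"
        by (rule linear_formI)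
           (simp_all add: \<gamma>_def hopf_algebraD[OF hopf(2)] tX \<tau> algebra_simps)
      show "bilinear_map (hscale K) (yscale S) (*) (\<gamma> k)"
        by (rule bilinear_formI)
           (simp_all add: \<gamma>_def hopf_algebraD[OF hopf(2)] lS l\<phi> S(2) tX \<tau> algebra_simps)
    qed
    have form: "linear_form (hscale K) (\<lambda>k. \<tau> (tA r 1) (tX s1 k))"
      by (rule linear_formI) (simp_all add: hopf_algebraD(1)[OF hopf(2)] tX \<tau>)
    have "co K S s2 (\<lambda>k u2. co K S u2 (\<gamma> k)) = co K S s2 (\<lambda>k u'. sw K k (\<lambda>k1 k2. \<gamma> k1 k2 u'))"
      by (rule co_coassoc[OF hopf(2) yd(2) \<gamma>, symmetric])
    also have "\<dots> = co K S s2 (\<lambda>k u'. q r s1 * (hcounit K k * \<phi> u'))"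
    proof -
      have "sw K k (\<lambda>k1 k2. \<gamma> k1 k2 u') = sw K k (\<lambda>k1 k2. \<tau> (tA r 1) (tX s1 (k1 * ?S k2))) * \<phi> u'" for k u'
        unfolding \<gamma>_def sw_def sweedler_mult_right ..
      then show ?thesis by (simp add: sw_antipode[OF hopf(2) form] q_def mult_ac)
    qed
    also have "\<dots> = q r s1 * co K S s2 (\<lambda>k u'. hcounit K k * \<phi> u')"
      by (simp add: co_def sweedler_mult_left)
    finally show ?thesis by (simp add: \<gamma>_def co_counit[OF yd(2) \<phi>])
  qed
  have swap: "co J R r (\<lambda>j u. bsw S s (\<lambda>s1 s2. co K S s2 (F j u s1 s2)))
      = bsw S s (\<lambda>s1 s2. co K S s2 (\<lambda>k u2. co J R r (\<lambda>j u. F j u s1 s2 k u2)))"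
    for F :: "_ \<Rightarrow> _ \<Rightarrow> _ \<Rightarrow> _ \<Rightarrow> _ \<Rightarrow> _ \<Rightarrow> 'k"
    unfolding co_def bsw_def by (subst sweedler_swap, subst sweedler_swap) (rule refl)
  have "co J R r (\<lambda>j u. co K S (twist u s) (\<lambda>k u'. \<tau>0 j (?S k) * \<phi> u'))
    = co J R r (\<lambda>j u. bsw S s (\<lambda>s1 s2. co K S s2 (\<lambda>k u2.
        \<tau> (tA u 1) (tX s1 k) * co K S u2 (\<lambda>k' u'. \<tau>0 j (?S k') * \<phi> u'))))"
    unfolding form_twist[OF linear_form_co[OF yd(2) bilinear_antipode[OF \<phi>]]] ..
  then show ?thesis unfolding swap inner outer .
qed

text \<open>For \<open>r\<close> of positive degree, \<open>twist r s\<close> is in the right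
  radical by \<open>q_mult\<close> and below degree \<open>n\<close> by \<open>twist_below\<close>,
  hence zero by induction. Then \<open>untwist\<close> makes the sum of
  \<open>q r s_1 * \<phi> s_2\<close> vanish, which yields the slice condition of
  \<open>nichols_element_eq_0\<close>.\<close>

lemma right_nondegenerate_hom: "s \<in> grade S n \<Longrightarrow> (\<And>r. q r s = 0) \<Longrightarrow> s = 0"
proof (induction n arbitrary: s rule: less_induct)
  case (less n)
  let ?M = "{s. \<forall>r. q r s = 0}"
  consider "n = 0" | "n = 1" | "n \<ge> 2" by linarith
  then show ?case
  proof cases
    case 3
    have flip: "bilinear_map (yscale S) (yscale R) (*) (\<lambda>s r. q r s)"
      using bilinear_q by (simp add: bilinear_map_def)
    have below: "?M \<inter> S.below n \<subseteq> {0}"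
      using graded_radical_below[OF S(3) R(3) flip q_orthogonal[OF _ _ not_sym] less.IH] by auto
    have twist: "twist r s = 0" if "r \<in> grade R i" "i > 0" for r i
    proof -
      have "twist r s \<in> ?M" using less.prems(2) by (simp add: q_mult[symmetric])
      then show ?thesis using twist_below[OF that less.prems(1)] below by blast
    qed
    have pos: "bsw S s (\<lambda>s1 s2. q r s1 * \<phi> s2) = bcounit R r * \<phi> s" if \<phi>: "linear_form (yscale S) \<phi>" for r \<phi>
    proof (induction r rule: R.hom_induct)
      case (hom i r)
      show ?case
      proof (cases "i = 0")
        case True
        then obtain c where "r = yscale R c 1" using hom by (auto simp: grade_R)
        then show ?thesis
          using bsw_counit(3)[OF gb_S \<phi>]
          by (simp add: q q_1 linear_scaleD[OF R(6)] R(8) bsw_def sweedler_mult_left mult.assoc)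
      next
        case False
        have b: "bilinear_map (hscale J) (yscale R) (*)
          (\<lambda>j u. co K S (twist u s) (\<lambda>k u'. \<tau>0 j (antipode K k) * \<phi> u'))"
        proof (rule bilinear_formI)
          fix j j' u u' c
          show "co K S (twist u s) (\<lambda>k u'. \<tau>0 (j + j') (antipode K k) * \<phi> u')
            = co K S (twist u s) (\<lambda>k u'. \<tau>0 j (antipode K k) * \<phi> u') + co K S (twist u s) (\<lambda>k u'. \<tau>0 j' (antipode K k) * \<phi> u')"
            "co K S (twist u s) (\<lambda>k u'. \<tau>0 (hscale J c j) (antipode K k) * \<phi> u')
            = c * co K S (twist u s) (\<lambda>k u'. \<tau>0 j (antipode K k) * \<phi> u')"
            by (simp_all add: \<tau>0 distrib_right mult.assoc co_def sweedler_add sweedler_mult_left)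
          note tw = form_twist[OF linear_form_co[OF yd(2) bilinear_antipode[OF \<phi>]]]
          show "co K S (twist (u + u') s) (\<lambda>k u'. \<tau>0 j (antipode K k) * \<phi> u')
            = co K S (twist u s) (\<lambda>k u'. \<tau>0 j (antipode K k) * \<phi> u') + co K S (twist u' s) (\<lambda>k u'. \<tau>0 j (antipode K k) * \<phi> u')"
            "co K S (twist (yscale R c u) s) (\<lambda>k u'. \<tau>0 j (antipode K k) * \<phi> u')
            = c * co K S (twist u s) (\<lambda>k u'. \<tau>0 j (antipode K k) * \<phi> u')"
            unfolding tw
            by (simp_all add: tA \<tau> distrib_right mult.assoc co_def bsw_def sweedler_add sweedler_mult_left)
        qed (auto simp: R(2) hopf_algebraD(1)[OF hopf(1)])
        \<comment> \<open>The right legs of the coaction of \<open>r\<close> stay in degree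
          \<open>i > 0\<close>, where every \<open>twist u s\<close> is zero.\<close>
        have "co J R r (\<lambda>j u. co K S (twist u s) (\<lambda>k u'. \<tau>0 j (antipode K k) * \<phi> u')) = 0"
          using twist[of _ i] False linear_0D[OF linear_form_co[OF yd(2) bilinear_antipode[OF \<phi>]]]
          by (intro co_eq_0[OF gb_R hom b]) simp
        then show ?thesis using R(15)[OF _ hom] False by (simp add: untwist[OF \<phi>])
      qed
    qed (simp add: q linear_addD[OF R(6)] distrib_right bsw_def sweedler_add)
    show ?thesis
    proof (rule nichols_element_eq_0[OF nichols_S less.prems(1) 3 subspace_radical(2) below])
      fix \<phi> assume \<phi>: "linear_form (yscale S) \<phi>"
      have "q r (bsw S s (\<lambda>x1 x2. yscale S (\<phi> x2) x1)) = bcounit R r * \<phi> s" for r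
      proof -
        have "linear_form (yscale S) (q r)" using bilinear_q by (simp add: bilinear_map_def)
        then show ?thesis
          unfolding pos[OF \<phi>, symmetric] bsw_def by (subst sweedler_linear) (simp_all add: q mult.commute)
      qed
      then show "bsw S s (\<lambda>x1 x2. yscale S (\<phi> x2) x1) - yscale S (\<phi> s) 1 \<in> ?M"
        by (simp add: q q_1 mult.commute)
    qed
  qed (use less.prems q_nondegenerate_0(2) q_nondegenerate_1(2) in auto)
qed

end

section \<open>Vector spaces with a carrier\<close>

lemma vspaceD:
  assumes "vspace X"
  shows "zero X \<in> carrier X"
    "x \<in> carrier X \<Longrightarrow> y \<in> carrier X \<Longrightarrow> add X x y \<in> carrier X"
    "x \<in> carrier X \<Longrightarrow> y \<in> carrier X \<Longrightarrow> add X x y = add X y x"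
    "x \<in> carrier X \<Longrightarrow> y \<in> carrier X \<Longrightarrow> z \<in> carrier X \<Longrightarrow> add X (add X x y) z = add X x (add X y z)"
    "x \<in> carrier X \<Longrightarrow> add X (zero X) x = x"
    "x \<in> carrier X \<Longrightarrow> \<exists>y\<in>carrier X. add X x y = zero X"
    "x \<in> carrier X \<Longrightarrow> smul X c x \<in> carrier X"
    "x \<in> carrier X \<Longrightarrow> y \<in> carrier X \<Longrightarrow> smul X c (add X x y) = add X (smul X c x) (smul X c y)"
    "x \<in> carrier X \<Longrightarrow> smul X (c + d) x = add X (smul X c x) (smul X d x)"
    "x \<in> carrier X \<Longrightarrow> smul X (c * d) x = smul X c (smul X d x)"
    "x \<in> carrier X \<Longrightarrow> smul X 1 x = x"
  using assms unfolding vspace_def by - (elim conjE, blast)+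

lemma vspace_cancel:
  assumes X: "vspace X" and c: "x \<in> carrier X" "y \<in> carrier X" "z \<in> carrier X"
    and eq: "add X x y = add X x z"
  shows "y = z"
proof -
  obtain x' where x': "x' \<in> carrier X" "add X x x' = zero X" using vspaceD(6)[OF X c(1)] by blast
  have x'x: "add X x' x = zero X" using x' c vspaceD(3)[OF X, of x' x] by simp
  have "y = add X (add X x' x) y" using x'x c by (simp add: vspaceD(5)[OF X])
  also have "\<dots> = add X x' (add X x z)" using x' c eq by (simp add: vspaceD(4)[OF X])
  also have "\<dots> = add X (add X x' x) z" using x' c by (simp add: vspaceD(4)[OF X])
  also have "\<dots> = z" using x'x c by (simp add: vspaceD(5)[OF X])
  finally show ?thesis .
qed

lemma vspace_smul_0:
  assumes X: "vspace X"
  shows "x \<in> carrier X \<Longrightarrow> smul X 0 x = zero X" "smul X c (zero X) = zero X"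
    "x \<in> carrier X \<Longrightarrow> add X x (zero X) = x"
proof -
  show r: "add X x (zero X) = x" if "x \<in> carrier X" for x
    using that vspaceD(3,5)[OF X] vspaceD(1)[OF X] by metis
  show z: "smul X 0 x = zero X" if x: "x \<in> carrier X"
  proof (rule vspace_cancel[OF X])
    show "add X (smul X 0 x) (smul X 0 x) = add X (smul X 0 x) (zero X)"
      using vspaceD(9)[OF X x, of 0 0] x by (simp add: r vspaceD(7)[OF X])
  qed (use x vspaceD[OF X] in auto)
  show "smul X c (zero X) = zero X"
  proof (rule vspace_cancel[OF X])
    show "add X (smul X c (zero X)) (smul X c (zero X)) = add X (smul X c (zero X)) (zero X)"
      using vspaceD(8)[OF X, of "zero X" "zero X" c] by (simp add: r vspaceD(1,5,7)[OF X])
  qed (use vspaceD[OF X] in auto)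
qed

lemma vspace_neg:
  assumes X: "vspace X" and x: "x \<in> carrier X"
  shows "add X x (smul X (-1) x) = zero X"
  using vspaceD(9)[OF X x, of 1 "-1"] x by (simp add: vspaceD(11)[OF X] vspace_smul_0[OF X])

lemma vspace_eqI:
  assumes X: "vspace X" and c: "x \<in> carrier X" "y \<in> carrier X"
    and eq: "add X x (smul X (-1) y) = zero X"
  shows "x = y"
proof (rule vspace_cancel[OF X _ c])
  show n: "smul X (-1) y \<in> carrier X" using c(2) by (rule vspaceD(7)[OF X])
  show "add X (smul X (-1) y) x = add X (smul X (-1) y) y"
    using eq vspace_neg[OF X c(2)] vspaceD(3)[OF X n c(1)] vspaceD(3)[OF X n c(2)] by simp
qed

lemma vspace_lcomm:
  assumes X: "vspace X" and c: "x \<in> carrier X" "y \<in> carrier X" "z \<in> carrier X"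
  shows "add X x (add X y z) = add X y (add X x z)"
proof -
  have "add X x (add X y z) = add X (add X x y) z" using c by (simp only: vspaceD(4)[OF X])
  also have "\<dots> = add X (add X y x) z" using c by (simp only: vspaceD(3)[OF X])
  also have "\<dots> = add X y (add X x z)" using c by (simp only: vspaceD(4)[OF X])
  finally show ?thesis .
qed

definition subspace_of :: "('k::field, 'u, 'm) vs_scheme \<Rightarrow> 'u set \<Rightarrow> bool" where
  "subspace_of X U \<longleftrightarrow> U \<subseteq> carrier X \<and> zero X \<in> U \<and> (\<forall>x\<in>U. \<forall>y\<in>U. add X x y \<in> U) \<and>
     (\<forall>c. \<forall>x\<in>U. smul X c x \<in> U)"

lemma subspace_ofD:
  assumes "subspace_of X U"
  shows "x \<in> U \<Longrightarrow> x \<in> carrier X" "zero X \<in> U" "x \<in> U \<Longrightarrow> y \<in> U \<Longrightarrow> add X x y \<in> U"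
    "x \<in> U \<Longrightarrow> smul X c x \<in> U"
  using assms by (auto simp: subspace_of_def)

abbreviation forms :: "('k::field, 'u, 'm) vs_scheme \<Rightarrow> ('u \<Rightarrow> 'k) set" where
  "forms X \<equiv> lin X (full (*))"

lemma linD:
  assumes "f \<in> lin X Y"
  shows "x \<in> carrier X \<Longrightarrow> f x \<in> carrier Y" "x \<in> carrier X \<Longrightarrow> y \<in> carrier X \<Longrightarrow> f (add X x y) = add Y (f x) (f y)"
    "x \<in> carrier X \<Longrightarrow> f (smul X c x) = smul Y c (f x)" "x \<notin> carrier X \<Longrightarrow> f x = undefined"
  using assms by (auto simp: lin_def PiE_def extensional_def)

lemma linI:
  assumes "\<And>x. x \<in> carrier X \<Longrightarrow> f x \<in> carrier Y"
    "\<And>x y. x \<in> carrier X \<Longrightarrow> y \<in> carrier X \<Longrightarrow> f (add X x y) = add Y (f x) (f y)"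
    "\<And>c x. x \<in> carrier X \<Longrightarrow> f (smul X c x) = smul Y c (f x)" "\<And>x. x \<notin> carrier X \<Longrightarrow> f x = undefined"
  shows "f \<in> lin X Y"
  using assms by (auto simp: lin_def PiE_def extensional_def)

lemma lin_restrictI:
  assumes "vspace X" "\<And>x. x \<in> carrier X \<Longrightarrow> f x \<in> carrier Y"
    "\<And>x y. x \<in> carrier X \<Longrightarrow> y \<in> carrier X \<Longrightarrow> f (add X x y) = add Y (f x) (f y)"
    "\<And>c x. x \<in> carrier X \<Longrightarrow> f (smul X c x) = smul Y c (f x)"
  shows "restrict f (carrier X) \<in> lin X Y"
  using assms(2-) by (intro linI) (auto simp: vspaceD[OF assms(1)])

lemma lin_zero:
  assumes X: "vspace X" and Y: "vspace Y" and f: "f \<in> lin X Y"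
  shows "f (zero X) = zero Y"
proof -
  have "f (smul X 0 (zero X)) = smul Y 0 (f (zero X))" using linD(3)[OF f] vspaceD(1)[OF X] .
  then show ?thesis using linD(1)[OF f vspaceD(1)[OF X]] by (simp add: vspace_smul_0 X Y)
qed

lemma vspace_field: "vspace (full ((*) :: 'k::field \<Rightarrow> 'k \<Rightarrow> 'k))"
  by (simp add: vspace_full vector_space_field)

lemma full_simps [simp]: "add (full s) = (+)" "zero (full s) = 0" "smul (full s) = s"
  by (simp_all add: full_def)

lemma formD:
  assumes "\<psi> \<in> forms X"
  shows "x \<in> carrier X \<Longrightarrow> y \<in> carrier X \<Longrightarrow> \<psi> (add X x y) = \<psi> x + \<psi> y"
    "x \<in> carrier X \<Longrightarrow> \<psi> (smul X c x) = c * \<psi> x"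
  using linD[OF assms] by auto

lemma form_zero: "vspace X \<Longrightarrow> \<psi> \<in> forms X \<Longrightarrow> \<psi> (zero X) = 0"
  using lin_zero[OF _ vspace_field] by fastforce

text \<open>Zorn's lemma gives a subspace that is maximal among those containing \<open>U\<close> but not \<open>z\<close>; it is
  a complement of the line through \<open>z\<close>.\<close>

lemma ex_separating_form:
  assumes X: "vspace X" and U: "subspace_of X U" and z: "z \<in> carrier X" "z \<notin> U"
  obtains \<psi> where "\<psi> \<in> forms X" "\<psi> z = 1" "\<And>u. u \<in> U \<Longrightarrow> \<psi> u = 0"
proof -
  note D = vspaceD[OF X] and Z = vspace_smul_0[OF X]
  note ac = D(2,3,4,7) vspace_lcomm[OF X]
  let ?S = "{U'. subspace_of X U' \<and> U \<subseteq> U' \<and> z \<notin> U'}"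
  have "\<exists>M\<in>?S. \<forall>N\<in>?S. M \<subseteq> N \<longrightarrow> N = M"
  proof (rule subset_Zorn_nonempty)
    show "?S \<noteq> {}" using U z by auto
    fix \<C> assume C: "\<C> \<noteq> {}" "subset.chain ?S \<C>"
    have sub: "\<And>V. V \<in> \<C> \<Longrightarrow> subspace_of X V" and UV: "\<And>V. V \<in> \<C> \<Longrightarrow> U \<subseteq> V"
      and zV: "\<And>V. V \<in> \<C> \<Longrightarrow> z \<notin> V"
      and ch: "\<And>V V'. V \<in> \<C> \<Longrightarrow> V' \<in> \<C> \<Longrightarrow> V \<subseteq> V' \<or> V' \<subseteq> V"
      using C(2) by (auto simp: subset_chain_def)
    have "subspace_of X (\<Union>\<C>)"
      unfolding subspace_of_def
    proof (intro conjI ballI allI)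
      show "\<Union>\<C> \<subseteq> carrier X" using subspace_ofD(1)[OF sub] by blast
      show "zero X \<in> \<Union>\<C>" using C(1) subspace_ofD(2)[OF sub] by blast
      fix x assume x: "x \<in> \<Union>\<C>"
      show "smul X c x \<in> \<Union>\<C>" for c using x subspace_ofD(4)[OF sub] by blast
      fix y assume y: "y \<in> \<Union>\<C>"
      obtain V V' where V: "V \<in> \<C>" "x \<in> V" "V' \<in> \<C>" "y \<in> V'" using x y by blast
      then consider "y \<in> V" | "x \<in> V'" using ch by blast
      then show "add X x y \<in> \<Union>\<C>" using V subspace_ofD(3)[OF sub] by cases blast+
    qed
    moreover have "U \<subseteq> \<Union>\<C>" using C(1) UV by blast
    ultimately show "\<Union>\<C> \<in> ?S" using zV by blast
  qed
  then obtain M where MS: "M \<in> ?S" and MN: "\<forall>N\<in>?S. M \<subseteq> N \<longrightarrow> N = M" by (rule bexE)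
  have M: "subspace_of X M" "U \<subseteq> M" "z \<notin> M" using MS by auto
  have max: "N = M" if "subspace_of X N" "M \<subseteq> N" "z \<notin> N" for N
    using MN that M(2) by simp
  note MD = subspace_ofD[OF M(1)]
  have inv: "x \<in> M" if x: "x \<in> carrier X" "smul X c x \<in> M" "c \<noteq> 0" for c x
    using MD(4)[OF x(2), of "inverse c"] x D(10)[OF x(1), of "inverse c" c] D(11) by simp
  \<comment> \<open>If \<open>x\<close> is not in \<open>M\<close>, then by maximality the sum of
    \<open>M\<close> and the line through \<open>x\<close> contains \<open>z\<close>; the
    coefficient of \<open>x\<close> in \<open>z\<close> is non-zero, so one can solve for
    \<open>x\<close>.\<close>
  have ex: "\<exists>c. add X x (smul X c z) \<in> M" if x: "x \<in> carrier X" for x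
  proof (cases "x \<in> M")
    case True
    then show ?thesis using x z by (intro exI[of _ 0]) (simp add: Z)
  next
    case False
    let ?N = "{add X u (smul X c x) | u c. u \<in> M}"
    have N_add: "add X (add X u (smul X c x)) (add X u' (smul X c' x)) = add X (add X u u') (smul X (c + c') x)"
      if "u \<in> M" "u' \<in> M" for u u' c c'
      using MD(1)[OF that(1)] MD(1)[OF that(2)] x by (simp add: ac D(9))
    have N_smul: "smul X d (add X u (smul X c x)) = add X (smul X d u) (smul X (d * c) x)" if "u \<in> M" for u c d
      using MD(1)[OF that] x by (simp add: D(7,8,10))
    have N_I: "add X u (smul X c x) \<in> ?N" if "u \<in> M" for u c using that by blast
    have subN: "subspace_of X ?N"
      unfolding subspace_of_def
    proof (intro conjI ballI allI)
      show "?N \<subseteq> carrier X" using MD(1) x D(2,7) by auto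
      have e: "add X (zero X) (smul X 0 x) = zero X" using x by (simp add: Z D(1,5))
      show "zero X \<in> ?N" using N_I[OF MD(2), of 0] unfolding e .
      fix n assume "n \<in> ?N"
      then obtain u c where n: "u \<in> M" "n = add X u (smul X c x)" by auto
      show "smul X d n \<in> ?N" for d unfolding n(2) N_smul[OF n(1)] by (rule N_I) (rule MD(4)[OF n(1)])
      fix n' assume "n' \<in> ?N"
      then obtain u' c' where n': "u' \<in> M" "n' = add X u' (smul X c' x)" by auto
      show "add X n n' \<in> ?N" unfolding n(2) n'(2) N_add[OF n(1) n'(1)] by (rule N_I) (rule MD(3)[OF n(1) n'(1)])
    qed
    have MN: "M \<subseteq> ?N"
    proof
      fix u assume u: "u \<in> M"
      then have e: "add X u (smul X 0 x) = u" using x MD(1) by (simp add: Z)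
      show "u \<in> ?N" using N_I[OF u, of 0] unfolding e .
    qed
    have xN: "x \<in> ?N"
    proof -
      have e: "add X (zero X) (smul X 1 x) = x" using x by (simp add: D(5,11))
      show ?thesis using N_I[OF MD(2), of 1] unfolding e .
    qed
    have "z \<in> ?N"
    proof (rule ccontr)
      assume "z \<notin> ?N"
      then have "?N = M" by (rule max[OF subN MN])
      then show False using xN False by (simp only:)
    qed
    then obtain u c where u: "u \<in> M" "z = add X u (smul X c x)" by auto
    have c: "c \<noteq> 0" using u M(3) x MD by (auto simp: Z)
    have "add X (smul X c x) (smul X (-1) z) = smul X (-1) u"
    proof (rule vspace_cancel[OF X, of z])
      have zz: "add X z (smul X (-1) z) = zero X" and uu: "add X u (smul X (-1) u) = zero X"
        using vspace_neg[OF X] z u MD(1) by auto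
      have "add X z (add X (smul X c x) (smul X (-1) z)) = add X (smul X c x) (add X z (smul X (-1) z))"
        using z x by (simp add: ac)
      also have "\<dots> = smul X c x" using x by (simp add: zz Z D)
      also have "\<dots> = add X (add X u (smul X (-1) u)) (smul X c x)" using x by (simp add: uu D(5,7))
      also have "\<dots> = add X z (smul X (-1) u)" using x u MD(1) by (simp add: ac)
      finally show "add X z (add X (smul X c x) (smul X (-1) z)) = add X z (smul X (-1) u)" .
    qed (use x z u MD(1) in \<open>auto simp: D\<close>)
    then have "add X (smul X c x) (smul X (-1) z) \<in> M" using MD(4) u by simp
    moreover have "smul X c (add X x (smul X (- inverse c) z)) = add X (smul X c x) (smul X (-1) z)"
      using x z c D(10)[of z c "- inverse c"] by (simp add: D(7,8))
    ultimately show ?thesis using inv[of "add X x (smul X (- inverse c) z)" c] c x z D by metis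
  qed
  have uniq: "c = d" if x: "x \<in> carrier X" "add X x (smul X c z) \<in> M" "add X x (smul X d z) \<in> M" for x c d
  proof (rule ccontr)
    assume "c \<noteq> d"
    have "smul X (c - d) z = add X (add X x (smul X c z)) (smul X (-1) (add X x (smul X d z)))"
    proof (rule vspace_cancel[OF X, of "add X x (smul X d z)"])
      let ?y = "add X x (smul X d z)"
      have y: "?y \<in> carrier X" using x z by (simp add: D)
      have yy: "add X ?y (smul X (-1) ?y) = zero X"
        by (rule vspace_neg[OF X y])
      have "add X ?y (smul X (c - d) z) = add X x (smul X c z)"
        using x z D(9)[of z d "c - d"] by (simp add: D(4,7))
      also have "\<dots> = add X (add X x (smul X c z)) (add X ?y (smul X (-1) ?y))"
        using x z unfolding yy by (simp add: Z D)
      also have "\<dots> = add X ?y (add X (add X x (smul X c z)) (smul X (-1) ?y))"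
        using x(1) z by (simp add: ac)
      finally show "add X ?y (smul X (c - d) z) = add X ?y (add X (add X x (smul X c z)) (smul X (-1) ?y))" .
    qed (use x z D in auto)
    then have m: "smul X (c - d) z \<in> M" using x MD(3,4) by simp
    show False using inv[OF z(1) m] M(3) \<open>c \<noteq> d\<close> by simp
  qed
  \<comment> \<open>The coefficient of \<open>z\<close> in the decomposition of \<open>x\<close>
    along \<open>M\<close> and the line through \<open>z\<close>; the minus sign undoes the
    convention \<open>x + c z \<in> M\<close>.\<close>
  define \<psi> where "\<psi> = restrict (\<lambda>x. - (THE c. add X x (smul X c z) \<in> M)) (carrier X)"
  have \<psi>: "\<psi> x = - c" if "x \<in> carrier X" "add X x (smul X c z) \<in> M" for x c
  proof -
    have "(THE c. add X x (smul X c z) \<in> M) = c"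
      by (rule the_equality[where P = "\<lambda>c. add X x (smul X c z) \<in> M", OF that(2)]) (rule uniq[OF that(1) _ that(2)])
    then show ?thesis using that(1) by (simp add: \<psi>_def)
  qed
  have ex\<psi>: "add X x (smul X (- \<psi> x) z) \<in> M" if x: "x \<in> carrier X" for x
  proof -
    obtain c where c: "add X x (smul X c z) \<in> M" using ex[OF x] by (rule exE)
    show ?thesis using c \<psi>[OF x c] by simp
  qed
  show thesis
  proof
    show "\<psi> \<in> forms X"
    proof (rule linI)
      fix x y assume x: "x \<in> carrier X" and y: "y \<in> carrier X"
      have "add X (add X x y) (smul X (- \<psi> x + - \<psi> y) z)
        = add X (add X x (smul X (- \<psi> x) z)) (add X y (smul X (- \<psi> y) z))"
        using x y z D(9)[OF z(1), of "- \<psi> x" "- \<psi> y"] by (simp add: ac)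
      then have "add X (add X x y) (smul X (- \<psi> x + - \<psi> y) z) \<in> M" using ex\<psi> x y MD(3) by metis
      from \<psi>[OF D(2)[OF x y] this] show "\<psi> (add X x y) = add (full (*)) (\<psi> x) (\<psi> y)" by simp
    next
      fix c x assume x: "x \<in> carrier X"
      have "smul X c (add X x (smul X (- \<psi> x) z)) = add X (smul X c x) (smul X (c * (- \<psi> x)) z)"
        using x z by (simp only: D)
      then have "add X (smul X c x) (smul X (c * (- \<psi> x)) z) \<in> M" using ex\<psi> x MD(4) by metis
      from \<psi>[OF D(7)[OF x] this] show "\<psi> (smul X c x) = smul (full (*)) c (\<psi> x)" by simp
    qed (auto simp: \<psi>_def)
    have "add X z (smul X (-1) z) = zero X" by (rule vspace_neg[OF X z(1)])
    then show "\<psi> z = 1" using \<psi>[OF z(1), of "-1"] MD(2) by simp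
    show "\<psi> u = 0" if "u \<in> U" for u
      using \<psi>[of u 0] that M(2) MD(1) z by (auto simp: Z)
  qed
qed

lemma forms_separate:
  assumes X: "vspace X" and xy: "x \<in> carrier X" "y \<in> carrier X"
    and eq: "\<And>\<psi>. \<psi> \<in> forms X \<Longrightarrow> \<psi> x = \<psi> y"
  shows "x = y"
proof -
  note D = vspaceD[OF X] and Z = vspace_smul_0[OF X]
  have "subspace_of X {zero X}" by (auto simp: subspace_of_def D Z)
  have "add X x (smul X (-1) y) = zero X"
  proof (rule ccontr)
    assume "add X x (smul X (-1) y) \<noteq> zero X"
    then obtain \<psi> where \<psi>: "\<psi> \<in> forms X" "\<psi> (add X x (smul X (-1) y)) = 1"
      using ex_separating_form[OF X \<open>subspace_of X {zero X}\<close>] D xy by (metis singletonD)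
    then show False using eq[OF \<psi>(1)] xy by (simp add: formD[OF \<psi>(1)] D(7))
  qed
  then show ?thesis by (rule vspace_eqI[OF X xy])
qed

text \<open>A substitute for finite sums in a space with a carrier: the element is described by its
  values under all forms, which determine it by \<open>forms_separate\<close>.\<close>

lemma ex_sum:
  assumes X: "vspace X" and "finite I" "\<And>i. i \<in> I \<Longrightarrow> f i \<in> carrier X"
  obtains x where "x \<in> carrier X" "\<And>\<psi>. \<psi> \<in> forms X \<Longrightarrow> \<psi> x = (\<Sum>i\<in>I. \<psi> (f i))"
proof -
  have "\<exists>x\<in>carrier X. \<forall>\<psi>\<in>forms X. \<psi> x = (\<Sum>i\<in>I. \<psi> (f i))"
    using assms(2,3)
  proof (induction I rule: finite_induct)
    case empty
    then show ?case using vspaceD(1)[OF X] form_zero[OF X] by auto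
  next
    case (insert i I)
    then obtain x where x: "x \<in> carrier X" "\<forall>\<psi>\<in>forms X. \<psi> x = (\<Sum>i\<in>I. \<psi> (f i))" by auto
    then show ?case using insert
      by (intro bexI[of _ "add X (f i) x"]) (auto simp: formD vspaceD(2)[OF X])
  qed
  then show thesis using that by blast
qed

section \<open>Tensor products\<close>

lemma bilinD:
  assumes "F \<in> bilin X Y Z"
  shows "x \<in> carrier X \<Longrightarrow> restrict (F x) (carrier Y) \<in> lin Y Z"
    "y \<in> carrier Y \<Longrightarrow> restrict (\<lambda>x. F x y) (carrier X) \<in> lin X Z"
  using assms by (auto simp: bilin_def)

lemma bilin_simps:
  assumes F: "F \<in> bilin X Y Z" and X: "vspace X" and Y: "vspace Y"
  shows "x \<in> carrier X \<Longrightarrow> y \<in> carrier Y \<Longrightarrow> F x y \<in> carrier Z"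
    "x \<in> carrier X \<Longrightarrow> x' \<in> carrier X \<Longrightarrow> y \<in> carrier Y \<Longrightarrow> F (add X x x') y = add Z (F x y) (F x' y)"
    "x \<in> carrier X \<Longrightarrow> y \<in> carrier Y \<Longrightarrow> F (smul X c x) y = smul Z c (F x y)"
    "x \<in> carrier X \<Longrightarrow> y \<in> carrier Y \<Longrightarrow> y' \<in> carrier Y \<Longrightarrow> F x (add Y y y') = add Z (F x y) (F x y')"
    "x \<in> carrier X \<Longrightarrow> y \<in> carrier Y \<Longrightarrow> F x (smul Y c y) = smul Z c (F x y)"
proof -
  assume x: "x \<in> carrier X" and y: "y \<in> carrier Y"
  note 1 = linD[OF bilinD(1)[OF F x]] and 2 = linD[OF bilinD(2)[OF F y]]
  show "F x y \<in> carrier Z" using 1(1)[OF y] y by simp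
  show "F (smul X c x) y = smul Z c (F x y)" using 2(3)[OF x, of c] x vspaceD(7)[OF X] by simp
  show "F x (smul Y c y) = smul Z c (F x y)" using 1(3)[OF y, of c] y vspaceD(7)[OF Y] by simp
  show "F (add X x x') y = add Z (F x y) (F x' y)" if "x' \<in> carrier X"
    using 2(2)[OF x that] x that vspaceD(2)[OF X] by simp
  show "F x (add Y y y') = add Z (F x y) (F x y')" if "y' \<in> carrier Y"
    using 1(2)[OF y that] y that vspaceD(2)[OF Y] by simp
qed

lemma bilinI:
  assumes X: "vspace X" and Y: "vspace Y"
    and "\<And>x y. x \<in> carrier X \<Longrightarrow> y \<in> carrier Y \<Longrightarrow> F x y \<in> carrier Z"
    "\<And>x x' y. x \<in> carrier X \<Longrightarrow> x' \<in> carrier X \<Longrightarrow> y \<in> carrier Y \<Longrightarrow> F (add X x x') y = add Z (F x y) (F x' y)"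
    "\<And>c x y. x \<in> carrier X \<Longrightarrow> y \<in> carrier Y \<Longrightarrow> F (smul X c x) y = smul Z c (F x y)"
    "\<And>x y y'. x \<in> carrier X \<Longrightarrow> y \<in> carrier Y \<Longrightarrow> y' \<in> carrier Y \<Longrightarrow> F x (add Y y y') = add Z (F x y) (F x y')"
    "\<And>c x y. x \<in> carrier X \<Longrightarrow> y \<in> carrier Y \<Longrightarrow> F x (smul Y c y) = smul Z c (F x y)"
  shows "F \<in> bilin X Y Z"
  unfolding bilin_def using assms by (auto intro!: lin_restrictI)

locale tensor =
  fixes X :: "('k::field, 'a, 'm1) vs_scheme" and Y :: "('k, 'b, 'm2) vs_scheme"
    and T :: "('k, 'c, 'm3) vs_scheme" and t :: "'a \<Rightarrow> 'b \<Rightarrow> 'c"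
  assumes tensor: "tensor_product X Y T t"
begin

lemma vspaces: "vspace X" "vspace Y" "vspace T"
  and t_bilin: "t \<in> bilin X Y T"
  using tensor by (auto simp: tensor_product_def)

lemmas t = bilin_simps[OF t_bilin vspaces(1,2)]

lemma lift_form:
  assumes "\<beta> \<in> bilin X Y (full (*))"
  obtains \<phi> where "\<phi> \<in> forms T" "\<And>x y. x \<in> carrier X \<Longrightarrow> y \<in> carrier Y \<Longrightarrow> \<phi> (t x y) = \<beta> x y"
  using tensor assms unfolding tensor_product_def by blast

text \<open>A form that vanishes on \<open>U\<close> but not at some \<open>z\<close> outside it
  would be a second extension of the zero bilinear form, against the uniqueness in the universal
  property.\<close>

lemma subspace_eq_carrier:
  assumes U: "subspace_of T U" and "\<And>x y. x \<in> carrier X \<Longrightarrow> y \<in> carrier Y \<Longrightarrow> t x y \<in> U"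
  shows "U = carrier T"
proof (rule ccontr)
  assume "U \<noteq> carrier T"
  then obtain z where "z \<in> carrier T" "z \<notin> U" using subspace_ofD(1)[OF U] by blast
  then obtain \<psi> where \<psi>: "\<psi> \<in> forms T" "\<psi> z = 1" "\<And>u. u \<in> U \<Longrightarrow> \<psi> u = 0"
    using ex_separating_form[OF vspaces(3) U] by metis
  let ?\<beta> = "\<lambda>x y. 0 :: 'k" and ?o = "restrict (\<lambda>m. 0 :: 'k) (carrier T)"
  have \<beta>: "?\<beta> \<in> bilin X Y (full (*))" by (rule bilinI[OF vspaces(1,2)]) auto
  have "\<forall>\<beta>\<in>bilin X Y (full (*)). \<exists>!\<phi>. \<phi> \<in> forms T \<and> (\<forall>x\<in>carrier X. \<forall>y\<in>carrier Y. \<phi> (t x y) = \<beta> x y)"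
    using tensor unfolding tensor_product_def by (elim conjE)
  from bspec[OF this \<beta>] have "\<exists>!\<phi>. \<phi> \<in> forms T \<and> (\<forall>x\<in>carrier X. \<forall>y\<in>carrier Y. \<phi> (t x y) = 0)" .
  moreover have "?o \<in> forms T" by (rule lin_restrictI[OF vspaces(3)]) auto
  moreover have "\<forall>x\<in>carrier X. \<forall>y\<in>carrier Y. ?o (t x y) = 0" using t(1) by simp
  moreover have "\<forall>x\<in>carrier X. \<forall>y\<in>carrier Y. \<psi> (t x y) = 0" using \<psi>(3) assms(2) by blast
  ultimately have "\<psi> = ?o" using \<psi>(1) by blast
  then show False using \<psi>(2) \<open>z \<in> carrier T\<close> by simp
qed

lemma tensor_induct [consumes 1, case_names pure add]:
  assumes m: "m \<in> carrier T"
    and pure: "\<And>x y. x \<in> carrier X \<Longrightarrow> y \<in> carrier Y \<Longrightarrow> Q (t x y)"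
    and add: "\<And>m m'. m \<in> carrier T \<Longrightarrow> m' \<in> carrier T \<Longrightarrow> Q m \<Longrightarrow> Q m' \<Longrightarrow> Q (add T m m')"
  shows "Q m"
proof -
  note D = vspaceD[OF vspaces(3)]
  \<comment> \<open>Since \<open>Q\<close> need not be preserved by scaling, the subspace consists
    of the elements all of whose multiples satisfy \<open>Q\<close>; a pure tensor qualifies because
    the scalar can be moved into its first factor.\<close>
  let ?U = "{m \<in> carrier T. \<forall>c. Q (smul T c m)}"
  have pureU: "t x y \<in> ?U" if "x \<in> carrier X" "y \<in> carrier Y" for x y
    using that pure[OF vspaceD(7)[OF vspaces(1)]] t(1,3) by auto
  have "zero T = t (zero X) (zero Y)"
    using t(1,3)[of "zero X" "zero Y"] vspaceD(1)[OF vspaces(1)] vspaceD(1)[OF vspaces(2)]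
      vspace_smul_0[OF vspaces(1)] vspace_smul_0[OF vspaces(3)] by metis
  then have "zero T \<in> ?U" using pureU vspaceD(1)[OF vspaces(1)] vspaceD(1)[OF vspaces(2)] by simp
  moreover have "smul T c m \<in> ?U" if "m \<in> ?U" for c m
    using that D(7) D(10)[symmetric] by auto
  moreover have "add T m m' \<in> ?U" if "m \<in> ?U" "m' \<in> ?U" for m m'
    using that D(2,7,8) add by auto
  ultimately have "subspace_of T ?U" by (auto simp: subspace_of_def)
  then have "m \<in> ?U" using subspace_eq_carrier[OF _ pureU] m by simp
  then show ?thesis using D(11)[OF m] by (metis (mono_tags, lifting) mem_Collect_eq)
qed

lemma lin_eqI:
  assumes "f \<in> lin T Z" "g \<in> lin T Z"
    and "\<And>x y. x \<in> carrier X \<Longrightarrow> y \<in> carrier Y \<Longrightarrow> f (t x y) = g (t x y)"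
  shows "f = g"
proof (rule ext)
  fix m show "f m = g m"
  proof (cases "m \<in> carrier T")
    case True then show ?thesis
      by (induction m rule: tensor_induct) (auto simp: assms(3) linD[OF assms(1)] linD[OF assms(2)])
  qed (simp add: linD(4)[OF assms(1)] linD(4)[OF assms(2)])
qed

text \<open>The graph of the linear map that \<open>F\<close> induces. It is single-valued because
  composing \<open>F\<close> with a form on \<open>Z\<close> gives a bilinear form, which does lift
  to \<open>T\<close>, and forms separate the points of \<open>Z\<close>.\<close>

inductive lift_graph :: "('k, 'd, 'm4) vs_scheme \<Rightarrow> ('a \<Rightarrow> 'b \<Rightarrow> 'd) \<Rightarrow> 'c \<Rightarrow> 'd \<Rightarrow> bool" for Z F where
  pure: "x \<in> carrier X \<Longrightarrow> y \<in> carrier Y \<Longrightarrow> lift_graph Z F (t x y) (F x y)"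
| add: "lift_graph Z F m z \<Longrightarrow> lift_graph Z F m' z' \<Longrightarrow> lift_graph Z F (add T m m') (add Z z z')"

lemma ex_lift:
  assumes Z: "vspace Z" and F: "F \<in> bilin X Y Z"
  obtains \<phi> where "\<phi> \<in> lin T Z" "\<And>x y. x \<in> carrier X \<Longrightarrow> y \<in> carrier Y \<Longrightarrow> \<phi> (t x y) = F x y"
proof -
  note F' = bilin_simps[OF F vspaces(1,2)] and D = vspaceD[OF vspaces(3)]
  have car: "m \<in> carrier T \<and> z \<in> carrier Z" if "lift_graph Z F m z" for m z
    using that by induction (auto simp: t F' D vspaceD[OF Z])
  have uniq: "z = z'" if "lift_graph Z F m z" "lift_graph Z F m z'" for m z z'
  proof (rule forms_separate[OF Z])
    fix \<psi> assume \<psi>: "\<psi> \<in> forms Z"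
    have "(\<lambda>x y. \<psi> (F x y)) \<in> bilin X Y (full (*))"
      by (rule bilinI[OF vspaces(1,2)]) (auto simp: F' formD[OF \<psi>])
    then obtain \<phi> where \<phi>: "\<phi> \<in> forms T" "\<And>x y. x \<in> carrier X \<Longrightarrow> y \<in> carrier Y \<Longrightarrow> \<phi> (t x y) = \<psi> (F x y)"
      by (rule lift_form) blast
    have "\<phi> m = \<psi> z" if "lift_graph Z F m z" for m z
      using that by induction (auto simp: \<phi>(2) formD[OF \<phi>(1)] formD[OF \<psi>] car)
    then show "\<psi> z = \<psi> z'" using that by metis
  qed (use that car in auto)
  have ex: "\<exists>z. lift_graph Z F m z" if "m \<in> carrier T" for m
    using that by (induction m rule: tensor_induct) (auto intro: lift_graph.intros)
  have smul: "lift_graph Z F (smul T c m) (smul Z c z)" if "lift_graph Z F m z" for c m z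
    using that
  proof induction
    case (pure x y)
    then show ?case using lift_graph.pure[of "smul X c x" y Z F] vspaceD(7)[OF vspaces(1)] t(3) F'(3) by simp
  next
    case (add m z m' z')
    then show ?case using lift_graph.add[OF add.IH] car[OF add.hyps(1)] car[OF add.hyps(2)]
      by (simp add: D vspaceD[OF Z])
  qed
  define \<phi> where "\<phi> = restrict (\<lambda>m. THE z. lift_graph Z F m z) (carrier T)"
  have \<phi>: "\<phi> m = z" if "lift_graph Z F m z" for m z
    using that uniq car by (auto simp: \<phi>_def)
  have g: "lift_graph Z F m (\<phi> m)" if "m \<in> carrier T" for m
    using ex[OF that] \<phi> by blast
  show thesis
  proof
    show "\<phi> \<in> lin T Z"
    proof (rule linI)
      fix x y assume x: "x \<in> carrier T" and y: "y \<in> carrier T"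
      show "\<phi> x \<in> carrier Z" using car[OF g[OF x]] by simp
      show "\<phi> (add T x y) = add Z (\<phi> x) (\<phi> y)" by (rule \<phi>[OF lift_graph.add[OF g[OF x] g[OF y]]])
      show "\<phi> (smul T c x) = smul Z c (\<phi> x)" for c by (rule \<phi>[OF smul[OF g[OF x]]])
    qed (simp add: \<phi>_def)
    show "\<phi> (t x y) = F x y" if "x \<in> carrier X" "y \<in> carrier Y" for x y
      using \<phi>[OF lift_graph.pure] that by blast
  qed
qed

end

text \<open>Along a basis of the first factor, \<open>m\<close> is the sum of the tensors
  \<open>e \<otimes> c e m\<close>, where \<open>c e\<close> contracts with the coordinate form of
  \<open>e\<close>, and all \<open>c e m\<close> are zero by assumption. The expansion is verified
  under an arbitrary form \<open>\<psi>\<close>.\<close>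

lemma tensor_eq_zeroI:
  assumes T: "tensor_product (full s) Y T t" and m: "m \<in> carrier T"
    and zero: "\<And>\<alpha> \<phi>. linear_form s \<alpha> \<Longrightarrow> \<phi> \<in> lin T Y \<Longrightarrow>
      (\<And>r y. y \<in> carrier Y \<Longrightarrow> \<phi> (t r y) = smul Y (\<alpha> r) y) \<Longrightarrow> \<phi> m = zero Y"
  shows "m = zero T"
proof -
  interpret tensor "full s" Y T t by unfold_locales (rule T)
  note D = vspaceD[OF vspaces(2)]
  have s: "vector_space s" using vspaces(1) by (simp add: vspace_full)
  obtain rep where rep: "\<And>e. linear_form s (\<lambda>v. rep v e)"
    "\<And>v. finite {e. rep v e \<noteq> 0}"
    "\<And>v E. finite E \<Longrightarrow> {e. rep v e \<noteq> 0} \<subseteq> E \<Longrightarrow> (\<Sum>e\<in>E. s (rep v e) e) = v"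
    using ex_coordinates[OF s] by blast
  have "\<exists>\<phi>\<in>lin T Y. \<forall>r. \<forall>y\<in>carrier Y. \<phi> (t r y) = smul Y (rep r e) y" for e
  proof -
    have "(\<lambda>r y. smul Y (rep r e) y) \<in> bilin (full s) Y Y"
      by (rule bilinI[OF vspaces(1,2)])
         (auto simp: D linear_addD[OF rep(1)] linear_scaleD[OF rep(1)] mult.commute simp flip: D(10))
    from ex_lift[OF vspaces(2) this] show ?thesis by (metis UNIV_I carrier_full)
  qed
  then obtain c where c: "\<And>e. c e \<in> lin T Y" "\<And>e r y. y \<in> carrier Y \<Longrightarrow> c e (t r y) = smul Y (rep r e) y"
    by metis
  have c0: "c e m = zero Y" for e by (rule zero[OF rep(1) c])
  show ?thesis
  proof (rule forms_separate[OF vspaces(3) m])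
    show "zero T \<in> carrier T" by (rule vspaceD(1)[OF vspaces(3)])
    fix \<psi> assume \<psi>: "\<psi> \<in> forms T"
    note \<psi>D = formD[OF \<psi>]
    have sum: "\<psi> (t (sum f E) y) = (\<Sum>e\<in>E. \<psi> (t (f e) y))" if y: "y \<in> carrier Y" for f E y
    proof -
      have lin: "Vector_Spaces.linear s (*) (\<lambda>r. \<psi> (t r y))"
        using y t(1)[of _ y] t(2)[of _ _ y] t(3)[of _ y] by (intro linear_formI s) (auto simp: \<psi>D)
      show ?thesis by (rule linear_sumD[OF lin])
    qed
    \<comment> \<open>Quantifying over all larger finite index sets allows the sets of two summands
      to be united in the additive case.\<close>
    have "\<exists>E. finite E \<and> (\<forall>E'. finite E' \<longrightarrow> E \<subseteq> E' \<longrightarrow> \<psi> m = (\<Sum>e\<in>E'. \<psi> (t e (c e m))))" using m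
    proof (induction m rule: tensor_induct)
      case (pure r y)
      show ?case
      proof (intro exI[of _ "{e. rep r e \<noteq> 0}"] conjI allI impI rep(2))
        fix E assume E: "finite E" "{e. rep r e \<noteq> 0} \<subseteq> E"
        have "\<psi> (t r y) = \<psi> (t (\<Sum>e\<in>E. s (rep r e) e) y)" using rep(3)[OF E] by simp
        also have "\<dots> = (\<Sum>e\<in>E. \<psi> (t e (c e (t r y))))"
          using pure(2) t(3)[of _ y] t(5)[of _ y] unfolding sum[OF pure(2)] by (simp add: c)
        finally show "\<psi> (t r y) = (\<Sum>e\<in>E. \<psi> (t e (c e (t r y))))" .
      qed
    next
      case (add m m')
      then obtain E E' where "finite E" "finite E'"
        "\<forall>F. finite F \<longrightarrow> E \<subseteq> F \<longrightarrow> \<psi> m = (\<Sum>e\<in>F. \<psi> (t e (c e m)))"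
        "\<forall>F. finite F \<longrightarrow> E' \<subseteq> F \<longrightarrow> \<psi> m' = (\<Sum>e\<in>F. \<psi> (t e (c e m')))" by blast
      then show ?case using add(1,2)
        by (intro exI[of _ "E \<union> E'"])
          (auto simp: linD[OF c(1)] t \<psi>D sum.distrib)
    qed
    then obtain E where E: "\<psi> m = (\<Sum>e\<in>E. \<psi> (t e (c e m)))" by blast
    have "\<psi> (t e (zero Y)) = 0" for e
      using t(5)[of e "zero Y" 0] vspace_smul_0[OF vspaces(2)] vspace_smul_0[OF vspaces(3)]
        t(1)[of e "zero Y"] D(1) form_zero[OF vspaces(3) \<psi>] by auto
    then show "\<psi> m = \<psi> (zero T)" by (simp add: E c0 form_zero[OF vspaces(3) \<psi>])
  qed
qed

section \<open>Integrable modules\<close>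

text \<open>Biorthogonalization: the new vector \<open>b\<close> is made orthogonal to the dual
  vectors found so far, some \<open>r \<in> Q\<close> detects the remainder \<open>s\<close>, and
  the old dual vectors are corrected so that they vanish at \<open>b\<close>.\<close>

lemma ex_dual_system:
  assumes q: "bilinear_map sR sS (*) q" and Q: "module.subspace sR Q" and B: "finite B"
    and indep: "\<not> module.dependent sS B"
    and nondeg: "\<And>s. s \<in> module.span sS B \<Longrightarrow> (\<And>r. r \<in> Q \<Longrightarrow> q r s = 0) \<Longrightarrow> s = 0"
  shows "\<exists>d. (\<forall>b\<in>B. d b \<in> Q) \<and> (\<forall>b\<in>B. \<forall>b'\<in>B. q (d b) b' = (if b = b' then 1 else 0 :: 'k::field))"
  using B indep nondeg
proof (induction B rule: finite_induct)
  case empty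
  then show ?case by simp
next
  case (insert b B)
  have vs: "vector_space sR" "vector_space sS"
    using q by (auto simp: bilinear_map_def Vector_Spaces.linear_iff)
  interpret R: vector_space sR by (rule vs)
  interpret S: vector_space sS by (rule vs)
  note q' = bilinear_formD[OF q]
  have ind: "S.independent B" "b \<notin> S.span B"
    using insert.prems(1) insert.hyps(2) by (auto simp: S.independent_insert)
  have "S.span B \<subseteq> S.span (insert b B)" by (rule S.span_mono) auto
  then obtain d where d: "\<And>b. b \<in> B \<Longrightarrow> d b \<in> Q"
      "\<And>b b'. b \<in> B \<Longrightarrow> b' \<in> B \<Longrightarrow> q (d b) b' = (if b = b' then 1 else 0)"
    using insert.IH[OF ind(1)] insert.prems(2) by (metis subsetD)
  define s where "s = b - (\<Sum>b'\<in>B. sS (q (d b') b) b')"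
  have sumB: "(\<Sum>b'\<in>B. sS (q (d b') b) b') \<in> S.span B"
    by (intro S.span_sum S.span_scale S.span_base)
  have "s \<noteq> 0" using sumB ind(2) by (auto simp: s_def)
  moreover have "s \<in> S.span (insert b B)"
    unfolding s_def by (intro S.span_diff S.span_base subsetD[OF \<open>S.span B \<subseteq> _\<close> sumB]) simp
  ultimately obtain r where r: "r \<in> Q" "q r s \<noteq> 0" using insert.prems(2) by metis
  \<comment> \<open>Subtracting the multiples of the \<open>d b'\<close> makes the vector orthogonal
    to \<open>B\<close> and changes its value at \<open>b\<close> from \<open>q r b\<close> to
    \<open>q r s\<close>, whence the normalising factor.\<close>
  define r0 where "r0 = sR (inverse (q r s)) (r - (\<Sum>b'\<in>B. sR (q r b') (d b')))"
  have r0Q: "r0 \<in> Q" unfolding r0_def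
    using r(1) d(1) by (intro R.subspace_scale[OF Q] R.subspace_diff[OF Q] R.subspace_sum[OF Q]) auto
  have r0B: "q r0 b' = 0" if b': "b' \<in> B" for b'
  proof -
    have "(\<Sum>a\<in>B. q r a * q (d a) b') = (\<Sum>a\<in>B. if a = b' then q r a else 0)"
      by (intro sum.cong) (auto simp: d(2) b')
    then show ?thesis using insert.hyps(1) b' by (simp add: r0_def q')
  qed
  have r0b: "q r0 b = 1" using r(2)
    by (simp add: r0_def q' s_def mult.commute)
  show ?case
  proof (intro exI[of _ "\<lambda>x. if x = b then r0 else d x - sR (q (d x) b) r0"] conjI ballI)
    show "(if a = b then r0 else d a - sR (q (d a) b) r0) \<in> Q" if "a \<in> insert b B" for a
      using that r0Q d(1) by (auto intro: R.subspace_diff[OF Q] R.subspace_scale[OF Q])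
    show "q (if a = b then r0 else d a - sR (q (d a) b) r0) a' = (if a = a' then 1 else 0)"
      if "a \<in> insert b B" "a' \<in> insert b B" for a a'
      using that insert.hyps(2) by (auto simp: q' r0b r0B d(2))
  qed
qed

lemma left_moduleD:
  assumes "left_module sB M"
  shows "vspace M" "mact M \<in> bilin (full sB) M M" "m \<in> carrier M \<Longrightarrow> mact M 1 m = m"
    "m \<in> carrier M \<Longrightarrow> mact M (b * b') m = mact M b (mact M b' m)"
  using assms by (auto simp: left_module_def)

section \<open>Dual bases in bounded degree\<close>

context q_boson
begin

lemma q_below:
  "r \<in> grade R i \<Longrightarrow> s \<in> S.below n \<Longrightarrow> n \<le> i \<Longrightarrow> q r s = 0"
  "r \<in> R.below n \<Longrightarrow> s \<in> grade S i \<Longrightarrow> n \<le> i \<Longrightarrow> q r s = 0"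
proof -
  show "q r s = 0" if r: "r \<in> grade R i" and s: "s \<in> S.below n" and n: "n \<le> i"
  proof -
    have "q r (S.pr m s) = 0" for m
      using q_orthogonal[OF r S.pr_decomposition(1), of m s] s n by (cases "m = i") (auto simp: S.below_def q)
    then have "q r (\<Sum>m | S.pr m s \<noteq> 0. S.pr m s) = 0" by (simp add: q(10))
    then show ?thesis unfolding S.pr_decomposition(3) .
  qed
  show "q r s = 0" if r: "r \<in> R.below n" and s: "s \<in> grade S i" and n: "n \<le> i"
  proof -
    have "q (R.pr m r) s = 0" for m
      using q_orthogonal[OF R.pr_decomposition(1) s, of m r] r n by (cases "m = i") (auto simp: R.below_def q)
    then have "q (\<Sum>m | R.pr m r \<noteq> 0. R.pr m r) s = 0" by (simp add: q(9))
    then show ?thesis unfolding R.pr_decomposition(3) .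
  qed
qed

text \<open>Components of \<open>r\<close> in degrees \<open>n\<close> and above are orthogonal to
  \<open>s\<close>, so testing against \<open>R.below n\<close> is as good as testing against all of
  \<open>R\<close>.\<close>

lemma right_nondegenerate_below:
  assumes s: "s \<in> S.below n" and 0: "\<And>r. r \<in> R.below n \<Longrightarrow> q r s = 0"
  shows "s = 0"
proof -
  have "q r s = 0" for r
  proof (induction r rule: R.hom_induct)
    case (hom i r)
    then show ?case using R.G_subset_below[of i n] 0 q_below(1)[OF hom s] by (cases "i < n") auto
  qed (simp add: q)
  moreover have "bilinear_map (yscale S) (yscale R) (*) (\<lambda>s r. q r s)"
    using bilinear_q by (simp add: bilinear_map_def)
  ultimately show ?thesis
    using graded_radical_below[OF S(3) R(3) _ q_orthogonal[OF _ _ not_sym] right_nondegenerate_hom s] by auto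
qed

text \<open>Products of a finite spanning set of \<open>W\<close> with one of \<open>S(n)\<close>
  span \<open>S(n + 1)\<close>; here the finite dimension of \<open>W\<close> enters.\<close>

lemma finite_dim_grade_S: "\<exists>B. finite B \<and> B \<subseteq> grade S n \<and> grade S n \<subseteq> S.span B"
proof (induction n)
  case 0
  show ?case using S(13) S.span_scale[OF S.span_base[of 1 "{1}"]]
    by (intro exI[of _ "{1}"]) (auto simp: grade_S)
next
  case (Suc n)
  then obtain B where B: "finite B" "B \<subseteq> grade S n" "grade S n \<subseteq> S.span B" by blast
  obtain C where C: "finite C" "module.span (yscale W) C = UNIV" using fin_W by (auto simp: finite_dim_def)
  note \<iota> = pre_nicholsD(3)[OF pre_S]
  interpret \<iota>: Vector_Spaces.linear "yscale W" "yscale S" \<iota>W by (rule \<iota>)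
  have W: "grade S 1 = S.span (\<iota>W ` C)" using \<iota>.span_image[of C] C(2) by (simp add: grade_S)
  let ?D = "(\<lambda>(w, x). w * x) ` ((\<iota>W ` C) \<times> B)"
  have 1: "w * x \<in> S.span ?D" if w: "w \<in> grade S 1" and x: "x \<in> B" for w x
  proof -
    have "S.subspace {w. w * x \<in> S.span ?D}"
      using S.span_zero S.span_add S.span_scale by (auto simp: S.subspace_def distrib_right S(9))
    moreover have "\<iota>W ` C \<subseteq> {w. w * x \<in> S.span ?D}" using x by (auto intro!: S.span_base)
    ultimately have "S.span (\<iota>W ` C) \<subseteq> {w. w * x \<in> S.span ?D}" by (intro S.span_minimal)
    then show ?thesis using w W by auto
  qed
  have 2: "w * x \<in> S.span ?D" if w: "w \<in> grade S 1" and x: "x \<in> grade S n" for w x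
  proof -
    have "S.subspace {x. w * x \<in> S.span ?D}"
      using S.span_zero S.span_add S.span_scale by (auto simp: S.subspace_def distrib_left S(10))
    moreover have "B \<subseteq> {x. w * x \<in> S.span ?D}" using 1[OF w] by auto
    ultimately have "S.span B \<subseteq> {x. w * x \<in> S.span ?D}" by (intro S.span_minimal)
    then show ?thesis using x B(3) by auto
  qed
  have "grade S (Suc n) \<subseteq> S.span ?D"
    unfolding pre_nichols_grade_Suc[OF pre_S] using 2 by (intro S.span_minimal) auto
  moreover have "?D \<subseteq> grade S (Suc n)"
  proof
    fix y assume "y \<in> ?D"
    then obtain c x where "x \<in> B" "y = \<iota>W c * x" by auto
    then show "y \<in> grade S (Suc n)" using S(14)[of "\<iota>W c" 1 x n] B(2) by (auto simp: grade_S)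
  qed
  ultimately show ?case using B(1) C(1) by (intro exI[of _ ?D]) auto
qed

text \<open>Below degree \<open>n\<close> the algebra \<open>S\<close> is finite-dimensional, and
  the pairing with \<open>R.below n\<close> has no right radical there. A basis \<open>B\<close> of
  homogeneous elements therefore has a dual system in \<open>R.below n\<close>, which gives the
  coordinates of \<open>s\<close>.\<close>

lemma ex_dual_basis:
  obtains B d where "finite B" "\<And>b. b \<in> B \<Longrightarrow> d b \<in> R.below n"
    "\<And>s. s \<in> S.below n \<Longrightarrow> (\<Sum>b\<in>B. yscale S (q (d b) s) b) = s"
proof -
  obtain C where C: "\<And>n. finite (C n)" "\<And>n. C n \<subseteq> grade S n" "\<And>n. grade S n \<subseteq> S.span (C n)"
    using finite_dim_grade_S by metis
  let ?C = "\<Union>i<n. C i"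
  obtain B where B: "B \<subseteq> ?C" "S.independent B" "?C \<subseteq> S.span B"
    using S.maximal_independent_subset by blast
  have fin: "finite B" using B(1) C(1) by (auto intro: finite_subset[of B ?C])
  have "C i \<subseteq> S.below n" if "i < n" for i using C(2) S.G_subset_below[OF that] by blast
  then have "?C \<subseteq> S.below n" by (intro UN_least) simp
  then have spanB: "S.span B \<subseteq> S.below n" using B(1) by (intro S.span_minimal S.subspace_below) simp
  have "\<exists>d. (\<forall>b\<in>B. d b \<in> R.below n) \<and> (\<forall>b\<in>B. \<forall>b'\<in>B. q (d b) b' = (if b = b' then 1 else 0))"
    by (rule ex_dual_system[OF bilinear_q R.subspace_below fin B(2)])
       (rule right_nondegenerate_below[OF subsetD[OF spanB]])
  then obtain d where d: "\<And>b. b \<in> B \<Longrightarrow> d b \<in> R.below n"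
      "\<And>b b'. b \<in> B \<Longrightarrow> b' \<in> B \<Longrightarrow> q (d b) b' = (if b = b' then 1 else 0)"
    by blast
  have sub: "S.subspace {s. (\<Sum>b\<in>B. yscale S (q (d b) s) b) = s}"
  proof -
    have "(\<Sum>b\<in>B. yscale S (q (d b) (yscale S c s)) b) = yscale S c (\<Sum>b\<in>B. yscale S (q (d b) s) b)" for c s
      by (simp add: q S.scale_sum_right)
    then show ?thesis by (auto simp: S.subspace_def q(3,6) S.scale_left_distrib sum.distrib)
  qed
  have "(\<Sum>b\<in>B. yscale S (q (d b) b') b) = b'" if b': "b' \<in> B" for b'
  proof -
    have "(\<Sum>b\<in>B. yscale S (q (d b) b') b) = (\<Sum>b\<in>B. if b = b' then b else 0)"
      by (intro sum.cong) (auto simp: d(2) b')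
    then show ?thesis using fin b' by simp
  qed
  then have sp: "S.span B \<subseteq> {s. (\<Sum>b\<in>B. yscale S (q (d b) s) b) = s}"
    by (intro S.span_minimal[OF _ sub]) auto
  show thesis
  proof (rule that[OF fin d(1)])
    fix s assume s: "s \<in> S.below n"
    have "S.pr i s \<in> S.span B" for i
    proof (cases "i < n")
      case True
      have "C i \<subseteq> S.span B" using B(3) True by auto
      then have "S.span (C i) \<subseteq> S.span B" by (intro S.span_minimal S.subspace_span)
      then show ?thesis using C(3)[of i] S.pr_decomposition(1)[of i s] by auto
    next
      case False
      then show ?thesis using s S.span_zero by (simp add: S.below_def)
    qed
    then have "(\<Sum>i | S.pr i s \<noteq> 0. S.pr i s) \<in> S.span B" by (intro S.span_sum)
    then show "(\<Sum>b\<in>B. yscale S (q (d b) s) b) = s" using sp unfolding S.pr_decomposition(3) by blast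
  qed
qed

section \<open>Modules over the q-boson algebra and their invariants\<close>

lemma vector_space_sB: "vector_space sB"
  using tensor_product_full(4)[OF tensors(3)] .

lemma bilin_mact:
  assumes "left_module sB M"
  shows "m \<in> carrier M \<Longrightarrow> mact M b m \<in> carrier M"
    "m \<in> carrier M \<Longrightarrow> mact M (b + b') m = add M (mact M b m) (mact M b' m)"
    "m \<in> carrier M \<Longrightarrow> mact M (sB c b) m = smul M c (mact M b m)"
    "m \<in> carrier M \<Longrightarrow> m' \<in> carrier M \<Longrightarrow> mact M b (add M m m') = add M (mact M b m) (mact M b m')"
    "m \<in> carrier M \<Longrightarrow> mact M b (smul M c m) = smul M c (mact M b m)"
    "mact M b (zero M) = zero M" "m \<in> carrier M \<Longrightarrow> mact M 0 m = zero M"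
proof -
  note M = left_moduleD[OF assms]
  have B: "vspace (full sB)" by (simp add: vspace_full vector_space_sB)
  note bl = bilin_simps[OF M(2) B M(1), simplified]
  show "m \<in> carrier M \<Longrightarrow> mact M b m \<in> carrier M"
    "m \<in> carrier M \<Longrightarrow> mact M (b + b') m = add M (mact M b m) (mact M b' m)"
    and s: "m \<in> carrier M \<Longrightarrow> mact M (sB c b) m = smul M c (mact M b m)" for m b b' c
    by (simp_all add: bl)
  show "m \<in> carrier M \<Longrightarrow> m' \<in> carrier M \<Longrightarrow> mact M b (add M m m') = add M (mact M b m) (mact M b m')"
    and s': "m \<in> carrier M \<Longrightarrow> mact M b (smul M c m) = smul M c (mact M b m)" for m m' b c
    by (simp_all add: bl)
  show "mact M b (zero M) = zero M"
    using s'[of "zero M" b 0] vspace_smul_0[OF M(1)] vspaceD(1)[OF M(1)] bl(1) by simp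
  interpret B: vector_space sB by (rule vector_space_sB)
  show "m \<in> carrier M \<Longrightarrow> mact M 0 m = zero M"
    using s[of m 0 0] vspace_smul_0[OF M(1)] bl(1) by simp
qed

abbreviation sact :: "('k, 'b, 'u) bmod \<Rightarrow> 's \<Rightarrow> 'u \<Rightarrow> 'u" where
  "sact M s m \<equiv> mact M (tB 1 s) m"

abbreviation ract :: "('k, 'b, 'u) bmod \<Rightarrow> 'r \<Rightarrow> 'u \<Rightarrow> 'u" where
  "ract M r m \<equiv> mact M (tB r 1) m"

lemma sact:
  assumes "left_module sB M" "m \<in> carrier M"
  shows "sact M (s + s') m = add M (sact M s m) (sact M s' m)"
    "sact M (yscale S c s) m = smul M c (sact M s m)" "sact M 0 m = zero M"
    "sact M (s * s') m = sact M s (sact M s' m)" "sact M 1 m = m"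
  using bilin_mact[OF assms(1)] left_moduleD[OF assms(1)] assms(2)
  by (simp_all add: tB tB_S[symmetric] tB_1)

text \<open>Since \<open>S(k + 1)\<close> is spanned by \<open>S(1) S(k)\<close>, the additional
  factor acts last, on an element already in the submodule \<open>U\<close>. Taking \<open>U\<close>
  to be zero gives eventual vanishing; taking it to be the image of \<open>mu M\<close> serves the
  surjectivity proof.\<close>

lemma sact_stable:
  assumes M: "left_module sB M" and U: "subspace_of M U" "\<And>b m. m \<in> U \<Longrightarrow> mact M b m \<in> U"
    and m: "m \<in> carrier M" and n: "\<And>s. s \<in> grade S n \<Longrightarrow> sact M s m \<in> U"
    and "n \<le> k" "s \<in> grade S k"
  shows "sact M s m \<in> U"
  using assms(6,7)
proof (induction k arbitrary: s rule: dec_induct)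
  case base
  then show ?case by (rule n)
next
  case (step k)
  note UD = subspace_ofD[OF U(1)]
  have sub: "S.subspace {s. sact M s m \<in> U}"
    using UD by (auto simp: S.subspace_def sact[OF M m])
  have "w * x \<in> {s. sact M s m \<in> U}" if "x \<in> grade S k" for w x
    using step.IH[OF that] U(2) by (simp add: sact[OF M m])
  then have "grade S (Suc k) \<subseteq> {s. sact M s m \<in> U}"
    unfolding pre_nichols_grade_Suc[OF pre_S] by (intro S.span_minimal[OF _ sub]) auto
  then show ?case using step.prems by auto
qed

lemma subspace_zero: "vspace M \<Longrightarrow> subspace_of M {zero M}"
  by (auto simp: subspace_of_def vspaceD vspace_smul_0)

lemma integrable_eventually:
  assumes M: "left_module sB M" and "integrable S tB M" and m: "m \<in> carrier M"
  obtains n where "n > 0" "\<And>k s. n \<le> k \<Longrightarrow> s \<in> grade S k \<Longrightarrow> sact M s m = zero M"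
proof -
  obtain n where n: "n > 0" "\<And>s. s \<in> grade S n \<Longrightarrow> sact M s m = zero M"
    using assms(2) m by (auto simp: integrable_def)
  have "sact M s m \<in> {zero M}" if "n \<le> k" "s \<in> grade S k" for k s
    by (rule sact_stable[OF M subspace_zero[OF left_moduleD(1)[OF M]] _ m _ that])
       (use n(2) bilin_mact(6)[OF M] in auto)
  then show thesis using that n(1) by blast
qed

lemma invariants_simps [simp]:
  "add (invariants S tB M) = add M" "zero (invariants S tB M) = zero M" "smul (invariants S tB M) = smul M"
  by (simp_all add: invariants_def)

lemma carrier_invariants:
  "m \<in> carrier (invariants S tB M) \<longleftrightarrow> m \<in> carrier M \<and> (\<forall>s\<in>grade S 1. sact M s m = zero M)"
  by (auto simp: invariants_def)

lemma vspace_invariants: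
  assumes M: "left_module sB M" shows "vspace (invariants S tB M)"
proof -
  note v = left_moduleD(1)[OF M] and b = bilin_mact[OF M]
  note D = vspaceD[OF v] and Z = vspace_smul_0[OF v]
  have c: "zero M \<in> carrier (invariants S tB M)"
    "m \<in> carrier (invariants S tB M) \<Longrightarrow> m' \<in> carrier (invariants S tB M) \<Longrightarrow> add M m m' \<in> carrier (invariants S tB M)"
    "m \<in> carrier (invariants S tB M) \<Longrightarrow> smul M c m \<in> carrier (invariants S tB M)" for m m' c
    using D(1) by (auto simp: carrier_invariants D(2,7) b Z D(5))
  have ex: "\<exists>y\<in>carrier (invariants S tB M). add M m y = zero M" if m: "m \<in> carrier (invariants S tB M)" for m
  proof (rule bexI[OF _ c(3)[OF m, of "-1"]])
    show "add M m (smul M (- 1) m) = zero M"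
      using D(9)[of m 1 "-1"] m by (simp add: D(11) Z carrier_invariants)
  qed
  have mem: "m \<in> carrier M" if "m \<in> carrier (invariants S tB M)" for m using that by (simp add: carrier_invariants)
  show ?thesis
    unfolding vspace_def invariants_simps
    by (intro conjI ballI allI)
       (simp_all add: c mem ex D(2-5,7-11) Z vspace_lcomm[OF v])
qed

lemma invariants_sact:
  assumes M: "left_module sB M" and m: "m \<in> carrier (invariants S tB M)"
  shows "sact M s m = smul M (bcounit S s) m"
proof -
  note v = left_moduleD(1)[OF M]
  have mc: "m \<in> carrier M" using m by (simp add: carrier_invariants)
  show ?thesis
  proof (induction s rule: S.hom_induct)
    case (hom k s)
    show ?case
    proof (cases "k = 0")
      case True
      then obtain c where "s = yscale S c 1" using hom by (auto simp: grade_S)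
      then show ?thesis by (simp add: sact[OF M mc] linear_scaleD[OF S(6)] S(8))
    next
      case False
      have "sact M s m \<in> {zero M}"
        by (rule sact_stable[OF M subspace_zero[OF v] _ mc _ _ hom, of 1])
           (use False m bilin_mact(6)[OF M] in \<open>auto simp: carrier_invariants\<close>)
      then show ?thesis using False S(15)[OF _ hom] by (simp add: vspace_smul_0(1)[OF v mc])
    qed
  qed (simp add: sact[OF M mc] linear_addD[OF S(6)] vspaceD(9)[OF v mc])
qed

lemma act_1_counit: "act s 1 = yscale R (bcounit S s) 1"
  by (simp add: act_on_1 q_1)

text \<open>On invariants, \<open>\<B>\<close> acts through the quotient \<open>\<B> / \<B> S\<^sup>+ = R\<close>.\<close>

lemma invariants_mact:
  assumes M: "left_module sB M" and m: "m \<in> carrier (invariants S tB M)"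
  shows "mact M b m = ract M (\<rho> b 1) m"
proof -
  interpret tensor "full (yscale R)" "full (yscale S)" "full sB" tB by unfold_locales (rule tensors(3))
  have mc: "m \<in> carrier M" using m by (simp add: carrier_invariants)
  note b = bilin_mact[OF M]
  have "b \<in> carrier (full sB)" by simp
  then show ?thesis
  proof (induction b rule: tensor_induct)
    case (pure r s)
    have "mact M (tB r s) m = ract M r (sact M s m)"
      by (simp add: tB_RS[of r s, symmetric] left_moduleD(4)[OF M mc])
    also have "\<dots> = smul M (bcounit S s) (ract M r m)"
      by (simp add: invariants_sact[OF M m] b(5) mc)
    also have "\<dots> = ract M (yscale R (bcounit S s) r) m" by (simp add: tB b(3) mc)
    also have "yscale R (bcounit S s) r = \<rho> (tB r s) 1"
      by (simp add: tB_RS[of r s, symmetric] \<rho>_mult \<rho>_R act_def[symmetric] act_1_counit R(10))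
    finally show ?case .
  next
    case (add b b')
    then show ?case by (simp add: b mc \<rho> tB)
  qed
qed

end

section \<open>The modules \<open>R \<otimes> X\<close>\<close>

locale q_boson_tensor =
  q_boson J K \<tau>0 V W \<tau>1 R \<iota>V S \<iota>W A tA X tX \<tau> sB tB \<rho>
  for J :: "('k::field, 'j::ring_1) hopf"
    and K :: "('k, 'c::ring_1) hopf"
    and \<tau>0 :: "'j \<Rightarrow> 'c \<Rightarrow> 'k"
    and V :: "('k, 'j, 'v::ab_group_add) yd"
    and W :: "('k, 'c, 'w::ab_group_add) yd"
    and \<tau>1 :: "'v \<Rightarrow> 'w \<Rightarrow> 'k"
    and R :: "('k, 'j, 'r::ring_1) graded_yd_bialg" and \<iota>V :: "'v \<Rightarrow> 'r"
    and S :: "('k, 'c, 's::ring_1) graded_yd_bialg" and \<iota>W :: "'w \<Rightarrow> 's"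
    and A :: "('k, 'a::ring_1) hopf" and tA :: "'r \<Rightarrow> 'j \<Rightarrow> 'a"
    and X :: "('k, 'x::ring_1) hopf" and tX :: "'s \<Rightarrow> 'c \<Rightarrow> 'x"
    and \<tau> :: "'a \<Rightarrow> 'x \<Rightarrow> 'k"
    and sB :: "'k \<Rightarrow> 'b::ring_1 \<Rightarrow> 'b" and tB :: "'r \<Rightarrow> 's \<Rightarrow> 'b"
    and \<rho> :: "'b \<Rightarrow> 'r \<Rightarrow> 'r" +
  fixes P :: "('k, 'u) vs \<Rightarrow> ('k, 'u) vs" and p :: "('k, 'u) vs \<Rightarrow> 'r \<Rightarrow> 'u \<Rightarrow> 'u"
  assumes choice: "tensor_choice R P p"
begin

lemma tensorP: "vspace Y \<Longrightarrow> tensor (full (yscale R)) Y (P Y) (p Y)"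
  using choice by (simp add: tensor_choice_def tensor_def)

lemma vspace_P: "vspace Y \<Longrightarrow> vspace (P Y)"
  by (rule tensor.vspaces(3)[OF tensorP])

lemma p_simps:
  assumes "vspace Y" "y \<in> carrier Y"
  shows "p Y r y \<in> carrier (P Y)" "p Y (r + r') y = add (P Y) (p Y r y) (p Y r' y)"
    "p Y (yscale R c r) y = smul (P Y) c (p Y r y)"
    "y' \<in> carrier Y \<Longrightarrow> p Y r (add Y y y') = add (P Y) (p Y r y) (p Y r y')"
    "p Y r (smul Y c y) = smul (P Y) c (p Y r y)"
    "p Y 0 y = zero (P Y)" "p Y r (zero Y) = zero (P Y)"
proof -
  interpret tensor "full (yscale R)" Y "P Y" "p Y" by (rule tensorP[OF assms(1)])
  note t' = t[simplified]
  show "p Y r y \<in> carrier (P Y)" "p Y (r + r') y = add (P Y) (p Y r y) (p Y r' y)"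
    "p Y (yscale R c r) y = smul (P Y) c (p Y r y)"
    "y' \<in> carrier Y \<Longrightarrow> p Y r (add Y y y') = add (P Y) (p Y r y) (p Y r y')"
    "p Y r (smul Y c y) = smul (P Y) c (p Y r y)"
    using assms by (simp_all add: t')
  show "p Y 0 y = zero (P Y)"
    using t'(3)[OF assms(2), of 0 0] t'(1)[OF assms(2), of 0] by (simp add: vspace_smul_0[OF vspaces(3)])
  show "p Y r (zero Y) = zero (P Y)"
    using t'(5)[OF vspaceD(1)[OF assms(1)], of r 0] t'(1)[OF vspaceD(1)[OF assms(1)], of r]
    by (simp add: vspace_smul_0[OF vspaces(3)] vspace_smul_0[OF assms(1)])
qed

lemma P_induct [consumes 2, case_names pure add]:
  assumes "vspace Y" "m \<in> carrier (P Y)" "\<And>r y. y \<in> carrier Y \<Longrightarrow> Q (p Y r y)"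
    "\<And>m m'. m \<in> carrier (P Y) \<Longrightarrow> m' \<in> carrier (P Y) \<Longrightarrow> Q m \<Longrightarrow> Q m' \<Longrightarrow> Q (add (P Y) m m')"
  shows "Q m"
  using assms(2) by (rule tensor.tensor_induct[OF tensorP[OF assms(1)]]) (use assms(3,4) in auto)

lemma P_lin_eqI:
  assumes "vspace Y" "f \<in> lin (P Y) Z" "g \<in> lin (P Y) Z"
    "\<And>r y. y \<in> carrier Y \<Longrightarrow> f (p Y r y) = g (p Y r y)"
  shows "f = g"
  using assms(2,3) by (rule tensor.lin_eqI[OF tensorP[OF assms(1)]]) (use assms(4) in auto)

lemma induced:
  assumes Y: "vspace Y" and Z: "vspace Z" and F: "F \<in> bilin (full (yscale R)) Y Z"
  shows "induced P p Y Z F \<in> lin (P Y) Z" "y \<in> carrier Y \<Longrightarrow> induced P p Y Z F (p Y r y) = F r y"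
proof -
  interpret tensor "full (yscale R)" Y "P Y" "p Y" by (rule tensorP[OF Y])
  let ?Q = "\<lambda>\<phi>. \<phi> \<in> lin (P Y) Z \<and> (\<forall>r. \<forall>y\<in>carrier Y. \<phi> (p Y r y) = F r y)"
  obtain \<phi> where \<phi>: "\<phi> \<in> lin (P Y) Z" "\<And>r y. r \<in> carrier (full (yscale R)) \<Longrightarrow> y \<in> carrier Y \<Longrightarrow> \<phi> (p Y r y) = F r y"
    by (rule ex_lift[OF Z F]) blast
  have "\<exists>!\<phi>. ?Q \<phi>"
  proof (rule ex1I)
    show "?Q \<phi>" using \<phi> by simp
    show "\<phi>' = \<phi>" if "?Q \<phi>'" for \<phi>'
      using that \<phi> by (intro lin_eqI[of \<phi>' Z \<phi>]) auto
  qed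
  then have "?Q (induced P p Y Z F)" unfolding induced_def by (rule theI')
  then show "induced P p Y Z F \<in> lin (P Y) Z" "y \<in> carrier Y \<Longrightarrow> induced P p Y Z F (p Y r y) = F r y"
    by auto
qed

lemma vspace_R: "vspace (full (yscale R))"
  by (simp add: vspace_full R(2))

abbreviation RT :: "('k, 'u) vs \<Rightarrow> ('k, 'b, 'u) bmod" where
  "RT \<equiv> fob (tensor_functor P p \<rho>)"

lemma RT_simps [simp]:
  "carrier (RT Y) = carrier (P Y)" "add (RT Y) = add (P Y)" "zero (RT Y) = zero (P Y)"
  "smul (RT Y) = smul (P Y)"
  by (simp_all add: tensor_functor_def)

lemma lin_RT [simp]: "lin (RT Y) Z = lin (P Y) Z" "lin Z' (RT Y) = lin Z' (P Y)"
  by (simp_all add: lin_def)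

lemma vspace_RT [simp]: "vspace (RT Y) = vspace (P Y)"
  by (simp add: vspace_def)

lemma mact_RT:
  assumes Y: "vspace Y"
  shows "mact (RT Y) b \<in> lin (P Y) (P Y)" "y \<in> carrier Y \<Longrightarrow> mact (RT Y) b (p Y r y) = p Y (\<rho> b r) y"
proof -
  have F: "(\<lambda>r y. p Y (\<rho> b r) y) \<in> bilin (full (yscale R)) Y (P Y)"
    by (rule bilinI[OF vspace_R Y]) (auto simp: p_simps[OF Y] \<rho>)
  have "mact (RT Y) b = induced P p Y (P Y) (\<lambda>r y. p Y (\<rho> b r) y)"
    by (simp add: tensor_functor_def)
  then show "mact (RT Y) b \<in> lin (P Y) (P Y)" "y \<in> carrier Y \<Longrightarrow> mact (RT Y) b (p Y r y) = p Y (\<rho> b r) y"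
    using induced[OF Y vspace_P[OF Y] F] by auto
qed

lemma RT_module:
  assumes Y: "vspace Y" shows "left_module sB (RT Y)"
proof -
  note P = vspace_P[OF Y]
  note D = vspaceD[OF P]
  note mc = linD(1-3)[OF mact_RT(1)[OF Y]] and mp = mact_RT(2)[OF Y]
  note ac = D(2,3,4) vspace_lcomm[OF P]
  have add: "mact (RT Y) (b + b') m = add (P Y) (mact (RT Y) b m) (mact (RT Y) b' m)"
    if "m \<in> carrier (P Y)" for b b' m
    using Y that by (induction rule: P_induct) (simp_all add: mp \<rho> p_simps[OF Y] mc ac)
  have smul: "mact (RT Y) (sB c b) m = smul (P Y) c (mact (RT Y) b m)"
    if "m \<in> carrier (P Y)" for c b m
    using Y that by (induction rule: P_induct) (simp_all add: mp \<rho> p_simps[OF Y] mc D(8))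
  have one: "mact (RT Y) 1 m = m" if "m \<in> carrier (P Y)" for m
    using Y that by (induction rule: P_induct) (simp_all add: mp \<rho>_1 mc)
  have mult: "mact (RT Y) (b * b') m = mact (RT Y) b (mact (RT Y) b' m)" if "m \<in> carrier (P Y)" for b b' m
    using Y that by (induction rule: P_induct) (simp_all add: mp \<rho>_mult mc)
  have "mact (RT Y) \<in> bilin (full sB) (RT Y) (RT Y)"
    by (rule bilinI) (auto simp: P mc add smul vspace_full vector_space_sB)
  then show ?thesis by (simp add: left_module_def P one mult)
qed

lemma sact_p: "vspace Y \<Longrightarrow> y \<in> carrier Y \<Longrightarrow> sact (RT Y) s (p Y r y) = p Y (act s r) y"
  by (simp add: mact_RT(2) act_def)

lemma RT_integrable:
  assumes Y: "vspace Y" shows "integrable S tB (RT Y)"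
proof -
  \<comment> \<open>Vanishing is required for all \<open>k \<ge> n\<close>, so that in the additive
    cases the maximum of two bounds works.\<close>
  have "\<exists>n>0. \<forall>k\<ge>n. \<forall>s\<in>grade S k. sact (RT Y) s m = zero (P Y)" if "m \<in> carrier (P Y)" for m
    using Y that
  proof (induction rule: P_induct)
    case (pure r y)
    have "\<exists>n>0. \<forall>k\<ge>n. \<forall>s\<in>grade S k. act s r = 0"
    proof (induction r rule: R.hom_induct)
      case (hom n r)
      have "\<forall>k\<ge>Suc n. \<forall>s\<in>grade S k. act s r = 0"
        using act_grade(2)[OF _ hom] by auto
      then show ?case by blast
    next
      case (add r r')
      then obtain n n' where "n > 0" "n' > 0" "\<forall>k\<ge>n. \<forall>s\<in>grade S k. act s r = 0" "\<forall>k\<ge>n'. \<forall>s\<in>grade S k. act s r' = 0"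
        by blast
      then show ?case by (intro exI[of _ "max n n'"]) (auto simp: act)
    qed
    then show ?case using Y pure by (auto simp: sact_p p_simps)
  next
    case (add m m')
    then obtain n n' where "n > 0" "n' > 0" "\<forall>k\<ge>n. \<forall>s\<in>grade S k. sact (RT Y) s m = zero (P Y)"
      "\<forall>k\<ge>n'. \<forall>s\<in>grade S k. sact (RT Y) s m' = zero (P Y)" by blast
    then show ?case using add(1,2) vspaceD(1,5)[OF vspace_P[OF Y]]
      by (intro exI[of _ "max n n'"]) (auto simp: linD(2)[OF mact_RT(1)[OF Y]])
  qed
  then show ?thesis unfolding integrable_def RT_simps by (meson order_refl)
qed

definition counit :: "('k, 'u) vs \<Rightarrow> 'u \<Rightarrow> 'u" where
  "counit Y = induced P p Y Y (\<lambda>r y. smul Y (bcounit R r) y)"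

lemma counit:
  assumes Y: "vspace Y"
  shows "counit Y \<in> lin (P Y) Y" "y \<in> carrier Y \<Longrightarrow> counit Y (p Y r y) = smul Y (bcounit R r) y"
proof -
  note D = vspaceD[OF Y]
  have "(\<lambda>r y. smul Y (bcounit R r) y) \<in> bilin (full (yscale R)) Y Y"
    by (rule bilinI[OF vspace_R Y])
       (auto simp: D linear_addD[OF R(6)] linear_scaleD[OF R(6)] mult.commute simp flip: D(10))
  from induced[OF Y Y this]
  show "counit Y \<in> lin (P Y) Y" "y \<in> carrier Y \<Longrightarrow> counit Y (p Y r y) = smul Y (bcounit R r) y"
    by (simp_all add: counit_def)
qed

text \<open>This embeds \<open>R \<otimes> Y\<close> into the linear maps from \<open>S\<close> to
  \<open>Y\<close>. A form \<open>\<psi>\<close> on \<open>Y\<close> induces a contraction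
  \<open>\<psi>'\<close> to \<open>R\<close>, and \<open>q (\<psi>' m) s\<close> is
  \<open>\<psi>\<close> of the tested value. Left non-degeneracy gives \<open>\<psi>' m = 0\<close>,
  and then every contraction of \<open>m\<close> with a form on \<open>R\<close> vanishes.\<close>

lemma RT_eq_zeroI:
  assumes Y: "vspace Y" and m: "m \<in> carrier (P Y)"
    and zero: "\<And>s. counit Y (sact (RT Y) s m) = zero Y"
  shows "m = zero (P Y)"
proof -
  interpret tensor "full (yscale R)" Y "P Y" "p Y" by (rule tensorP[OF Y])
  note mr = linD(1-3)[OF mact_RT(1)[OF Y]] and cu = linD(1-3)[OF counit(1)[OF Y]]
  show ?thesis
  proof (rule tensor_eq_zeroI[OF tensor m])
    fix \<alpha> \<phi> assume \<alpha>: "linear_form (yscale R) \<alpha>" and \<phi>: "\<phi> \<in> lin (P Y) Y"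
      "\<And>r y. y \<in> carrier Y \<Longrightarrow> \<phi> (p Y r y) = smul Y (\<alpha> r) y"
    show "\<phi> m = zero Y"
    proof (rule forms_separate[OF Y linD(1)[OF \<phi>(1) m] vspaceD(1)[OF Y]])
      fix \<psi> assume \<psi>: "\<psi> \<in> forms Y"
      have "(\<lambda>r y. yscale R (\<psi> y) r) \<in> bilin (full (yscale R)) Y (full (yscale R))"
        by (rule bilinI[OF vspace_R Y])
           (auto simp: formD[OF \<psi>] R.scale_right_distrib R.scale_left_distrib mult.commute)
      then obtain \<psi>' where \<psi>': "\<psi>' \<in> lin (P Y) (full (yscale R))"
        "\<And>r y. r \<in> carrier (full (yscale R)) \<Longrightarrow> y \<in> carrier Y \<Longrightarrow> \<psi>' (p Y r y) = yscale R (\<psi> y) r"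
        by (rule ex_lift[OF vspace_R]) blast
      have a: "\<psi> (\<phi> n) = \<alpha> (\<psi>' n)" if "n \<in> carrier (P Y)" for n
        using Y that
      proof (induction rule: P_induct)
        case (pure r y)
        then show ?case by (simp add: \<phi>(2) \<psi>'(2) formD[OF \<psi>] linear_scaleD[OF \<alpha>])
      next
        case (add n n')
        then show ?case
          using linD(1-3)[OF \<phi>(1)] linD(1-3)[OF \<psi>'(1)] by (simp add: formD[OF \<psi>] linear_addD[OF \<alpha>])
      qed
      have b: "\<psi> (counit Y (sact (RT Y) s n)) = q (\<psi>' n) s" if "n \<in> carrier (P Y)" for n s
        using Y that
      proof (induction rule: P_induct)
        case (pure r y)
        then show ?case by (simp add: sact_p[OF Y] counit(2)[OF Y] \<psi>'(2) formD[OF \<psi>] q q_eq_counit[symmetric] mult.commute)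
      next
        case (add n n')
        then show ?case using linD(1-3)[OF \<psi>'(1)] by (simp add: mr cu formD[OF \<psi>] q)
      qed
      have "\<psi>' m = 0"
        by (rule left_nondegenerate) (simp add: b[OF m, symmetric] zero form_zero[OF Y \<psi>])
      then show "\<psi> (\<phi> m) = \<psi> (zero Y)" by (simp add: a[OF m] linear_0D[OF \<alpha>] form_zero[OF Y \<psi>])
    qed
  qed
qed

lemma RT_eqI:
  assumes Y: "vspace Y" and m: "m \<in> carrier (P Y)" "m' \<in> carrier (P Y)"
    and eq: "\<And>s. counit Y (sact (RT Y) s m) = counit Y (sact (RT Y) s m')"
  shows "m = m'"
proof -
  note D = vspaceD[OF vspace_P[OF Y]]
  note mr = linD(1-3)[OF mact_RT(1)[OF Y]] and cu = linD(1-3)[OF counit(1)[OF Y]]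
  have "add (P Y) m (smul (P Y) (-1) m') = zero (P Y)"
    by (rule RT_eq_zeroI[OF Y]) (simp_all add: m D(2,7) mr cu eq vspace_neg[OF Y])
  then show ?thesis by (rule vspace_eqI[OF vspace_P[OF Y] m])
qed

lemma p_1_invariant: "vspace Y \<Longrightarrow> y \<in> carrier Y \<Longrightarrow> p Y 1 y \<in> carrier (invariants S tB (RT Y))"
  using S(15)[of 1] by (auto simp: carrier_invariants p_simps sact_p act_1_counit)

lemma counit_p_1: "vspace Y \<Longrightarrow> y \<in> carrier Y \<Longrightarrow> counit Y (p Y 1 y) = y"
  by (simp add: counit R(8) vspaceD(11))

text \<open>On invariants \<open>s\<close> acts by the scalar \<open>bcounit S s\<close>, so
  \<open>m\<close> and \<open>p Y 1 (counit Y m)\<close> give the same function of \<open>s\<close>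
  in \<open>RT_eqI\<close>.\<close>

lemma RT_invariant:
  assumes Y: "vspace Y" and m: "m \<in> carrier (invariants S tB (RT Y))"
  shows "m = p Y 1 (counit Y m)"
proof -
  have mc: "m \<in> carrier (P Y)" using m by (simp add: carrier_invariants)
  have c: "counit Y m \<in> carrier Y" using linD(1)[OF counit(1)[OF Y] mc] .
  note i = invariants_sact[OF RT_module[OF Y]]
  show ?thesis
  proof (rule RT_eqI[OF Y mc p_simps(1)[OF Y c]])
    fix s
    have "counit Y (sact (RT Y) s m) = smul Y (bcounit S s) (counit Y m)"
      by (simp add: i[OF m] linD(3)[OF counit(1)[OF Y] mc])
    also have "\<dots> = counit Y (sact (RT Y) s (p Y 1 (counit Y m)))"
      by (simp add: i[OF p_1_invariant[OF Y c]] linD(3)[OF counit(1)[OF Y] p_simps(1)[OF Y c]] counit_p_1[OF Y c])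
    finally show "counit Y (sact (RT Y) s m) = counit Y (sact (RT Y) s (p Y 1 (counit Y m)))" .
  qed
qed

section \<open>The map \<open>R \<otimes> M\<^sub>0 \<rightarrow> M\<close>\<close>

text \<open>The target of \<open>induced\<close> has type \<open>('k, 'u) vs\<close>, whereas
  \<open>M\<close> is a module record; hence a separate choice of the same kind of map.\<close>

definition mu :: "('k, 'b, 'u) bmod \<Rightarrow> 'u \<Rightarrow> 'u" where
  "mu M = (SOME \<phi>. \<phi> \<in> lin (P (invariants S tB M)) M \<and>
     (\<forall>r. \<forall>y\<in>carrier (invariants S tB M). \<phi> (p (invariants S tB M) r y) = ract M r y))"

lemma mu:
  assumes M: "left_module sB M"
  shows "mu M \<in> lin (P (invariants S tB M)) M"
    "y \<in> carrier (invariants S tB M) \<Longrightarrow> mu M (p (invariants S tB M) r y) = ract M r y"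
proof -
  let ?Y = "invariants S tB M"
  note Y = vspace_invariants[OF M] and b = bilin_mact[OF M]
  interpret tensor "full (yscale R)" ?Y "P ?Y" "p ?Y" by (rule tensorP[OF Y])
  have "(\<lambda>r y. ract M r y) \<in> bilin (full (yscale R)) ?Y M"
    by (rule bilinI[OF vspace_R Y]) (auto simp: carrier_invariants b tB)
  from ex_lift[OF left_moduleD(1)[OF M] this]
  have "\<exists>\<phi>. \<phi> \<in> lin (P ?Y) M \<and> (\<forall>r. \<forall>y\<in>carrier ?Y. \<phi> (p ?Y r y) = ract M r y)"
    by (metis UNIV_I carrier_full)
  then have "mu M \<in> lin (P ?Y) M \<and> (\<forall>r. \<forall>y\<in>carrier ?Y. mu M (p ?Y r y) = ract M r y)"
    unfolding mu_def by (rule someI_ex)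
  then show "mu M \<in> lin (P ?Y) M" "y \<in> carrier ?Y \<Longrightarrow> mu M (p ?Y r y) = ract M r y" by auto
qed

text \<open>On pure tensors, \<open>b\<close> applied to \<open>r y\<close> is the product of
  \<open>b\<close> with \<open>r\<close> applied to the invariant \<open>y\<close>, and
  \<open>invariants_mact\<close> replaces this product by its value at \<open>1 \<in> R\<close>,
  which is \<open>\<rho> b r\<close>.\<close>

lemma mu_mact:
  assumes M: "left_module sB M" and m: "m \<in> carrier (P (invariants S tB M))"
  shows "mu M (mact (RT (invariants S tB M)) b m) = mact M b (mu M m)"
proof -
  let ?Y = "invariants S tB M"
  note Y = vspace_invariants[OF M]
  show ?thesis using Y m
  proof (induction rule: P_induct)
    case (pure r y)
    then have "y \<in> carrier M" by (simp add: carrier_invariants)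
    have "mact M b (ract M r y) = mact M (b * tB r 1) y"
      by (simp add: left_moduleD(4)[OF M \<open>y \<in> carrier M\<close>])
    also have "\<dots> = ract M (\<rho> b r) y"
      by (subst invariants_mact[OF M pure]) (simp add: \<rho>_mult \<rho>_R)
    finally show ?case by (simp add: mact_RT(2)[OF Y pure] mu(2)[OF M pure])
  next
    case (add m m')
    note ml = linD(1-3)[OF mact_RT(1)[OF Y]] and ul = linD(1-3)[OF mu(1)[OF M]]
    show ?case using add by (simp add: ml ul bilin_mact[OF M])
  qed
qed

lemma mu_p_1:
  "left_module sB M \<Longrightarrow> y \<in> carrier (invariants S tB M) \<Longrightarrow> mu M (p (invariants S tB M) 1 y) = y"
  by (simp add: mu(2) tB_1 left_moduleD(3) carrier_invariants)

lemma mu_inj: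
  assumes M: "left_module sB M"
  shows "inj_on (mu M) (carrier (P (invariants S tB M)))"
proof (rule inj_onI)
  let ?Y = "invariants S tB M"
  note Y = vspace_invariants[OF M]
  note P = vspace_P[OF Y] and v = left_moduleD(1)[OF M]
  note ul = linD(1-3)[OF mu(1)[OF M]] and RM = RT_module[OF Y]
  have kernel: "m = zero (P ?Y)" if m: "m \<in> carrier (P ?Y)" and mu0: "mu M m = zero M" for m
  proof (rule ccontr)
    assume "m \<noteq> zero (P ?Y)"
    \<comment> \<open>With \<open>n = Suc k\<close> minimal, some \<open>s\<close> in
      \<open>S(k)\<close> moves \<open>m\<close> to a non-zero element, and \<open>S(1)\<close>
      kills it because \<open>S(1) S(k)\<close> lies in \<open>S(n)\<close>.\<close>
    let ?Q = "\<lambda>n. \<forall>s\<in>grade S n. sact (RT ?Y) s m = zero (P ?Y)"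
    have "\<exists>n. ?Q n" using RT_integrable[OF Y] m unfolding integrable_def RT_simps by blast
    then obtain n where Q: "?Q n" and min: "\<And>k. k < n \<Longrightarrow> \<not> ?Q k"
      using exists_least_iff[of ?Q] by blast
    have "n \<noteq> 0"
    proof
      assume "n = 0"
      then have "sact (RT ?Y) 1 m = zero (P ?Y)" using bspec[OF Q, of 1] S(13) by simp
      then show False using sact(5)[OF RM, of m] m \<open>m \<noteq> zero (P ?Y)\<close> by simp
    qed
    then obtain k where k: "n = Suc k" using not0_implies_Suc by blast
    have "\<not> ?Q k" by (rule min) (simp add: k)
    then obtain s where s: "s \<in> grade S k" "sact (RT ?Y) s m \<noteq> zero (P ?Y)" by blast
    let ?y = "sact (RT ?Y) s m"
    have yc: "?y \<in> carrier (P ?Y)" using linD(1)[OF mact_RT(1)[OF Y] m] .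
    have "sact (RT ?Y) w ?y = zero (P ?Y)" if "w \<in> grade S 1" for w
      using sact(4)[OF RM, of m w s] m bspec[OF Q, of "w * s"] S(14)[OF that s(1)] by (simp add: k)
    then have yi: "?y \<in> carrier (invariants S tB (RT ?Y))" using yc by (simp add: carrier_invariants)
    note e = RT_invariant[OF Y yi]
    have c: "counit ?Y ?y \<in> carrier ?Y" using linD(1)[OF counit(1)[OF Y] yc] .
    \<comment> \<open>The element \<open>?y\<close> is the tensor of 1 with its counit, and
      \<open>mu M\<close> sends such a tensor back to its second factor.\<close>
    have "counit ?Y ?y = mu M ?y" using mu_p_1[OF M c] e by simp
    also have "\<dots> = zero M" by (simp add: mu_mact[OF M m] mu0 bilin_mact(6)[OF M])
    finally have "?y = p ?Y 1 (zero ?Y)" using e by simp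
    then show False using s(2) p_simps(7)[OF Y vspaceD(1)[OF Y]] by simp
  qed
  fix m m' assume m: "m \<in> carrier (P ?Y)" "m' \<in> carrier (P ?Y)" and eq: "mu M m = mu M m'"
  have "add (P ?Y) m (smul (P ?Y) (-1) m') = zero (P ?Y)"
    by (rule kernel) (simp_all add: m eq ul vspaceD(2,7)[OF P] vspace_neg[OF v])
  then show "m = m'" by (rule vspace_eqI[OF P m])
qed

end

section \<open>Surjectivity of \<open>mu M\<close> for integrable modules\<close>

context q_boson_tensor
begin

text \<open>If \<open>S\<^sup>+ y\<close> lies in the image of \<open>\<mu> : R \<otimes> M\<^sub>0 \<rightarrow> M\<close>, then \<open>s \<mapsto> (\<epsilon> \<otimes> id)(\<mu>\<^sup>-\<^sup>1(s y))\<close> vanishes in high degree,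
  hence is represented by some \<open>t \<in> R \<otimes> M\<^sub>0\<close>, as \<open>R\<close> is the graded dual of \<open>S\<close>. Then
  \<open>y - \<mu>(t)\<close> is invariant.\<close>

lemma mu_image_step:
  assumes M: "left_module sB M" and int: "integrable S tB M" and y: "y \<in> carrier M"
    and S1: "\<And>w. w \<in> grade S 1 \<Longrightarrow> sact M w y \<in> mu M ` carrier (P (invariants S tB M))"
  shows "y \<in> mu M ` carrier (P (invariants S tB M))"
proof -
  let ?Y = "invariants S tB M"
  define U where "U = mu M ` carrier (P ?Y)"
  note Y = vspace_invariants[OF M]
  note P = vspace_P[OF Y] and v = left_moduleD(1)[OF M] and RM = RT_module[OF Y]
  note D = vspaceD[OF v] and DP = vspaceD[OF P]
  note ul = linD(1-3)[OF mu(1)[OF M]] and cl = linD(1-3)[OF counit(1)[OF Y]]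
    and ml = linD(1-3)[OF mact_RT(1)[OF Y]]
  have u0: "mu M (zero (P ?Y)) = zero M" by (rule lin_zero[OF P v mu(1)[OF M]])
  have c0: "counit ?Y (zero (P ?Y)) = zero M" using lin_zero[OF P Y counit(1)[OF Y]] by simp
  have U: "subspace_of M U"
    unfolding subspace_of_def U_def
  proof (intro conjI ballI allI)
    show "mu M ` carrier (P ?Y) \<subseteq> carrier M" using ul(1) by auto
    show "zero M \<in> mu M ` carrier (P ?Y)" using u0 DP(1) by (metis imageI)
    fix a assume "a \<in> mu M ` carrier (P ?Y)"
    then obtain m where m: "m \<in> carrier (P ?Y)" "a = mu M m" by auto
    show "smul M c a \<in> mu M ` carrier (P ?Y)" for c
      using m DP(7) by (intro image_eqI[of _ _ "smul (P ?Y) c m"]) (simp_all add: ul)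
    fix b assume "b \<in> mu M ` carrier (P ?Y)"
    then obtain m' where m': "m' \<in> carrier (P ?Y)" "b = mu M m'" by auto
    show "add M a b \<in> mu M ` carrier (P ?Y)"
      using m m' DP(2) by (intro image_eqI[of _ _ "add (P ?Y) m m'"]) (simp_all add: ul)
  qed
  note UD = subspace_ofD[OF U]
  have stable: "mact M b a \<in> U" if "a \<in> U" for b a
    using that ml(1) unfolding U_def by (auto simp: mu_mact[OF M, symmetric])
  define f0 where "f0 a = inv_into (carrier (P ?Y)) (mu M) a" for a
  have f0: "f0 a \<in> carrier (P ?Y)" "mu M (f0 a) = a" if "a \<in> U" for a
    using that unfolding U_def f0_def by (auto intro: inv_into_into f_inv_into_f)
  have f0_mu: "f0 (mu M m) = m" if "m \<in> carrier (P ?Y)" for m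
    unfolding f0_def by (rule inv_into_f_f[OF mu_inj[OF M] that])
  have f0_add: "f0 (add M a b) = add (P ?Y) (f0 a) (f0 b)" if "a \<in> U" "b \<in> U" for a b
    using f0_mu[of "add (P ?Y) (f0 a) (f0 b)"] f0[OF that(1)] f0[OF that(2)] by (simp add: ul DP(2))
  have f0_smul: "f0 (smul M c a) = smul (P ?Y) c (f0 a)" if "a \<in> U" for c a
    using f0_mu[of "smul (P ?Y) c (f0 a)"] f0[OF that(1)] by (simp add: ul DP(7))
  have pos: "sact M s y \<in> U" if "s \<in> grade S k" "k > 0" for s k
    using sact_stable[OF M U stable y, of 1 k s] S1 that unfolding U_def by auto
  \<comment> \<open>The projection of \<open>S\<close> onto its positive part along the scalars.
    Only positive degrees are known to move \<open>y\<close> into \<open>U\<close>; composing with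
    \<open>aug\<close> gives a linear function \<open>g\<close> on all of \<open>S\<close>.\<close>
  define aug where "aug s = s - yscale S (bcounit S s) 1" for s
  note eps = linear_addD[OF S(6)] linear_scaleD[OF S(6)]
  have aug_pos: "aug s = s" if "s \<in> grade S k" "k > 0" for s k
    using S(15)[OF that(2,1)] by (simp add: aug_def)
  have aug_add: "aug (s + s') = aug s + aug s'" for s s'
    by (simp add: aug_def eps S.scale_left_distrib)
  have aug_smul: "aug (yscale S c s) = yscale S c (aug s)" for c s
    by (simp add: aug_def eps S.scale_right_diff_distrib)
  have augU: "sact M (aug s) y \<in> U" for s
  proof (induction s rule: S.hom_induct)
    case (hom k s)
    show ?case
    proof (cases "k = 0")
      case True
      then obtain c where "s = yscale S c 1" using hom by (auto simp: grade_S)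
      then have "aug s = 0" by (simp add: aug_def eps S(8))
      then show ?thesis by (simp add: sact(3)[OF M y] UD(2))
    qed (use pos[OF hom] aug_pos[OF hom] in simp)
  qed (simp add: aug_add sact(1)[OF M y] UD(3))
  define g where "g s = counit ?Y (f0 (sact M (aug s) y))" for s
  have gc: "g s \<in> carrier ?Y" for s unfolding g_def by (rule cl(1)[OF f0(1)[OF augU]])
  have g_add: "g (s + s') = add M (g s) (g s')" for s s'
    by (simp add: g_def aug_add sact(1)[OF M y] f0_add augU cl f0(1))
  have g_smul: "g (yscale S c s) = smul M c (g s)" for c s
    by (simp add: g_def aug_smul sact(2)[OF M y] f0_smul augU cl f0(1))
  have g_pos: "g s = counit ?Y (f0 (sact M s y))" if "s \<in> grade S k" "k > 0" for s k
    by (simp add: g_def aug_pos[OF that])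
  obtain n where n: "n > 0" "\<And>k s. n \<le> k \<Longrightarrow> s \<in> grade S k \<Longrightarrow> sact M s y = zero M"
    by (rule integrable_eventually[OF M int y]) blast
  have g_large: "g s = zero M" if "s \<in> grade S k" "n \<le> k" for s k
    using g_pos[OF that(1)] n(1) that n(2)[OF that(2,1)] f0_mu[OF DP(1)] by (simp add: u0 c0)
  obtain B d where B: "finite B" "\<And>b. b \<in> B \<Longrightarrow> d b \<in> R.below n"
    "\<And>s. s \<in> S.below n \<Longrightarrow> (\<Sum>b\<in>B. yscale S (q (d b) s) b) = s"
    using ex_dual_basis[of n] by blast
  \<comment> \<open>The element \<open>t\<close> is the sum of \<open>d b \<otimes> g b\<close> over
    the dual basis, obtained through its values under forms.\<close>
  obtain t where t: "t \<in> carrier (P ?Y)"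
    "\<And>\<Phi>. \<Phi> \<in> forms (P ?Y) \<Longrightarrow> \<Phi> t = (\<Sum>b\<in>B. \<Phi> (p ?Y (d b) (g b)))"
    using ex_sum[OF P B(1), of "\<lambda>b. p ?Y (d b) (g b)"] p_simps(1)[OF Y gc] by blast
  \<comment> \<open>Below degree \<open>n\<close> the dual basis reproduces \<open>s\<close>. From
    degree \<open>n\<close> on both sides vanish, because the \<open>d b\<close> lie below degree
    \<open>n\<close> and such \<open>s\<close> kill \<open>y\<close>.\<close>
  have counit_t: "counit ?Y (sact (RT ?Y) s t) = g s" if s: "s \<in> grade S k" "k > 0" for s k
  proof (rule forms_separate[OF Y])
    show "counit ?Y (sact (RT ?Y) s t) \<in> carrier ?Y" by (intro cl(1) ml(1) t(1))
    fix \<psi> assume \<psi>: "\<psi> \<in> forms ?Y"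
    note \<psi>D = formD[OF \<psi>, simplified]
    have "restrict (\<lambda>m. \<psi> (counit ?Y (sact (RT ?Y) s m))) (carrier (P ?Y)) \<in> forms (P ?Y)"
      by (rule lin_restrictI[OF P]) (simp_all add: ml cl \<psi>D)
    from t(2)[OF this] have "\<psi> (counit ?Y (sact (RT ?Y) s t))
        = (\<Sum>b\<in>B. \<psi> (counit ?Y (sact (RT ?Y) s (p ?Y (d b) (g b)))))"
      by (simp add: t(1) p_simps(1)[OF Y gc])
    also have "\<dots> = (\<Sum>b\<in>B. q (d b) s * \<psi> (g b))"
      by (simp add: sact_p[OF Y gc] counit(2)[OF Y gc] \<psi>D gc q_eq_counit)
    also have "\<dots> = \<psi> (g s)"
    proof (cases "k < n")
      case True
      have lin: "linear_form (yscale S) (\<lambda>s. \<psi> (g s))"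
        by (rule linear_formI[OF S(2)]) (simp_all add: g_add g_smul \<psi>D gc)
      have "s \<in> S.below n" using S.G_subset_below[OF True] s(1) by blast
      then have "\<psi> (g s) = \<psi> (g (\<Sum>b\<in>B. yscale S (q (d b) s) b))" using B(3) by simp
      then show ?thesis by (simp add: linear_sumD[OF lin] linear_scaleD[OF lin])
    next
      case False
      then have "q (d b) s = 0" if "b \<in> B" for b using q_below(2)[OF B(2)[OF that] s(1)] by simp
      moreover have "\<psi> (g s) = 0" using g_large[OF s(1)] False form_zero[OF Y \<psi>] by simp
      ultimately show ?thesis by simp
    qed
    finally show "\<psi> (counit ?Y (sact (RT ?Y) s t)) = \<psi> (g s)" .
  qed (rule gc)
  \<comment> \<open>In \<open>RT_eqI\<close> both sides are moved by a further \<open>s\<close>, and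
    \<open>s * w\<close> has positive degree even for \<open>s\<close> of degree 0, so
    \<open>counit_t\<close> applies.\<close>
  have "sact (RT ?Y) w t = f0 (sact M w y)" if w: "w \<in> grade S 1" for w
  proof (rule RT_eqI[OF Y])
    have wU: "sact M w y \<in> U" using S1[OF w] by (simp add: U_def)
    show "sact (RT ?Y) w t \<in> carrier (P ?Y)" by (rule ml(1)[OF t(1)])
    show fc: "f0 (sact M w y) \<in> carrier (P ?Y)" by (rule f0(1)[OF wU])
    fix s
    show "counit ?Y (sact (RT ?Y) s (sact (RT ?Y) w t)) = counit ?Y (sact (RT ?Y) s (f0 (sact M w y)))"
    proof (induction s rule: S.hom_induct)
      case (hom k s)
      have sw: "s * w \<in> grade S (k + 1)" by (rule S(14)[OF hom w])
      have "sact (RT ?Y) s (f0 (sact M w y)) = f0 (sact M (s * w) y)"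
        using f0_mu[OF ml(1)[OF fc], of "tB 1 s"] f0(2)[OF wU]
        by (simp add: mu_mact[OF M fc] sact(4)[OF M y])
      then show ?case
        using counit_t[OF sw] g_pos[OF sw] t(1) by (simp add: sact(4)[OF RM, symmetric])
    next
      case (add s s')
      then show ?case using t(1) fc sact(1)[OF RM, simplified] by (simp add: cl ml)
    qed
  qed
  then have wt: "sact M w (mu M t) = sact M w y" if "w \<in> grade S 1" for w
    using mu_mact[OF M t(1), of "tB 1 w"] f0(2)[of "sact M w y"] S1[OF that] that by (simp add: U_def)
  let ?z = "add M y (smul M (-1) (mu M t))"
  note b = bilin_mact[OF M]
  have uc: "mu M t \<in> carrier M" using ul(1)[OF t(1)] .
  have "?z \<in> carrier ?Y"
    using y uc by (auto simp: carrier_invariants D(2,7) b wt vspace_neg[OF v])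
  \<comment> \<open>Every invariant lies in the image, being \<open>mu M\<close> of its tensor with
    1; adding \<open>mu M t\<close> back gives \<open>y\<close>.\<close>
  then have "?z \<in> U" unfolding U_def using mu_p_1[OF M] p_simps(1)[OF Y] by (metis imageI)
  then have "add M ?z (mu M t) \<in> U" using t(1) UD(3) unfolding U_def by blast
  also have "add M ?z (mu M t) = add M y (add M (smul M (-1) (mu M t)) (mu M t))"
    using y uc by (simp add: D(2,4,7))
  also have "\<dots> = y"
    using y uc vspace_neg[OF v uc] D(3)[OF D(7)[OF uc] uc] by (simp add: vspace_smul_0[OF v])
  finally show ?thesis by (simp add: U_def)
qed

text \<open>For \<open>m\<close> outside the image, integrability provides a least \<open>n\<close>
  such that \<open>S(n)\<close> moves \<open>m\<close> into the image. Some \<open>s\<close> in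
  \<open>S(n - 1)\<close> still leaves it outside, although \<open>S(1)\<close> then maps the result
  into the image, which \<open>mu_image_step\<close> rules out.\<close>

lemma mu_surj:
  assumes M: "left_module sB M" and int: "integrable S tB M"
  shows "mu M ` carrier (P (invariants S tB M)) = carrier M"
proof -
  let ?U = "mu M ` carrier (P (invariants S tB M))"
  note Y = vspace_invariants[OF M]
  have "m \<in> ?U" if m: "m \<in> carrier M" for m
  proof (rule ccontr)
    assume mU: "m \<notin> ?U"
    let ?Q = "\<lambda>n. \<forall>s\<in>grade S n. sact M s m \<in> ?U"
    have "zero M \<in> ?U"
      using lin_zero[OF vspace_P[OF Y] left_moduleD(1)[OF M] mu(1)[OF M]] vspaceD(1)[OF vspace_P[OF Y]]
      by (metis imageI)
    moreover obtain n where "\<forall>s\<in>grade S n. sact M s m = zero M"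
      using int m unfolding integrable_def by blast
    ultimately have "\<exists>n. ?Q n" by (intro exI[of _ n]) simp
    then obtain n where Q: "?Q n" and min: "\<And>k. k < n \<Longrightarrow> \<not> ?Q k"
      using exists_least_iff[of ?Q] by blast
    have "n \<noteq> 0" using bspec[OF Q, of 1] S(13) mU sact(5)[OF M m] by auto
    then obtain k where k: "n = Suc k" using not0_implies_Suc by blast
    have "\<not> ?Q k" by (rule min) (simp add: k)
    then obtain s where s: "s \<in> grade S k" "sact M s m \<notin> ?U" by blast
    have "sact M s m \<in> ?U"
    proof (rule mu_image_step[OF M int bilin_mact(1)[OF M m]])
      fix w assume "w \<in> grade S 1"
      then have "w * s \<in> grade S n" using S(14)[of w 1 s k] s(1) k by simp
      then show "sact M w (sact M s m) \<in> ?U" using Q by (simp add: sact(4)[OF M m, symmetric])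
    qed
    then show False using s(2) by simp
  qed
  then show ?thesis using linD(1)[OF mu(1)[OF M]] by auto
qed

end

section \<open>The category equivalence\<close>

text \<open>Serves both \<open>Vec\<close> and \<open>cat_O\<close>. Arrows are extensional
  functions, so the restricted composites satisfy the category laws as equations of
  functions.\<close>

lemma category_of_maps:
  assumes "\<And>X Y f. X \<in> Ob \<Longrightarrow> Y \<in> Ob \<Longrightarrow> f \<in> Hom X Y \<Longrightarrow> f \<in> car X \<rightarrow>\<^sub>E car Y"
    "\<And>X. X \<in> Ob \<Longrightarrow> restrict (\<lambda>x. x) (car X) \<in> Hom X X"
    "\<And>X Y Z f g. X \<in> Ob \<Longrightarrow> Y \<in> Ob \<Longrightarrow> Z \<in> Ob \<Longrightarrow> f \<in> Hom X Y \<Longrightarrow> g \<in> Hom Y Z \<Longrightarrow>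
      restrict (g \<circ> f) (car X) \<in> Hom X Z"
  shows "category \<lparr>obj = Ob, hom = Hom, ident = (\<lambda>X. restrict (\<lambda>x. x) (car X)),
     comp = (\<lambda>X Y Z g f. restrict (g \<circ> f) (car X))\<rparr>"
  unfolding category_def cat.select_convs
proof (intro conjI ballI)
  fix X Y f assume "X \<in> Ob" "Y \<in> Ob" "f \<in> Hom X Y"
  then have f: "f \<in> car X \<rightarrow>\<^sub>E car Y" by (rule assms(1))
  then show "restrict (f \<circ> restrict (\<lambda>x. x) (car X)) (car X) = f"
    "restrict (restrict (\<lambda>x. x) (car Y) \<circ> f) (car X) = f"
    by (auto simp: fun_eq_iff PiE_def extensional_def restrict_def)
  fix Z U g h assume "Z \<in> Ob" "U \<in> Ob" "g \<in> Hom Y Z" "h \<in> Hom Z U"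
  show "restrict (h \<circ> restrict (g \<circ> f) (car X)) (car X) = restrict (restrict (h \<circ> g) (car Y) \<circ> f) (car X)"
    using f by (auto simp: fun_eq_iff PiE_def Pi_def restrict_def)
qed (use assms in auto)

lemma lin_PiE: "f \<in> lin X Y \<Longrightarrow> f \<in> carrier X \<rightarrow>\<^sub>E carrier Y"
  by (simp add: lin_def)

lemma lin_ident: "vspace X \<Longrightarrow> restrict (\<lambda>x. x) (carrier X) \<in> lin X X"
  by (rule lin_restrictI) auto

lemma lin_comp: "vspace X \<Longrightarrow> f \<in> lin X Y \<Longrightarrow> g \<in> lin Y Z \<Longrightarrow> restrict (g \<circ> f) (carrier X) \<in> lin X Z"
  by (rule lin_restrictI) (simp_all add: linD(1-3)[of f X Y] linD(1-3)[of g Y Z])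

lemma lin_inverse:
  assumes X: "vspace X" and Y: "vspace Y" and f: "f \<in> lin X Y" "bij_betw f (carrier X) (carrier Y)"
  defines "g \<equiv> restrict (inv_into (carrier X) f) (carrier Y)"
  shows "g \<in> lin Y X" "restrict (g \<circ> f) (carrier X) = restrict (\<lambda>x. x) (carrier X)"
    "restrict (f \<circ> g) (carrier Y) = restrict (\<lambda>y. y) (carrier Y)"
proof -
  note fl = linD(1-3)[OF f(1)]
  have gf: "g (f x) = x" if "x \<in> carrier X" for x
    using that fl(1) bij_betw_imp_inj_on[OF f(2)] by (simp add: g_def)
  have g: "g y \<in> carrier X" "f (g y) = y" if "y \<in> carrier Y" for y
    using that bij_betw_imp_surj_on[OF f(2)]
    by (auto simp: g_def intro: inv_into_into f_inv_into_f)
  show "g \<in> lin Y X"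
  proof (rule linI)
    fix y y' assume y: "y \<in> carrier Y" "y' \<in> carrier Y"
    show "g y \<in> carrier X" using g(1) y by simp
    show "g (add Y y y') = add X (g y) (g y')"
      using gf[of "add X (g y) (g y')"] g[OF y(1)] g[OF y(2)] by (simp add: fl vspaceD(2)[OF X])
    show "g (smul Y c y) = smul X c (g y)" for c
      using gf[of "smul X c (g y)"] g[OF y(1)] by (simp add: fl vspaceD(7)[OF X])
  qed (simp add: g_def)
  show "restrict (g \<circ> f) (carrier X) = restrict (\<lambda>x. x) (carrier X)"
    "restrict (f \<circ> g) (carrier Y) = restrict (\<lambda>y. y) (carrier Y)"
    using gf g by (auto simp: fun_eq_iff restrict_def)
qed

lemma Vec_simps [simp]: "obj Vec = {X. vspace X}" "hom Vec = lin"
  "ident Vec X = restrict (\<lambda>x. x) (carrier X)" "comp Vec X Y Z g f = restrict (g \<circ> f) (carrier X)"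
  by (simp_all add: Vec_def)

lemma cat_O_simps [simp]:
  "obj (cat_O S sB tB) = {M. left_module sB M \<and> integrable S tB M}" "hom (cat_O S sB tB) = mod_hom"
  "ident (cat_O S sB tB) M = restrict (\<lambda>m. m) (carrier M)"
  "comp (cat_O S sB tB) M N Q g f = restrict (g \<circ> f) (carrier M)"
  by (simp_all add: cat_O_def)

lemma category_Vec: "category Vec"
  unfolding Vec_def by (rule category_of_maps) (auto simp: lin_ident lin_comp dest: lin_PiE)

lemma mod_homD:
  assumes "f \<in> mod_hom M N"
  shows "f \<in> lin M N" "m \<in> carrier M \<Longrightarrow> f (mact M b m) = mact N b (f m)"
  using assms by (auto simp: mod_hom_def)

lemma mod_homI:
  "f \<in> lin M N \<Longrightarrow> (\<And>b m. m \<in> carrier M \<Longrightarrow> f (mact M b m) = mact N b (f m)) \<Longrightarrow> f \<in> mod_hom M N"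
  by (simp add: mod_hom_def)

lemma mact_closed: "left_module sB M \<Longrightarrow> m \<in> carrier M \<Longrightarrow> mact M b m \<in> carrier M"
  unfolding left_module_def bilin_def by (fastforce dest: linD(1) simp: full_def)

lemma category_O: "category (cat_O S sB tB)"
  unfolding cat_O_def
proof (rule category_of_maps)
  fix M N f assume f: "f \<in> mod_hom M N"
  show "f \<in> carrier M \<rightarrow>\<^sub>E carrier N" by (rule lin_PiE[OF mod_homD(1)[OF f]])
next
  fix M assume "M \<in> {M. left_module sB M \<and> integrable S tB M}"
  then have M: "left_module sB M" by simp
  show "restrict (\<lambda>x. x) (carrier M) \<in> mod_hom M M"
    using mact_closed[OF M] left_moduleD(1)[OF M] by (intro mod_homI lin_ident) simp_all
next
  fix M N Q f g
  assume "M \<in> {M. left_module sB M \<and> integrable S tB M}" and f: "f \<in> mod_hom M N" and g: "g \<in> mod_hom N Q"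
  then have M: "left_module sB M" by simp
  show "restrict (g \<circ> f) (carrier M) \<in> mod_hom M Q"
  proof (rule mod_homI)
    show "restrict (g \<circ> f) (carrier M) \<in> lin M Q"
      by (rule lin_comp[OF left_moduleD(1)[OF M] mod_homD(1)[OF f] mod_homD(1)[OF g]])
  qed (simp add: mact_closed[OF M] mod_homD(2)[OF f] mod_homD(2)[OF g] linD(1)[OF mod_homD(1)[OF f]])
qed

lemma Vec_isomorphismI:
  assumes "vspace X" "vspace Y" "f \<in> lin X Y" "bij_betw f (carrier X) (carrier Y)"
  shows "isomorphism Vec X Y f"
  unfolding isomorphism_def using lin_inverse[OF assms] assms(3) by auto

lemma cat_O_isomorphismI:
  assumes M: "left_module sB M" and N: "left_module sB N" and f: "f \<in> mod_hom M N"
    and bij: "bij_betw f (carrier M) (carrier N)"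
  shows "isomorphism (cat_O S sB tB) M N f"
proof -
  note v = left_moduleD(1)[OF M] left_moduleD(1)[OF N]
  note inv = lin_inverse[OF v mod_homD(1)[OF f] bij]
  let ?g = "restrict (inv_into (carrier M) f) (carrier N)"
  have "?g \<in> mod_hom N M"
  proof (rule mod_homI[OF inv(1)])
    fix b n assume "n \<in> carrier N"
    then obtain m where m: "m \<in> carrier M" "n = f m" using bij_betw_imp_surj_on[OF bij] by blast
    have gf: "?g (f m) = m" if "m \<in> carrier M" for m
      using that linD(1)[OF mod_homD(1)[OF f]] bij_betw_imp_inj_on[OF bij] by simp
    show "?g (mact N b n) = mact M b (?g n)"
      unfolding m(2) mod_homD(2)[OF f m(1), symmetric] gf[OF m(1)] by (rule gf[OF mact_closed[OF M m(1)]])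
  qed
  then show ?thesis unfolding isomorphism_def using inv f by auto
qed

section \<open>The two functors and the natural isomorphisms\<close>

context q_boson
begin

lemma invariants_hom:
  assumes M: "left_module sB M" and N: "left_module sB N" and f: "f \<in> mod_hom M N"
  shows "m \<in> carrier (invariants S tB M) \<Longrightarrow> f m \<in> carrier (invariants S tB N)"
    and "restrict f (carrier (invariants S tB M)) \<in> lin (invariants S tB M) (invariants S tB N)"
proof -
  note fl = linD(1-3)[OF mod_homD(1)[OF f]]
  show fi: "f m \<in> carrier (invariants S tB N)" if "m \<in> carrier (invariants S tB M)" for m
    using that lin_zero[OF left_moduleD(1)[OF M] left_moduleD(1)[OF N] mod_homD(1)[OF f]]
    by (auto simp: carrier_invariants fl mod_homD(2)[OF f, symmetric])
  show "restrict f (carrier (invariants S tB M)) \<in> lin (invariants S tB M) (invariants S tB N)"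
    by (rule lin_restrictI[OF vspace_invariants[OF M]]) (simp_all add: fi, simp_all add: fl carrier_invariants)
qed

lemma invariants_functor:
  "is_functor (cat_O S sB tB) Vec (invariants_functor S tB :: (('k, 'b, 'u) bmod, 'u \<Rightarrow> 'u, ('k, 'u) vs, 'u \<Rightarrow> 'u) funct)"
  unfolding is_functor_def invariants_functor_def funct.select_convs
proof (intro conjI ballI)
  let ?I = "invariants S tB :: ('k, 'b, 'u) bmod \<Rightarrow> ('k, 'u) vs"
  fix M :: "('k, 'b, 'u) bmod" assume "M \<in> obj (cat_O S sB tB)"
  then have M: "left_module sB M" by simp
  then show "?I M \<in> obj Vec" by (simp add: vspace_invariants)
  show "restrict (ident (cat_O S sB tB) M) (carrier (?I M)) = ident Vec (?I M)"
    by (auto simp: fun_eq_iff carrier_invariants restrict_def)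
  fix N :: "('k, 'b, 'u) bmod" and f assume "N \<in> obj (cat_O S sB tB)" "f \<in> hom (cat_O S sB tB) M N"
  then have N: "left_module sB N" and f: "f \<in> mod_hom M N" by auto
  show "restrict f (carrier (?I M)) \<in> hom Vec (?I M) (?I N)"
    unfolding Vec_simps by (rule invariants_hom(2)[OF M N f])
  fix Q :: "('k, 'b, 'u) bmod" and g
  show "restrict (comp (cat_O S sB tB) M N Q g f) (carrier (?I M)) =
       comp Vec (?I M) (?I N) (?I Q) (restrict g (carrier (?I N))) (restrict f (carrier (?I M)))"
    using invariants_hom(1)[OF M N f] by (auto simp: fun_eq_iff restrict_def carrier_invariants)
qed

end

context q_boson_tensor
begin

abbreviation rmap :: "('k, 'u) vs \<Rightarrow> ('k, 'u) vs \<Rightarrow> ('u \<Rightarrow> 'u) \<Rightarrow> 'u \<Rightarrow> 'u" where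
  "rmap \<equiv> fmap (tensor_functor P p \<rho>)"

lemma rmap:
  assumes Y: "vspace Y" and Z: "vspace Z" and f: "f \<in> lin Y Z"
  shows "rmap Y Z f \<in> lin (P Y) (P Z)" "y \<in> carrier Y \<Longrightarrow> rmap Y Z f (p Y r y) = p Z r (f y)"
proof -
  note fl = linD(1-3)[OF f]
  have F: "(\<lambda>r y. p Z r (f y)) \<in> bilin (full (yscale R)) Y (P Z)"
    by (rule bilinI[OF vspace_R Y]) (auto simp: p_simps[OF Z] fl)
  have "rmap Y Z f = induced P p Y (P Z) (\<lambda>r y. p Z r (f y))" by (simp add: tensor_functor_def)
  then show "rmap Y Z f \<in> lin (P Y) (P Z)" "y \<in> carrier Y \<Longrightarrow> rmap Y Z f (p Y r y) = p Z r (f y)"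
    using induced[OF Y vspace_P[OF Z] F] by auto
qed

lemma tensor_functor: "is_functor Vec (cat_O S sB tB) (tensor_functor P p \<rho>)"
  unfolding is_functor_def
proof (intro conjI ballI)
  fix Y assume "Y \<in> obj (Vec :: (('k, 'u) vs, 'u \<Rightarrow> 'u) cat)"
  then have Y: "vspace Y" by simp
  show "RT Y \<in> obj (cat_O S sB tB)" by (simp add: RT_module[OF Y] RT_integrable[OF Y])
  have id: "restrict (\<lambda>y. y) (carrier Y) \<in> lin Y Y" by (rule lin_ident[OF Y])
  have "rmap Y Y (restrict (\<lambda>y. y) (carrier Y)) = restrict (\<lambda>m. m) (carrier (P Y))"
    by (rule P_lin_eqI[OF Y rmap(1)[OF Y Y id] lin_ident[OF vspace_P[OF Y]]])
       (simp add: rmap(2)[OF Y Y id] p_simps(1)[OF Y])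
  then show "rmap Y Y (ident Vec Y) = ident (cat_O S sB tB) (RT Y)" by simp
  fix Z f assume "Z \<in> obj (Vec :: (('k, 'u) vs, 'u \<Rightarrow> 'u) cat)" "f \<in> hom Vec Y Z"
  then have Z: "vspace Z" and f: "f \<in> lin Y Z" by auto
  note fl = linD(1-3)[OF f] and rf = rmap[OF Y Z f]
  have "rmap Y Z f (mact (RT Y) b m) = mact (RT Z) b (rmap Y Z f m)" if "m \<in> carrier (P Y)" for b m
    using Y that
  proof (induction rule: P_induct)
    case (pure r y)
    then show ?case by (simp add: rf(2) mact_RT(2)[OF Y] mact_RT(2)[OF Z] fl)
  next
    case (add m m')
    then show ?case
      by (simp add: linD(1-3)[OF rf(1)] linD(1-3)[OF mact_RT(1)[OF Y]] linD(1-3)[OF mact_RT(1)[OF Z]])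
  qed
  then show "rmap Y Z f \<in> hom (cat_O S sB tB) (RT Y) (RT Z)"
    unfolding cat_O_simps by (intro mod_homI) (simp_all add: rf(1))
  fix Q g assume "Q \<in> obj (Vec :: (('k, 'u) vs, 'u \<Rightarrow> 'u) cat)" "g \<in> hom Vec Z Q"
  then have Q: "vspace Q" and g: "g \<in> lin Z Q" by auto
  note rg = rmap[OF Z Q g] and gf = lin_comp[OF Y f g]
  have "rmap Y Q (restrict (g \<circ> f) (carrier Y)) = restrict (rmap Z Q g \<circ> rmap Y Z f) (carrier (P Y))"
    by (rule P_lin_eqI[OF Y rmap(1)[OF Y Q gf] lin_comp[OF vspace_P[OF Y] rf(1) rg(1)]])
       (simp add: rmap(2)[OF Y Q gf] rf(2) rg(2) fl p_simps(1)[OF Y])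
  then show "rmap Y Q (comp Vec Y Z Q g f) = comp (cat_O S sB tB) (RT Y) (RT Z) (RT Q) (rmap Z Q g) (rmap Y Z f)"
    by simp
qed

text \<open>Naturality is tested on pure tensors \<open>r \<otimes> y\<close>: both composites give
  \<open>r f(y)\<close>, because \<open>f\<close> commutes with the action of
  \<open>r\<close>.\<close>

lemma mu_natural:
  "natural_isomorphism (cat_O S sB tB) (cat_O S sB tB)
     (fcomp (tensor_functor P p \<rho>) (invariants_functor S tB)) fid mu"
  unfolding natural_isomorphism_def fcomp_def fid_def funct.select_convs
proof (intro conjI ballI)
  let ?I = "invariants S tB :: ('k, 'b, 'u) bmod \<Rightarrow> ('k, 'u) vs"
  have I: "fob (invariants_functor S tB) M = ?I M" for M by (simp add: invariants_functor_def)
  fix M :: "('k, 'b, 'u) bmod" assume "M \<in> obj (cat_O S sB tB)"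
  then have M: "left_module sB M" and iM: "integrable S tB M" by auto
  note YM = vspace_invariants[OF M]
  show "isomorphism (cat_O S sB tB) (RT (fob (invariants_functor S tB) M)) M (mu M)"
    unfolding I
  proof (rule cat_O_isomorphismI[OF RT_module[OF YM] M])
    show "mu M \<in> mod_hom (RT (?I M)) M"
      by (rule mod_homI) (simp_all add: mu(1)[OF M] mu_mact[OF M])
    show "bij_betw (mu M) (carrier (RT (?I M))) (carrier M)"
      using mu_inj[OF M] mu_surj[OF M iM] by (simp add: bij_betw_def)
  qed
  fix N :: "('k, 'b, 'u) bmod" and f assume "N \<in> obj (cat_O S sB tB)" "f \<in> hom (cat_O S sB tB) M N"
  then have N: "left_module sB N" and f: "f \<in> mod_hom M N" by auto
  note YN = vspace_invariants[OF N] and fl = linD(1-3)[OF mod_homD(1)[OF f]]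
  let ?f = "restrict f (carrier (?I M))"
  have f': "?f \<in> lin (?I M) (?I N)"
    by (rule invariants_hom(2)[OF M N f])
  note rf = rmap[OF YM YN f']
  have "restrict (mu N \<circ> rmap (?I M) (?I N) ?f) (carrier (P (?I M))) = restrict (f \<circ> mu M) (carrier (P (?I M)))"
  proof (rule P_lin_eqI[OF YM])
    show "restrict (mu N \<circ> rmap (?I M) (?I N) ?f) (carrier (P (?I M))) \<in> lin (P (?I M)) N"
      by (rule lin_comp[OF vspace_P[OF YM] rf(1) mu(1)[OF N]])
    show "restrict (f \<circ> mu M) (carrier (P (?I M))) \<in> lin (P (?I M)) N"
      by (rule lin_comp[OF vspace_P[OF YM] mu(1)[OF M] mod_homD(1)[OF f]])
    fix r y assume y: "y \<in> carrier (?I M)"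
    then have fy: "f y \<in> carrier (?I N)" using linD(1)[OF f' y] by simp
    have "y \<in> carrier M" using y by (simp add: carrier_invariants)
    then show "restrict (mu N \<circ> rmap (?I M) (?I N) ?f) (carrier (P (?I M))) (p (?I M) r y)
        = restrict (f \<circ> mu M) (carrier (P (?I M))) (p (?I M) r y)"
      using y by (simp add: p_simps(1)[OF YM] rf(2) mu(2)[OF M] mu(2)[OF N fy] mod_homD(2)[OF f])
  qed
  then show "comp (cat_O S sB tB) (RT (fob (invariants_functor S tB) M)) (RT (fob (invariants_functor S tB) N)) N (mu N)
        (rmap (fob (invariants_functor S tB) M) (fob (invariants_functor S tB) N) (fmap (invariants_functor S tB) M N f)) =
       comp (cat_O S sB tB) (RT (fob (invariants_functor S tB) M)) M N f (mu M)"
    by (simp add: invariants_functor_def)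
qed

text \<open>The inverse of the component at \<open>Y\<close> sends \<open>y\<close> to
  \<open>1 \<otimes> y\<close>, by \<open>RT_invariant\<close> and
  \<open>counit_p_1\<close>.\<close>

lemma counit_natural:
  "natural_isomorphism Vec Vec
     (fcomp (invariants_functor S tB) (tensor_functor P p \<rho>)) fid
     (\<lambda>Y. restrict (counit Y) (carrier (invariants S tB (RT Y))))"
  unfolding natural_isomorphism_def fcomp_def fid_def funct.select_convs
proof (intro conjI ballI)
  let ?I = "\<lambda>Y. invariants S tB (RT Y)"
  have I: "fob (invariants_functor S tB) (RT Y) = ?I Y" for Y by (simp add: invariants_functor_def)
  fix Y assume "Y \<in> obj (Vec :: (('k, 'u) vs, 'u \<Rightarrow> 'u) cat)"
  then have Y: "vspace Y" by simp
  note YI = vspace_invariants[OF RT_module[OF Y]] and cl = linD(1-3)[OF counit(1)[OF Y]]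
  have mem: "m \<in> carrier (P Y)" if "m \<in> carrier (?I Y)" for m using that by (simp add: carrier_invariants)
  let ?c = "restrict (counit Y) (carrier (?I Y))"
  show "isomorphism Vec (fob (invariants_functor S tB) (RT Y)) Y ?c"
    unfolding I
  proof (rule Vec_isomorphismI[OF YI Y])
    show "?c \<in> lin (?I Y) Y"
      by (rule lin_restrictI[OF YI]) (simp_all add: mem cl)
    show "bij_betw ?c (carrier (?I Y)) (carrier Y)"
    proof (rule bij_betw_byWitness[where f' = "p Y 1"])
      show "\<forall>m\<in>carrier (?I Y). p Y 1 (?c m) = m" using RT_invariant[OF Y] by simp
      show "\<forall>y\<in>carrier Y. ?c (p Y 1 y) = y" using p_1_invariant[OF Y] counit_p_1[OF Y] by simp
      show "?c ` carrier (?I Y) \<subseteq> carrier Y" using mem cl(1) by auto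
      show "p Y 1 ` carrier Y \<subseteq> carrier (?I Y)" using p_1_invariant[OF Y] by auto
    qed
  qed
  fix Z f assume "Z \<in> obj (Vec :: (('k, 'u) vs, 'u \<Rightarrow> 'u) cat)" "f \<in> hom Vec Y Z"
  then have Z: "vspace Z" and f: "f \<in> lin Y Z" by auto
  have *: "restrict (counit Z) (carrier (?I Z)) (rmap Y Z f m) = f (counit Y m)" if m: "m \<in> carrier (?I Y)" for m
  proof -
    have c: "counit Y m \<in> carrier Y" using cl(1)[OF mem[OF m]] .
    \<comment> \<open>The value of \<open>rmap\<close> is explicit on pure tensors only, and an
      invariant is such a tensor.\<close>
    have "rmap Y Z f m = rmap Y Z f (p Y 1 (counit Y m))" using RT_invariant[OF Y m] by simp
    also have "\<dots> = p Z 1 (f (counit Y m))" by (rule rmap(2)[OF Y Z f c])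
    finally show ?thesis using linD(1)[OF f c] by (simp add: p_1_invariant[OF Z] counit_p_1[OF Z])
  qed
  have fm: "fmap (invariants_functor S tB) (RT Y) (RT Z) (rmap Y Z f) = restrict (rmap Y Z f) (carrier (?I Y))"
    by (simp add: invariants_functor_def)
  show "comp Vec (fob (invariants_functor S tB) (RT Y)) (fob (invariants_functor S tB) (RT Z)) Z
        (restrict (counit Z) (carrier (?I Z))) (fmap (invariants_functor S tB) (RT Y) (RT Z) (rmap Y Z f)) =
       comp Vec (fob (invariants_functor S tB) (RT Y)) Y Z f ?c"
    unfolding I fm Vec_simps by (rule restrict_ext) (simp only: o_apply restrict_apply' *)
qed

lemma quasi_inverse_functors:
  "quasi_inverse (cat_O S sB tB) Vec (invariants_functor S tB) (tensor_functor P p \<rho>)"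
  unfolding quasi_inverse_def
  using category_O category_Vec invariants_functor tensor_functor mu_natural counit_natural by blast

end

theorem theorem3p13:
  fixes J :: "('k::field, 'j::ring_1) hopf"
    and K :: "('k, 'c::ring_1) hopf"
    and \<tau>0 :: "'j \<Rightarrow> 'c \<Rightarrow> 'k"
    and V :: "('k, 'j, 'v::ab_group_add) yd"
    and W :: "('k, 'c, 'w::ab_group_add) yd"
    and \<tau>1 :: "'v \<Rightarrow> 'w \<Rightarrow> 'k"
    and R :: "('k, 'j, 'r::ring_1) graded_yd_bialg" and \<iota>V :: "'v \<Rightarrow> 'r"
    and S :: "('k, 'c, 's::ring_1) graded_yd_bialg" and \<iota>W :: "'w \<Rightarrow> 's"
    and A :: "('k, 'a::ring_1) hopf" and tA :: "'r \<Rightarrow> 'j \<Rightarrow> 'a"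
    and X :: "('k, 'x::ring_1) hopf" and tX :: "'s \<Rightarrow> 'c \<Rightarrow> 'x"
    and \<tau> :: "'a \<Rightarrow> 'x \<Rightarrow> 'k"
    and sB :: "'k \<Rightarrow> 'b::ring_1 \<Rightarrow> 'b" and tB :: "'r \<Rightarrow> 's \<Rightarrow> 'b"
    and \<rho> :: "'b \<Rightarrow> 'r \<Rightarrow> 'r"
    and P :: "('k, 'u) vs \<Rightarrow> ('k, 'u) vs" and p :: "('k, 'u) vs \<Rightarrow> 'r \<Rightarrow> 'u \<Rightarrow> 'u"
  assumes "boson_data J K \<tau>0 V W \<tau>1 R \<iota>V S \<iota>W"
    and "finite_dim (yscale V)" and "finite_dim (yscale W)"
    and "bosonization J R A tA" and "bosonization K S X tX"
    and "extended_pairing \<tau>0 \<tau>1 \<iota>V \<iota>W A tA X tX \<tau>"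
    and "q_boson_algebra J K \<tau>0 V W \<tau>1 R \<iota>V S \<iota>W sB tB"
    and "boson_action R tA tX \<tau> sB tB \<rho>"
    and "tensor_choice R P p"
    and "nondegenerate \<tau>1"
    and "nichols J V R \<iota>V" and "nichols K W S \<iota>W"
  shows "quasi_inverse (cat_O S sB tB) (Vec :: (('k, 'u) vs, 'u \<Rightarrow> 'u) cat)
           (invariants_functor S tB) (tensor_functor P p \<rho>)
         \<and> equivalent_categories (cat_O S sB tB :: (('k, 'b, 'u) bmod, 'u \<Rightarrow> 'u) cat)
             (Vec :: (('k, 'u) vs, 'u \<Rightarrow> 'u) cat)"
proof -
  interpret q_boson_tensor J K \<tau>0 V W \<tau>1 R \<iota>V S \<iota>W A tA X tX \<tau> sB tB \<rho> P p
    using assms by unfold_locales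
  show ?thesis
    using quasi_inverse_functors unfolding equivalent_categories_def by blast
qed

end
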